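(* Let $u\in[\frac12,1)$ and $\mathcal{L}\in\mathcal{N}(u)$. Suppose that the Dirichlet series expansion of $\mathcal{L}$ satisfies the Ramanujan hypothesis. Let $\alpha\in(u,1]$ and $l>0$. (a) If $l\notin\Gamma_P:=\{2\pi k(\log\frac nm)^{-1}:k,n,m\in\mathbb{N},\,n\ne m\}$, then there exists an $l$-set $A\subset[1,\infty)$ of density zero such that, for every $k\in\mathbb{N}$, uniformly for $\sigma\in[\alpha,2]$ and $\lambda\in[0,l]$, $$\lim_{N\to\infty}\frac1N\sum_{n=1}^N|\mathcal{L}(\sigma+i\lambda+inl)|^{2k}\,\mathbf{1}_{A^c}(nl)=\sum_{n=1}^\infty\frac{|a_k(n)|^2}{n^{2\sigma}}$$ and $$\lim_{N\to\infty}\frac1N\sum_{n=1}^N\mathcal{L}(\sigma+i\lambda+inl)^k\,\mathbf{1}_{A^c}(nl)=a_k(1).$$ (b) Suppose additionally that $\mathcal{L}$ can be written as a polynomial Euler product. If $l=2\pi r/\log p$ with some $r\in\mathbb{N}$ and some prime $p$, then there exists an $l$-set $A\subset[1,\infty)$ of density zero such that, for every $k\in\mathbb{N}$, uniformly for $\sigma\in[\alpha,2]$ and $\lambda\in[0,l]$, $$\lim_{N\to\infty}\frac1N\sum_{n=1}^N|\mathcal{L}(\sigma+i\lambda+inl)|^{2k}\,\mathbf{1}_{A^c}(nl)=\left|\prod_{j=1}^m\left(1-\frac{\alpha_j(p)}{p^\sigma}\right)^{-2k}\right|\cdot\sum_{n\in\mathbb{N},\,p\nmid n}\frac{|a_k(n)|^2}{n^{2\sigma}}$$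 and $$\lim_{N\to\infty}\frac1N\sum_{n=1}^N\mathcal{L}(\sigma+i\lambda+inl)^k\,\mathbf{1}_{A^c}(nl)=a_k(1)\cdot\prod_{j=1}^m\left(1-\frac{\alpha_j(p)}{p^\sigma}\right)^{-k}.$$ Here the $a_k(n)$ denote the coefficients of the Dirichlet series expansion of $\mathcal{L}^k$ and the $\alpha_j(p)$ the local roots of the polynomial Euler product representation of $\mathcal{L}$.
   Context: $\mathbf{1}_X$ is the indicator function of $X\subset\mathbb{R}$, $X^c=\mathbb{R}\setminus X$, $\mathbb{N}=\{1,2,\dots\}$. For $J\subset\mathbb{N}$, $\mathrm{dens}_*J$ is the lower limit of $\#(J\cap[1,N])/N$ as $N\to\infty$; $\mathrm{dens}\,J$ is the limit if it exists. A set $A\subset[1,\infty)$ is an $l$-set of density zero if $A=\bigcup_{n\in J}[nl,(n+1)l)$ for some $J\subset\mathbb{N}$ with $\mathrm{dens}\,J=0$. The class $\mathcal{N}(u)$, $u\in[\frac12,1)$: functions $\mathcal{L}$ on the half-plane $\sigma>1$ such that (N.1) $\mathcal{L}(s)=\sum_{n\ge1}a(n)n^{-s}$ for $\sigma>1$ with $\sum_n|a(n)|^2n^{-\sigma}<\infty$ for every $\sigma>1$; (N.2) for all $\alpha\in(u,1]$ and $l,\varepsilon>0$ there is $J_\varepsilon\subset\mathbb{N}$ with $\mathrm{dens}_*J_\varepsilon>1-\varepsilon$ such that for every $n\in J_\varepsilon$ the function $s\mapsto\mathcal{L}(s+inl)$ extends to an analytic function on $Q(\alpha,l):=\{\sigma+it:\sigma>\alpha,\,-l<t<2l\}$,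 and the family of these functions, $n\in J_\varepsilon$, is normal in $Q(\alpha,l)$ (every sequence has a subsequence converging locally uniformly in the chordal metric). $\mathcal{L}(\sigma+it)$ denotes the value of the analytic continuation of $\mathcal{L}$. Ramanujan hypothesis: $a(n)\ll_\varepsilon n^\varepsilon$ for every $\varepsilon>0$. Polynomial Euler product: there are $m\in\mathbb{N}$ and complex numbers $\alpha_1(p),\dots,\alpha_m(p)$ (the local roots at $p$) with $\mathcal{L}(s)=\prod_p\prod_{j=1}^m(1-\alpha_j(p)p^{-s})^{-1}$ (over primes $p$) for $\sigma>1$.
   Formalization: In (b) the local factors are taken at p^{σ+iλ} instead of p^σ, since the printed formulas fail for λ≠0 (e.g. for zeta); and for l<1 the inclusion A⊂[1,∞) is not required, as a pole at height below 1 may force removal of finitely many blocks with nl<1. *)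

theory Defs
  imports "HOL-Complex_Analysis.Complex_Analysis" "HOL-Library.Landau_Symbols"
begin

text \<open>Densities of sets of positive integers.\<close>

definition lower_density :: "nat set \<Rightarrow> ereal" where
  "lower_density J = liminf (\<lambda>N. ereal (real (card (J \<inter> {1..N})) / real N))"

definition has_density :: "nat set \<Rightarrow> real \<Rightarrow> bool" where
  "has_density J d \<longleftrightarrow> (\<lambda>N. real (card (J \<inter> {1..N})) / real N) \<longlonglongrightarrow> d"

text \<open>
  Every such set lies in \<open>[l, \<infinity>)\<close>, hence in \<open>[1, \<infinity>)\<close> if \<open>l \<ge> 1\<close>. For \<open>l < 1\<close> the inclusion
  \<open>A \<subseteq> [1, \<infinity>)\<close> is not imposed: it would forbid removing the finitely many \<open>n\<close> with \<open>n l < 1\<close>,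
  and the continuation may have a pole at the height of such a block (for example
  \<open>\<zeta>(s - 3\<i>/4)\<close>, which has its pole at \<open>1 + 3\<i>/4\<close>, with \<open>l = 1/2\<close> and \<open>n = 1\<close>).
\<close>
definition lset_density_zero :: "real \<Rightarrow> real set \<Rightarrow> bool" where
  "lset_density_zero l A \<longleftrightarrow>
     (\<exists>J \<subseteq> {1..}. has_density J 0 \<and> A = (\<Union>n\<in>J. {real n * l ..< real (n + 1) * l}))"

text \<open>
  The Riemann sphere is \<^typ>\<open>complex option\<close>, with \<^term>\<open>None\<close> as the point at infinity.
\<close>
fun chordal :: "complex option \<Rightarrow> complex option \<Rightarrow> real" where
  "chordal (Some z) (Some w) =
     2 * norm (z - w) / (sqrt (1 + (norm z)\<^sup>2) * sqrt (1 + (norm w)\<^sup>2))"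
| "chordal (Some z) None = 2 / sqrt (1 + (norm z)\<^sup>2)"
| "chordal None (Some w) = 2 / sqrt (1 + (norm w)\<^sup>2)"
| "chordal None None = 0"

definition chordal_loc_unif_conv ::
    "complex set \<Rightarrow> (nat \<Rightarrow> complex \<Rightarrow> complex) \<Rightarrow> (complex \<Rightarrow> complex option) \<Rightarrow> bool" where
  "chordal_loc_unif_conv D f g \<longleftrightarrow>
     (\<forall>z\<in>D. \<exists>U. open U \<and> z \<in> U \<and> U \<subseteq> D \<and>
        (\<forall>e>0. \<forall>\<^sub>F j in sequentially. \<forall>w\<in>U. chordal (Some (f j w)) (g w) < e))"

definition normal_family :: "complex set \<Rightarrow> (complex \<Rightarrow> complex) set \<Rightarrow> bool" where
  "normal_family D \<F> \<longleftrightarrow>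
     (\<forall>f. range f \<subseteq> \<F> \<longrightarrow>
        (\<exists>(r :: nat \<Rightarrow> nat) g. strict_mono r \<and> chordal_loc_unif_conv D (f \<circ> r) g))"

text \<open>
  Functions on the half-plane \<open>\<sigma> > 1\<close> are total functions whose values elsewhere are never used.
  The condition \<open>a 0 = 0\<close> makes the coefficient function unique; the term \<open>n = 0\<close> of the series
  vanishes.
\<close>
definition has_dirichlet_series :: "(complex \<Rightarrow> complex) \<Rightarrow> (nat \<Rightarrow> complex) \<Rightarrow> bool" where
  "has_dirichlet_series f a \<longleftrightarrow>
     a 0 = 0 \<and> (\<forall>s. Re s > 1 \<longrightarrow> (\<lambda>n. a n / of_nat n powr s) sums f s)"

definition dirichlet_coeffs :: "(complex \<Rightarrow> complex) \<Rightarrow> nat \<Rightarrow> complex" where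
  "dirichlet_coeffs f = (THE a. has_dirichlet_series f a)"

definition half_strip :: "real \<Rightarrow> real \<Rightarrow> real \<Rightarrow> complex set" where
  "half_strip \<alpha> t\<^sub>1 t\<^sub>2 = {z. Re z > \<alpha> \<and> t\<^sub>1 < Im z \<and> Im z < t\<^sub>2}"

definition class_N :: "real \<Rightarrow> (complex \<Rightarrow> complex) set" where
  "class_N u = {L.
     (\<exists>a. has_dirichlet_series L a \<and>
          (\<forall>\<sigma>>1. summable (\<lambda>n. (norm (a n))\<^sup>2 / real n powr \<sigma>))) \<and>
     (\<forall>\<alpha>\<in>{u<..1}. \<forall>l>0. \<forall>\<epsilon>>0. \<exists>J \<subseteq> {1..}.
        lower_density J > ereal (1 - \<epsilon>) \<and>
        (\<exists>F :: nat \<Rightarrow> complex \<Rightarrow> complex.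
           (\<forall>n\<in>J. F n holomorphic_on half_strip \<alpha> (- l) (2 * l) \<and>
              (\<forall>s\<in>half_strip \<alpha> (- l) (2 * l). Re s > 1 \<longrightarrow>
                 F n s = L (s + \<i> * of_real (real n * l)))) \<and>
           normal_family (half_strip \<alpha> (- l) (2 * l)) (F ` J)))}"

text \<open>
  Analytic continuation from \<open>\<sigma> > 1\<close> leftwards along horizontal half-strips, which are the domains
  occurring in the definition of the class. The value is unique, because two half-strips
  containing \<open>s\<close> meet in a half-strip containing \<open>s\<close>.
\<close>
definition continuation_value :: "(complex \<Rightarrow> complex) \<Rightarrow> complex \<Rightarrow> complex \<Rightarrow> bool" where
  "continuation_value L s w \<longleftrightarrow>
     (\<exists>F \<alpha> t\<^sub>1 t\<^sub>2. s \<in> half_strip \<alpha> t\<^sub>1 t\<^sub>2 \<and> F holomorphic_on half_strip \<alpha> t\<^sub>1 t\<^sub>2 \<and>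
        (\<forall>z\<in>half_strip \<alpha> t\<^sub>1 t\<^sub>2. Re z > 1 \<longrightarrow> F z = L z) \<and> F s = w)"

definition continuable_at :: "(complex \<Rightarrow> complex) \<Rightarrow> complex \<Rightarrow> bool" where
  "continuable_at L s \<longleftrightarrow> (\<exists>w. continuation_value L s w)"

definition continuation :: "(complex \<Rightarrow> complex) \<Rightarrow> complex \<Rightarrow> complex" where
  "continuation L s = (THE w. continuation_value L s w)"

definition ramanujan_hypothesis :: "(complex \<Rightarrow> complex) \<Rightarrow> bool" where
  "ramanujan_hypothesis L \<longleftrightarrow>
     (\<forall>\<epsilon>>0. (\<lambda>n. norm (dirichlet_coeffs L n)) \<in> O(\<lambda>n. real n powr \<epsilon>))"

text \<open>
  \<open>\<rho> j p\<close> is the \<open>j\<close>-th local root at \<open>p\<close>. The product is taken over the primes in increasing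
  order. The denominators are required not to vanish because otherwise the convention
  \<open>inverse 0 = 0\<close> would give a meaning to factors that have none.
\<close>
definition polynomial_euler_product ::
    "(complex \<Rightarrow> complex) \<Rightarrow> nat \<Rightarrow> (nat \<Rightarrow> nat \<Rightarrow> complex) \<Rightarrow> bool" where
  "polynomial_euler_product L m \<rho> \<longleftrightarrow> m \<ge> 1 \<and>
     (\<forall>s. Re s > 1 \<longrightarrow>
        (\<forall>p j. prime p \<longrightarrow> j \<in> {1..m} \<longrightarrow> 1 - \<rho> j p / of_nat p powr s \<noteq> 0) \<and>
        (\<lambda>p. if prime p then \<Prod>j=1..m. inverse (1 - \<rho> j p / of_nat p powr s) else 1)
          has_prod L s)"

definition Gamma_P :: "real set" where
  "Gamma_P = {2 * pi * real k / ln (real n / real m) | k n m :: nat.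
     k \<ge> 1 \<and> n \<ge> 1 \<and> m \<ge> 1 \<and> n \<noteq> m}"

end

theory Submission imports Defs begin

text \<open>
  Removing a set of blocks of density zero replaces every growth condition on \<open>L\<close>: what has to be
  shown is that \<open>L\<close> is, on the remaining blocks, close to the partial sums of its Dirichlet series,
  whose moments are a matter of orthogonality.

  Normality gives local boundedness. The functions \<open>L(s + i n l)\<close> of a normal family are bounded at
  a point with \<open>Re s > 1\<close>, because the Dirichlet series converges absolutely there. By Hurwitz the
  set where a chordal limit is infinite is open and closed, so it is empty and the family is locally
  bounded (\<open>normal_family_imp_locally_bounded\<close>).

  For most \<open>n\<close> the partial sums of \<open>L^k\<close> approximate \<open>L^k\<close> on the whole block. The Ramanujan
  hypothesis makes \<open>\<Sum> |a_k(m)|^2 m^(-2 \<sigma>)\<close> finite for \<open>\<sigma> > 1/2\<close>. Hence the mean square over \<open>n\<close> of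
  the partial sums is bounded independently of their length, and by Cauchy's formula the partial sums
  are bounded, for most \<open>n\<close>, on a rectangle that contains the block and extends to the right of it.
  Their difference from \<open>L^k\<close> is thus bounded on the rectangle and small in its right part; by Montel
  and the identity theorem it is small on the block (\<open>power_mostly_near_dirichlet_poly\<close>).

  Closeness for most \<open>n\<close> says nothing about moments, since the few bad \<open>n\<close> may carry all the mass.
  The exceptional set therefore consists of the \<open>n\<close> at which some \<open>L^k\<close> is not close to a partial sum
  whose length grows slowly with \<open>n\<close>. Partial sums of different lengths differ little in mean
  square, so outside the exceptional set \<open>L^k\<close> is close in mean square to every long partial sum of
  fixed length (\<open>diagonal_approximation\<close>). This gives both moments
  (\<open>moments_along_density_one_set\<close>), provided the characters \<open>n \<mapsto> m^(-i n l)\<close> are distinct for the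
  different \<open>m\<close> that occur in the series.

  For \<open>l \<notin> Gamma_P\<close> they are distinct for all \<open>m\<close>. For \<open>l = 2 \<pi> r / log p\<close> two of them coincide exactly
  if the quotient of the two numbers is a power of \<open>p\<close>; on the other hand the Euler factor at \<open>p\<close> has
  period \<open>i l\<close>. Dividing \<open>L\<close> by this factor leaves a series supported on the integers prime to \<open>p\<close>,
  to which the same result applies, and the factor reappears in the limits. It has no zeros
  or poles in \<open>Re s > 0\<close>, because the Ramanujan hypothesis forces the local roots into the closed unit
  disc (\<open>local_root_norm_le_1\<close>).
\<close>

section \<open>Normal families and local boundedness\<close>

text \<open>
  The third coordinate of the stereographic projection, a continuous real function on the sphere
  that takes the value \<open>1\<close> only at infinity. It turns statements about chordal convergence into
  statements about real functions.
\<close>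
fun height :: "complex option \<Rightarrow> real" where
  "height (Some z) = 1 - 2 / (1 + (norm z)\<^sup>2)"
| "height None = 1"

lemma height_Some_diff_le:
  "\<bar>height (Some z) - height (Some w)\<bar> \<le> chordal (Some z) (Some w)"
proof -
  define x y P where "x = norm z" and "y = norm w" and "P = sqrt (1 + x\<^sup>2) * sqrt (1 + y\<^sup>2)"
  have pos: "1 + x\<^sup>2 > 0" "1 + y\<^sup>2 > 0" by (auto simp: add_pos_nonneg)
  have P: "P > 0" using pos by (simp add: P_def)
  have P2: "P\<^sup>2 = (1 + x\<^sup>2) * (1 + y\<^sup>2)" using pos by (simp add: P_def power_mult_distrib)
  have nn: "x \<ge> 0" "y \<ge> 0" by (auto simp: x_def y_def)
  have "(1 - x * y)\<^sup>2 \<ge> 0" by simp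
  then have "(x + y)\<^sup>2 \<le> P\<^sup>2" unfolding P2 by (simp add: power2_eq_square algebra_simps)
  then have xyP: "x + y \<le> P" using P by (auto intro: power2_le_imp_le[OF _ less_imp_le])
  have "height (Some z) - height (Some w) = 2 * ((x - y) * (x + y)) / P\<^sup>2"
  proof -
    have "1 + x\<^sup>2 \<noteq> 0" "1 + y\<^sup>2 \<noteq> 0" using pos by auto
    then show ?thesis unfolding P2 height.simps x_def[symmetric] y_def[symmetric]
      by (simp add: diff_divide_eq_iff divide_diff_eq_iff diff_frac_eq add_divide_distrib)
        (simp add: field_simps power2_eq_square)
  qed
  also have "\<bar>\<dots>\<bar> = 2 * (\<bar>x - y\<bar> * (x + y)) / P\<^sup>2" using nn by (simp add: abs_mult)
  also have "\<dots> \<le> 2 * (norm (z - w) * P) / P\<^sup>2"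
    using xyP nn P norm_triangle_ineq3[of z w]
    by (intro divide_right_mono mult_left_mono mult_mono) (auto simp: x_def y_def)
  also have "\<dots> = 2 * norm (z - w) / P" using P by (simp add: power2_eq_square)
  finally show ?thesis by (simp add: P_def x_def y_def)
qed

text \<open>
  Coordinates are \<open>1\<close>-Lipschitz for the distance in space, and the chordal metric is that distance.
\<close>
lemma height_diff_le_chordal: "\<bar>height a - height b\<bar> \<le> chordal a b"
proof -
  have le: "2 / (1 + x\<^sup>2) \<le> 2 / sqrt (1 + x\<^sup>2)" for x :: real
  proof -
    have "sqrt (1 + x\<^sup>2) \<ge> 1" by simp
    then have "sqrt (1 + x\<^sup>2) * 1 \<le> sqrt (1 + x\<^sup>2) * sqrt (1 + x\<^sup>2)"
      by (intro mult_left_mono) auto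
    then have "sqrt (1 + x\<^sup>2) \<le> 1 + x\<^sup>2" by (simp add: add_nonneg_nonneg)
    then show ?thesis by (intro divide_left_mono) (auto simp: add_pos_nonneg intro!: mult_pos_pos)
  qed
  show ?thesis
    using height_Some_diff_le le
    by (cases a; cases b) (auto simp del: chordal.simps(1) simp: add_nonneg_nonneg)
qed

text \<open>
  Near a point where the limit is infinite the functions are large, so their reciprocals are bounded
  and zero-free. By Montel the reciprocals have a holomorphic limit, which vanishes at the point;
  by Hurwitz it vanishes identically.
\<close>
lemma height_limit_one_open:
  fixes F :: "nat \<Rightarrow> complex \<Rightarrow> complex"
  assumes hol: "\<And>j. F j holomorphic_on D" and cont: "continuous_on D H" and D: "open D"
    and lim: "open U" "z0 \<in> U" "U \<subseteq> D"
      "uniform_limit U (\<lambda>j w. height (Some (F j w))) H sequentially"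
    and one: "H z0 = 1"
  shows "\<exists>r>0. ball z0 r \<subseteq> D \<and> (\<forall>w\<in>ball z0 r. H w = 1)"
proof -
  have "continuous (at z0) H"
    using cont D lim by (metis continuous_on_eq_continuous_at subsetD)
  then obtain r0 where r0: "r0 > 0" "\<And>w. dist w z0 < r0 \<Longrightarrow> dist (H w) (H z0) < 1/2"
    unfolding continuous_at_eps_delta by (metis half_gt_zero zero_less_one)
  obtain r1 where r1: "r1 > 0" "ball z0 r1 \<subseteq> U" using lim openE by blast
  define r where "r = min r0 r1"
  have r: "r > 0" "ball z0 r \<subseteq> U" "\<And>w. w \<in> ball z0 r \<Longrightarrow> H w > 1/2"
  proof -
    show "r > 0" using r0 r1 by (simp add: r_def)
    show "ball z0 r \<subseteq> U" using r1 by (auto simp: r_def)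
    fix w assume "w \<in> ball z0 r"
    then have "dist (H w) 1 < 1/2" using r0(2)[of w] one by (simp add: r_def dist_commute)
    then show "H w > 1/2" by (simp add: dist_real_def abs_if split: if_splits)
  qed
  have "\<forall>\<^sub>F j in sequentially. \<forall>w\<in>U. dist (height (Some (F j w))) (H w) < 1/2"
    using uniform_limitD[OF lim(4), of "1/2"] by simp
  then obtain j0 where j0: "\<And>j w. j \<ge> j0 \<Longrightarrow> w \<in> U \<Longrightarrow> dist (height (Some (F j w))) (H w) < 1/2"
    unfolding eventually_sequentially by blast
  \<comment> \<open>The shift by \<open>j0\<close> discards the functions that are not yet large near \<open>z0\<close>.\<close>
  define G where "G j w = inverse (F (j + j0) w)" for j w
  have big: "norm (F (j + j0) w) > 1" if "w \<in> ball z0 r" for j w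
  proof -
    have "height (Some (F (j + j0) w)) > 0"
      using j0[of "j + j0" w] r(3)[OF that] r(2) that by (auto simp: dist_real_def abs_if split: if_splits)
    then have "2 / (1 + (norm (F (j + j0) w))\<^sup>2) < 1" by simp
    then have "(norm (F (j + j0) w))\<^sup>2 > 1" by (simp add: divide_simps add_pos_nonneg split: if_splits)
    then show ?thesis by (metis norm_ge_zero not_less power_le_one)
  qed
  have nz: "F (j + j0) w \<noteq> 0" if "w \<in> ball z0 r" for j w using big[OF that, of j] by auto
  have holG: "G j holomorphic_on ball z0 r" for j
  proof -
    have "F (j + j0) holomorphic_on ball z0 r"
      using hol r(2) lim(3) by (meson holomorphic_on_subset order_trans)
    then show ?thesis unfolding G_def using nz by (intro holomorphic_on_inverse) auto
  qed
  have G1: "norm (G j w) \<le> 1" if "w \<in> ball z0 r" for j w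
    using big[OF that, of j] unfolding G_def norm_inverse
    by (metis inverse_le_1_iff less_imp_le)
  obtain q s where q: "q holomorphic_on ball z0 r" "strict_mono (s :: nat \<Rightarrow> nat)"
    "\<And>x. x \<in> ball z0 r \<Longrightarrow> (\<lambda>n. G (s n) x) \<longlonglongrightarrow> q x"
    "\<And>K. \<lbrakk>compact K; K \<subseteq> ball z0 r\<rbrakk> \<Longrightarrow> uniform_limit K (G \<circ> s) q sequentially"
    by (rule Montel[of "ball z0 r" "range G" G]) (use holG in \<open>auto intro!: exI[of _ 1] G1\<close>)
  have Hq: "H w = 1 - 2 * (norm (q w))\<^sup>2 / (1 + (norm (q w))\<^sup>2)" if w: "w \<in> ball z0 r" for w
  proof -
    have "(\<lambda>j. height (Some (F j w))) \<longlonglongrightarrow> H w"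
      using tendsto_uniform_limitI[OF lim(4)] w r(2) by auto
    then have "(\<lambda>j. height (Some (F (j + j0) w))) \<longlonglongrightarrow> H w" by (rule LIMSEQ_ignore_initial_segment)
    then have "((\<lambda>j. height (Some (F (j + j0) w))) \<circ> s) \<longlonglongrightarrow> H w"
      using q(2) by (rule LIMSEQ_subseq_LIMSEQ)
    moreover have "((\<lambda>j. height (Some (F (j + j0) w))) \<circ> s)
        = (\<lambda>j. 1 - 2 * (norm (G (s j) w))\<^sup>2 / (1 + (norm (G (s j) w))\<^sup>2))"
    proof -
      have "2 / (1 + (norm x)\<^sup>2) = 2 * (norm (inverse x))\<^sup>2 / (1 + (norm (inverse x))\<^sup>2)"
        if "x \<noteq> 0" for x :: complex
      proof -
        have "1 + (norm x)\<^sup>2 > 0" "1 + (norm (inverse x))\<^sup>2 > 0" by (simp_all add: add_pos_nonneg)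
        then show ?thesis
          using that by (simp add: frac_eq_eq norm_inverse) (simp add: field_simps)
      qed
      then show ?thesis using nz[OF w] by (auto simp: fun_eq_iff G_def o_def)
    qed
    moreover have "(\<lambda>j. 1 - 2 * (norm (G (s j) w))\<^sup>2 / (1 + (norm (G (s j) w))\<^sup>2))
        \<longlonglongrightarrow> 1 - 2 * (norm (q w))\<^sup>2 / (1 + (norm (q w))\<^sup>2)"
      using q(3)[OF w] by (intro tendsto_intros) (auto simp: add_nonneg_eq_0_iff)
    ultimately show ?thesis by (simp only: LIMSEQ_unique)
  qed
  have z0: "z0 \<in> ball z0 r" using r by simp
  have q0: "q z0 = 0"
    using Hq[OF z0] one by (auto simp: divide_simps add_nonneg_eq_0_iff split: if_splits)
  have "q constant_on ball z0 r"
  proof (rule ccontr)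
    assume "\<not> q constant_on ball z0 r"
    then have "q z0 \<noteq> 0"
      by (intro Hurwitz_no_zeros[of "ball z0 r" "G \<circ> s" q])
        (use holG q z0 nz in \<open>auto simp: G_def\<close>)
    with q0 show False by simp
  qed
  then have "q w = 0" if "w \<in> ball z0 r" for w using that q0 z0 unfolding constant_on_def by metis
  then have "\<forall>w\<in>ball z0 r. H w = 1" using Hq by simp
  then show ?thesis using r lim by blast
qed

text \<open>
  The bound at the single point \<open>z1\<close> excludes the limit \<open>\<infinity>\<close> there, and connectedness of \<open>D\<close>
  spreads this to all of \<open>D\<close>. A sequence that is unbounded on \<open>K\<close> would have a limit of height less
  than \<open>1\<close> on \<open>K\<close>, hence bounded away from \<open>1\<close> by compactness.
\<close>
lemma normal_family_imp_locally_bounded: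
  assumes D: "open D" "connected D" and hol: "\<And>f. f \<in> \<F> \<Longrightarrow> f holomorphic_on D"
    and nf: "normal_family D \<F>" and z1: "z1 \<in> D" and B: "\<And>f. f \<in> \<F> \<Longrightarrow> norm (f z1) \<le> B"
    and K: "compact K" "K \<subseteq> D"
  shows "\<exists>C. \<forall>f\<in>\<F>. \<forall>z\<in>K. norm (f z) \<le> C"
proof (rule ccontr)
  assume neg: "\<not> ?thesis"
  have "\<forall>j::nat. \<exists>f z. f \<in> \<F> \<and> z \<in> K \<and> norm (f z) > real j" using neg by (meson not_le)
  then obtain f z where fz: "\<And>j::nat. f j \<in> \<F>" "\<And>j. z j \<in> K" "\<And>j. norm (f j (z j)) > real j"
    by metis
  obtain r g where r: "strict_mono (r :: nat \<Rightarrow> nat)" and conv: "chordal_loc_unif_conv D (f \<circ> r) g"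
    using nf fz unfolding normal_family_def by blast
  define H where "H w = height (g w)" for w
  have loc: "\<exists>U. open U \<and> w \<in> U \<and> U \<subseteq> D \<and>
      uniform_limit U (\<lambda>j w. height (Some (f (r j) w))) H sequentially" if "w \<in> D" for w
  proof -
    obtain U where U: "open U" "w \<in> U" "U \<subseteq> D"
      "\<And>e. e > 0 \<Longrightarrow> \<forall>\<^sub>F j in sequentially. \<forall>w\<in>U. chordal (Some ((f \<circ> r) j w)) (g w) < e"
      using bspec[OF conv[unfolded chordal_loc_unif_conv_def] \<open>w \<in> D\<close>] by auto
    have "uniform_limit U (\<lambda>j w. height (Some (f (r j) w))) H sequentially"
    proof (rule uniform_limitI)
      fix e :: real assume "e > 0"
      show "\<forall>\<^sub>F j in sequentially. \<forall>w\<in>U. dist (height (Some (f (r j) w))) (H w) < e"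
        using U(4)[OF \<open>e > 0\<close>]
        by eventually_elim
          (auto simp: H_def dist_real_def simp del: height.simps intro: le_less_trans[OF height_diff_le_chordal])
    qed
    with U show ?thesis by blast
  qed
  have holr: "f (r j) holomorphic_on D" for j using hol fz by blast
  have conth: "continuous_on D (\<lambda>w. height (Some (f j w)))" for j
    using holomorphic_on_imp_continuous_on[OF hol[OF fz(1)]]
    by (auto intro!: continuous_intros simp: add_nonneg_eq_0_iff)
  have contH: "continuous_on D H"
  proof (rule continuous_at_imp_continuous_on, rule ballI)
    fix w assume "w \<in> D"
    then obtain U where U: "open U" "w \<in> U" "U \<subseteq> D"
      "uniform_limit U (\<lambda>j w. height (Some (f (r j) w))) H sequentially" using loc by blast
    have "continuous_on U H"
    proof (rule uniform_limit_theorem[OF _ U(4)])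
      show "\<forall>\<^sub>F n in sequentially. continuous_on U (\<lambda>w. height (Some (f (r n) w)))"
        using continuous_on_subset[OF conth U(3)] by (intro always_eventually allI)
    qed simp
    then show "isCont H w" using U by (simp add: continuous_on_eq_continuous_at)
  qed
  \<comment> \<open>The set where the limit is infinite.\<close>
  define E where "E = {w\<in>D. H w = 1}"
  have openE: "open E" unfolding open_contains_ball
  proof
    fix w assume "w \<in> E"
    then have "w \<in> D" "H w = 1" by (auto simp: E_def)
    then obtain U where U: "open U" "w \<in> U" "U \<subseteq> D"
      "uniform_limit U (\<lambda>j w. height (Some (f (r j) w))) H sequentially" using loc by blast
    have "\<exists>r>0. ball w r \<subseteq> D \<and> (\<forall>v\<in>ball w r. H v = 1)"
      using height_limit_one_open[of "\<lambda>j. f (r j)", OF holr contH D(1) U(1,2,3,4) \<open>H w = 1\<close>] .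
    then show "\<exists>e>0. ball w e \<subseteq> E" by (auto simp: E_def)
  qed
  have openE': "open (D \<inter> H -` (- {1}))"
    by (rule continuous_open_preimage[OF contH D(1)]) auto
  have "H z1 < 1"
  proof -
    obtain U where U: "z1 \<in> U" "uniform_limit U (\<lambda>j w. height (Some (f (r j) w))) H sequentially"
      using loc z1 by blast
    then have "(\<lambda>j. height (Some (f (r j) z1))) \<longlonglongrightarrow> H z1"
      using tendsto_uniform_limitI[OF U(2)] by simp
    moreover have "height (Some (f (r j) z1)) \<le> 1 - 2 / (1 + B\<^sup>2)" for j
    proof -
      have "(norm (f (r j) z1))\<^sup>2 \<le> B\<^sup>2" by (rule power_mono[OF B[OF fz(1)] norm_ge_zero])
      then have "2 / (1 + B\<^sup>2) \<le> 2 / (1 + (norm (f (r j) z1))\<^sup>2)"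
        by (intro frac_le) (simp_all add: add_pos_nonneg)
      then show ?thesis by simp
    qed
    ultimately have "H z1 \<le> 1 - 2 / (1 + B\<^sup>2)" by (rule LIMSEQ_le_const2[OF _ exI, OF _ allI, OF _ impI])
    moreover have "2 / (1 + B\<^sup>2) > 0" by (simp add: add_pos_nonneg)
    ultimately show ?thesis by linarith
  qed
  then have "E = {}"
    using connectedD[OF D(2) openE openE'] z1 by (fastforce simp: E_def)
  have "H w \<le> 1" if "w \<in> D" for w
  proof (cases "g w")
    case (Some a) then show ?thesis by (simp add: H_def add_nonneg_nonneg)
  qed (simp add: H_def)
  moreover have "H w \<noteq> 1" if "w \<in> D" for w using \<open>E = {}\<close> that by (auto simp: E_def)
  ultimately have H1: "H w < 1" if "w \<in> D" for w using that by fastforce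
  have "K \<noteq> {}" using fz by blast
  then obtain k where k: "k \<in> K" "\<And>w. w \<in> K \<Longrightarrow> H w \<le> H k"
    using continuous_attains_sup[OF K(1) _ continuous_on_subset[OF contH K(2)]] by blast
  define c where "c = 1 - H k"
  have c: "c > 0" using H1 k K by (auto simp: c_def)
  have "\<exists>U. open U \<and> w \<in> U \<and> (\<forall>\<^sub>F j in sequentially. \<forall>v\<in>U. dist (height (Some (f (r j) v))) (H v) < c/2)"
    if wK: "w \<in> K" for w
  proof -
    obtain V where V: "open V" "w \<in> V"
      "uniform_limit V (\<lambda>j w. height (Some (f (r j) w))) H sequentially"
      using loc[OF subsetD[OF K(2) wK]] by blast
    have "\<forall>\<^sub>F j in sequentially. \<forall>v\<in>V. dist (height (Some (f (r j) v))) (H v) < c/2"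
      by (rule uniform_limitD[OF V(3)]) (use c in simp)
    with V(1,2) show ?thesis by blast
  qed
  then have "\<forall>w\<in>K. \<exists>U. open U \<and> w \<in> U \<and>
     (\<forall>\<^sub>F j in sequentially. \<forall>v\<in>U. dist (height (Some (f (r j) v))) (H v) < c/2)" by (rule ballI)
  from bchoice[OF this] obtain U where "\<forall>w\<in>K. open (U w) \<and> w \<in> U w \<and>
     (\<forall>\<^sub>F j in sequentially. \<forall>v\<in>U w. dist (height (Some (f (r j) v))) (H v) < c/2)" ..
  note U = bspec[OF this]
  obtain T where T: "T \<subseteq> K" "finite T" "K \<subseteq> (\<Union>w\<in>T. U w)"
  proof (rule compactE_image[OF K(1), of K U])
    show "open (U w)" if "w \<in> K" for w using U[OF that] by blast
    show "K \<subseteq> (\<Union>w\<in>K. U w)" using U by blast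
  qed
  have "\<forall>\<^sub>F j in sequentially. \<forall>w\<in>T. \<forall>v\<in>U w. dist (height (Some (f (r j) v))) (H v) < c/2"
  proof (rule eventually_ball_finite[OF T(2)], rule ballI)
    fix w assume "w \<in> T"
    then show "\<forall>\<^sub>F j in sequentially. \<forall>v\<in>U w. dist (height (Some (f (r j) v))) (H v) < c/2"
      using U[of w] T(1) by blast
  qed
  moreover have "\<forall>\<^sub>F j in sequentially. real j > max 1 (4 / c)"
    using eventually_gt_at_top[of "nat \<lceil>max 1 (4/c)\<rceil>"] by eventually_elim linarith
  ultimately have "\<forall>\<^sub>F j :: nat in sequentially. False"
  proof eventually_elim
    case (elim j)
    define v where "v = z (r j)"
    have v: "v \<in> K" using fz by (simp add: v_def)
    then have "dist (height (Some (f (r j) v))) (H v) < c/2" using elim T by blast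
    moreover have "H v \<le> 1 - c" using k(2)[OF v] by (simp add: c_def)
    ultimately have "2 / (1 + (norm (f (r j) v))\<^sup>2) > c/2" by (simp add: dist_real_def abs_if split: if_splits)
    then have "1 + (norm (f (r j) v))\<^sup>2 < 4 / c" using c
      by (simp add: field_simps add_pos_nonneg)
    moreover have "norm (f (r j) v) > real j"
      using fz(3)[of "r j"] seq_suble[OF r, of j] by (simp add: v_def le_less_trans of_nat_mono)
    then have "norm (f (r j) v) > 4 / c" "norm (f (r j) v) > 1" using elim by auto
    moreover have "(norm (f (r j) v))\<^sup>2 \<ge> norm (f (r j) v)"
      using \<open>norm (f (r j) v) > 1\<close> by (intro self_le_power) auto
    ultimately show False by linarith
  qed
  then show False by simp
qed

text \<open>
  A compactness form of the two-constants theorem: a sequence of counterexamples would have, by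
  Montel, a limit that vanishes on \<open>V\<close> and hence on \<open>S\<close>, uniformly on \<open>K\<close>.
\<close>
lemma small_on_open_imp_small_on_compact:
  fixes \<delta> C :: real
  assumes S: "open S" "connected S" and K: "compact K" "K \<subseteq> S"
    and V: "open V" "V \<subseteq> S" "V \<noteq> {}" and \<delta>: "\<delta> > 0"
  shows "\<exists>\<eta>>0. \<forall>f. f holomorphic_on S \<and> (\<forall>z\<in>S. norm (f z) \<le> C) \<and> (\<forall>z\<in>V. norm (f z) \<le> \<eta>)
     \<longrightarrow> (\<forall>z\<in>K. norm (f z) \<le> \<delta>)"
proof (rule ccontr)
  assume neg: "\<not> ?thesis"
  have "\<forall>j::nat. \<exists>f. f holomorphic_on S \<and> (\<forall>z\<in>S. norm (f z) \<le> C) \<and>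
     (\<forall>z\<in>V. norm (f z) \<le> inverse (real (Suc j))) \<and> \<not> (\<forall>z\<in>K. norm (f z) \<le> \<delta>)"
  proof
    fix j :: nat
    have "inverse (real (Suc j)) > 0" by simp
    with neg show "\<exists>f. f holomorphic_on S \<and> (\<forall>z\<in>S. norm (f z) \<le> C) \<and>
     (\<forall>z\<in>V. norm (f z) \<le> inverse (real (Suc j))) \<and> \<not> (\<forall>z\<in>K. norm (f z) \<le> \<delta>)" by blast
  qed
  then obtain f where f: "\<And>j::nat. f j holomorphic_on S" "\<And>j z. z \<in> S \<Longrightarrow> norm (f j z) \<le> C"
    "\<And>j z. z \<in> V \<Longrightarrow> norm (f j z) \<le> inverse (real (Suc j))" "\<And>j. \<not> (\<forall>z\<in>K. norm (f j z) \<le> \<delta>)"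
    by metis
  obtain g s where g: "g holomorphic_on S" "strict_mono (s :: nat \<Rightarrow> nat)"
    "\<And>x. x \<in> S \<Longrightarrow> (\<lambda>n. f (s n) x) \<longlonglongrightarrow> g x"
    "\<And>K. \<lbrakk>compact K; K \<subseteq> S\<rbrakk> \<Longrightarrow> uniform_limit K (f \<circ> s) g sequentially"
    by (rule Montel[of S "range f" f]) (use f(1) S(1) in \<open>auto intro!: exI[of _ C] f(2)\<close>)
  have "g z = 0" if "z \<in> V" for z
  proof -
    have "(\<lambda>n. f n z) \<longlonglongrightarrow> 0"
      by (rule Lim_null_comparison[OF _ LIMSEQ_inverse_real_of_nat]) (use f(3) that in auto)
    then have "((\<lambda>n. f n z) \<circ> s) \<longlonglongrightarrow> 0" using g(2) by (rule LIMSEQ_subseq_LIMSEQ)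
    then show ?thesis using g(3)[of z] V that LIMSEQ_unique by (fastforce simp: o_def)
  qed
  then have g0: "g z = 0" if "z \<in> S" for z
    using analytic_continuation_open[of V S g "\<lambda>_. 0"] V S g(1) that by auto
  have "\<forall>\<^sub>F n in sequentially. \<forall>z\<in>K. dist ((f \<circ> s) n z) (g z) < \<delta>"
    using g(4)[OF K] \<delta> uniform_limitD by blast
  then obtain n where "\<forall>z\<in>K. dist ((f \<circ> s) n z) (g z) < \<delta>"
    unfolding eventually_sequentially by blast
  then have "\<forall>z\<in>K. norm (f (s n) z) \<le> \<delta>" using g0 K by (auto simp: subset_iff less_imp_le)
  with f(4) show False by blast
qed

section \<open>Dirichlet series whose coefficients grow slower than every power\<close>

lemma norm_dirichlet_term:
  "norm (a n / of_nat n powr s :: complex) = norm (a n) / real n powr Re s"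
  by (cases "n = 0") (auto simp: norm_divide norm_powr_real_powr)

text \<open>
  If the earlier coefficients vanish, then \<open>d n\<close> is, up to the factor \<open>n powr \<sigma>\<close>, the negative
  of the rest of the series, which decays relative to \<open>n powr (- \<sigma>)\<close> like a power of \<open>n / (n + 1)\<close> with
  exponent growing with \<open>\<sigma>\<close>. Convergence at one point bounds the coefficients
  by a power, which makes the comparison series summable.
\<close>
lemma dirichlet_coefficients_zero:
  fixes d :: "nat \<Rightarrow> complex"
  assumes d: "\<And>\<sigma>::real. \<sigma> > c \<Longrightarrow> (\<lambda>n. d n / of_nat n powr of_real \<sigma>) sums 0" and n: "n \<ge> 1"
  shows "d n = 0"
  using n
proof (induction n rule: less_induct)
  case (less n)
  define \<sigma>0 where "\<sigma>0 = max c 0 + 1"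
  have "(\<lambda>n. d n / of_nat n powr of_real \<sigma>0) \<longlonglongrightarrow> 0"
    by (rule summable_LIMSEQ_zero, rule sums_summable, rule d) (simp add: \<sigma>0_def)
  then have "Bseq (\<lambda>n. d n / of_nat n powr of_real \<sigma>0)" by (rule convergent_imp_Bseq[OF convergentI])
  then obtain B where B: "B > 0" "\<And>m. norm (d m / of_nat m powr of_real \<sigma>0) \<le> B"
    unfolding Bseq_def by auto
  have dB: "norm (d m) \<le> B * real m powr \<sigma>0" if "m \<ge> 1" for m
    using B(2)[of m] that by (simp add: norm_dirichlet_term divide_simps mult_ac)
  define W where "W = (\<Sum>m. real m powr (-2))"
  have sumW: "summable (\<lambda>m. real m powr (-2))" using summable_real_powr_iff[of "-2"] by simp
  define q where "q = real n / real (Suc n)"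
  have q: "0 < q" "q < 1" using less.prems by (auto simp: q_def)
  define M where "M = B * real n powr (\<sigma>0 + 2) * W"
  have bound: "norm (d n) \<le> M * q ^ j" for j
  proof -
    define \<sigma> where "\<sigma> = \<sigma>0 + 2 + real j"
    define t where "t m = d m / of_nat m powr of_real \<sigma>" for m
    have s0: "t sums 0" unfolding t_def using d[of \<sigma>] by (auto simp: \<sigma>_def \<sigma>0_def)
    have t_zero: "t m = 0" if "m < n" for m
      using less.IH[of m] that by (cases "m = 0") (auto simp: t_def)
    have "(\<lambda>m. t m - (if m = n then t n else 0)) sums (0 - t n)"
      by (intro sums_diff s0 sums_single)
    moreover have bnd: "norm (t m - (if m = n then t n else 0)) \<le> B * q ^ j * real n powr (- real j) * real m powr (-2)" for m
    proof (cases "m \<le> n")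
      case True
      then show ?thesis using t_zero[of m] B q by (cases "m = n") auto
    next
      case False
      then have m: "m \<ge> Suc n" "real m > 0" by auto
      have "norm (t m) = norm (d m) / real m powr \<sigma>" by (simp add: t_def norm_dirichlet_term)
      also have "\<dots> \<le> B * real m powr \<sigma>0 / real m powr \<sigma>" using dB[of m] m by (intro divide_right_mono) auto
      also have "\<dots> = B * real m powr (\<sigma>0 - \<sigma>)" by (simp add: powr_diff)
      also have "\<sigma>0 - \<sigma> = - real j + (-2)" by (simp add: \<sigma>_def)
      also have "B * real m powr (- real j + (-2)) = B * real m powr (- real j) * real m powr (-2)"
        by (subst powr_add) simp
      also have "real m powr (- real j) \<le> real (Suc n) powr (- real j)"
        using m by (intro powr_mono2') auto
      also have "real (Suc n) powr (- real j) = q ^ j * real n powr (- real j)"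
        using less.prems by (simp add: q_def powr_minus powr_realpow power_divide field_simps)
      finally show ?thesis using False B by (simp add: mult_left_mono mult_right_mono mult_ac)
    qed
    ultimately have "norm (0 - t n) \<le> (\<Sum>m. B * q ^ j * real n powr (- real j) * real m powr (-2))"
    proof -
      assume sm: "(\<lambda>m. t m - (if m = n then t n else 0)) sums (0 - t n)"
      have sB: "summable (\<lambda>m. B * q ^ j * real n powr (- real j) * real m powr (-2))"
        by (intro summable_mult sumW)
      have sn: "summable (\<lambda>m. norm (t m - (if m = n then t n else 0)))"
      proof (rule summable_comparison_test'[OF sB, of 0])
        fix m
        show "norm (norm (t m - (if m = n then t n else 0))) \<le> B * q ^ j * real n powr (- real j) * real m powr (-2)"
          unfolding real_norm_def abs_norm_cancel by (rule bnd)
      qed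
      have "norm (0 - t n) \<le> (\<Sum>m. norm (t m - (if m = n then t n else 0)))"
        using summable_norm[OF sn] sums_unique[OF sm] by simp
      also have "\<dots> \<le> (\<Sum>m. B * q ^ j * real n powr (- real j) * real m powr (-2))"
        by (intro suminf_le bnd sn summable_mult sumW)
      finally show ?thesis .
    qed
    also have "\<dots> = B * q ^ j * real n powr (- real j) * W"
      unfolding W_def by (intro suminf_mult sumW)
    finally have "norm (d n) \<le> B * q ^ j * real n powr (- real j) * W * real n powr \<sigma>"
      using less.prems by (simp add: t_def norm_dirichlet_term divide_simps mult_ac)
    also have "\<dots> = M * q ^ j"
      using less.prems by (simp add: M_def \<sigma>_def powr_add powr_minus field_simps)
    finally show ?thesis .
  qed
  have "(\<lambda>j. M * q ^ j) \<longlonglongrightarrow> M * 0" using q by (intro tendsto_intros LIMSEQ_realpow_zero) auto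
  then have "norm (d n) \<le> M * 0" by (rule LIMSEQ_le_const) (use bound in blast)
  then show ?case by simp
qed

lemma dirichlet_coefficients_unique:
  fixes a b :: "nat \<Rightarrow> complex"
  assumes a: "\<And>\<sigma>::real. \<sigma> > c \<Longrightarrow> (\<lambda>n. a n / of_nat n powr of_real \<sigma>) sums f \<sigma>"
    and b: "\<And>\<sigma>::real. \<sigma> > c \<Longrightarrow> (\<lambda>n. b n / of_nat n powr of_real \<sigma>) sums f \<sigma>"
    and zero: "a 0 = b 0"
  shows "a = b"
proof
  fix n
  have "(\<lambda>n. (a n - b n) / of_nat n powr of_real \<sigma>) sums 0" if "\<sigma> > c" for \<sigma> :: real
    using sums_diff[OF a[OF that] b[OF that]] by (simp add: diff_divide_distrib)
  then have "n \<ge> 1 \<Longrightarrow> a n - b n = 0" by (rule dirichlet_coefficients_zero)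
  then show "a n = b n" using zero by (cases "n = 0") auto
qed

lemma dirichlet_coeffs_eqI:
  assumes "has_dirichlet_series f a"
  shows "dirichlet_coeffs f = a"
  unfolding dirichlet_coeffs_def
proof (rule the_equality, rule assms)
  fix b assume b: "has_dirichlet_series f b"
  show "b = a"
  proof (rule dirichlet_coefficients_unique)
    fix \<sigma> :: real assume "1 < \<sigma>"
    then have "Re (of_real \<sigma>) > 1" by simp
    then show "(\<lambda>n. b n / of_nat n powr of_real \<sigma>) sums f (of_real \<sigma>)"
      and "(\<lambda>n. a n / of_nat n powr of_real \<sigma>) sums f (of_real \<sigma>)"
      using b assms unfolding has_dirichlet_series_def by blast+
  qed (use b assms in \<open>simp add: has_dirichlet_series_def\<close>)
qed

definition dirichlet_abs_conv :: "(nat \<Rightarrow> complex) \<Rightarrow> real \<Rightarrow> bool" where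
  "dirichlet_abs_conv a \<sigma> \<longleftrightarrow> (\<lambda>n. norm (a n) / real n powr \<sigma>) summable_on UNIV"

definition dirichlet_sum :: "(nat \<Rightarrow> complex) \<Rightarrow> complex \<Rightarrow> complex" where
  "dirichlet_sum a s = (\<Sum>\<^sub>\<infinity>n. a n / of_nat n powr s)"

lemma dirichlet_has_sum:
  assumes "dirichlet_abs_conv a (Re s)"
  shows "((\<lambda>n. a n / of_nat n powr s) has_sum dirichlet_sum a s) UNIV"
proof -
  have "(\<lambda>n. norm (a n / of_nat n powr s)) summable_on UNIV"
    using assms by (simp add: dirichlet_abs_conv_def norm_dirichlet_term)
  then show ?thesis
    unfolding dirichlet_sum_def by (rule has_sum_infsum[OF Infinite_Sum.abs_summable_summable])
qed

lemma dirichlet_sums: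
  "dirichlet_abs_conv a (Re s) \<Longrightarrow> (\<lambda>n. a n / of_nat n powr s) sums dirichlet_sum a s"
  by (rule has_sum_imp_sums[OF dirichlet_has_sum])

lemma dirichlet_abs_conv_mono:
  assumes "dirichlet_abs_conv a \<sigma>" "\<sigma> \<le> \<tau>"
  shows "dirichlet_abs_conv a \<tau>"
  unfolding dirichlet_abs_conv_def
proof (rule summable_on_comparison_test[OF assms(1)[unfolded dirichlet_abs_conv_def]])
  fix n :: nat
  show "norm (a n) / real n powr \<tau> \<le> norm (a n) / real n powr \<sigma>"
  proof (cases "n = 0")
    case False
    then have "real n powr \<sigma> \<le> real n powr \<tau>" using assms(2) by (intro powr_mono) auto
    then show ?thesis using False by (intro divide_left_mono mult_pos_pos) auto
  qed simp
qed auto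

definition dirichlet_conv :: "(nat \<Rightarrow> complex) \<Rightarrow> (nat \<Rightarrow> complex) \<Rightarrow> nat \<Rightarrow> complex" where
  "dirichlet_conv a b n = (\<Sum>d | d dvd n. a d * b (n div d))"

lemma dirichlet_conv_0 [simp]: "dirichlet_conv a b 0 = 0"
  by (simp add: dirichlet_conv_def)

text \<open>
  The absolutely convergent double series over pairs \<open>(d, e)\<close> is summed along the fibres of
  \<open>(d, e) \<mapsto> d * e\<close>.
\<close>
lemma dirichlet_sum_conv:
  fixes a b :: "nat \<Rightarrow> complex"
  assumes a: "dirichlet_abs_conv a (Re s)" and b: "dirichlet_abs_conv b (Re s)"
  shows "dirichlet_sum (dirichlet_conv a b) s = dirichlet_sum a s * dirichlet_sum b s"
proof -
  define P where "P = {1::nat..}"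
  define f where "f n = a n / of_nat n powr s" for n
  define g where "g n = b n / of_nat n powr s" for n
  define T where "T = Sigma P (\<lambda>n. {d. d dvd n})"
  define h where "h = (\<lambda>(n, d). a d * b (n div d) / of_nat n powr s)"
  have restrict: "(F has_sum S) P \<longleftrightarrow> (F has_sum S) UNIV" if "F 0 = 0"
    for F :: "nat \<Rightarrow> complex" and S
    by (rule has_sum_cong_neutral) (use that in \<open>auto simp: P_def Suc_le_eq\<close>)
  have f: "(f has_sum dirichlet_sum a s) P"
    using dirichlet_has_sum[OF a] restrict[of f] by (simp add: f_def[abs_def])
  have f': "(\<lambda>n. norm (f n)) summable_on P"
    using a unfolding f_def norm_dirichlet_term dirichlet_abs_conv_def
    by (rule summable_on_subset_banach) simp
  have g: "(g has_sum dirichlet_sum b s) P"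
    using dirichlet_has_sum[OF b] restrict[of g] by (simp add: g_def[abs_def])
  have g': "(\<lambda>n. norm (g n)) summable_on P"
    using b unfolding g_def norm_dirichlet_term dirichlet_abs_conv_def
    by (rule summable_on_subset_banach) simp
  have abs: "(\<lambda>x. norm (case x of (m, n) \<Rightarrow> f m * g n)) summable_on P \<times> P"
  proof (subst Infinite_Sum.abs_summable_on_Sigma_iff, intro conjI ballI)
    fix m
    show "(\<lambda>n. norm (case (m, n) of (m, n) \<Rightarrow> f m * g n)) summable_on P"
      using summable_on_cmult_right[OF g', of "norm (f m)"] by (simp add: norm_mult)
  next
    have "(\<lambda>m. norm (f m) * (\<Sum>\<^sub>\<infinity>n\<in>P. norm (g n))) summable_on P"
      by (rule summable_on_cmult_left[OF f'])
    then show "(\<lambda>m. norm (\<Sum>\<^sub>\<infinity>n\<in>P. norm (case (m, n) of (m, n) \<Rightarrow> f m * g n))) summable_on P"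
      by (simp add: norm_mult infsum_cmult_right' infsum_nonneg abs_mult)
  qed
  have prod: "((\<lambda>(m, n). f m * g n) has_sum dirichlet_sum a s * dirichlet_sum b s) (P \<times> P)"
  proof (rule has_sum_SigmaI[where g = "\<lambda>m. f m * dirichlet_sum b s"])
    show "((\<lambda>n. case (m, n) of (m, n) \<Rightarrow> f m * g n) has_sum f m * dirichlet_sum b s) P" for m
      using has_sum_cmult_right[OF g, of "f m"] by simp
    show "((\<lambda>m. f m * dirichlet_sum b s) has_sum dirichlet_sum a s * dirichlet_sum b s) P"
      by (rule has_sum_cmult_left[OF f])
    show "(\<lambda>(m, n). f m * g n) summable_on P \<times> P"
      by (rule Infinite_Sum.abs_summable_summable[OF abs])
  qed
  have val: "h (m * n, m) = f m * g n" if "m \<in> P" "n \<in> P" for m n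
    using that by (auto simp: h_def f_def g_def P_def powr_times_real)
  have bij: "(F has_sum S) (P \<times> P) \<longleftrightarrow> (G has_sum S) T"
    if "\<And>m n. m \<in> P \<Longrightarrow> n \<in> P \<Longrightarrow> G (m * n, m) = F (m, n)"
    for F G :: "nat \<times> nat \<Rightarrow> 'x :: {comm_monoid_add, topological_space}" and S
    by (rule has_sum_reindex_bij_witness[where i = "\<lambda>(n, d). (d, n div d)" and j = "\<lambda>(m, k). (m * k, m)"])
      (use that in \<open>auto simp: T_def P_def Suc_le_eq elim!: dvdE\<close>)
  have hT: "(h has_sum dirichlet_sum a s * dirichlet_sum b s) T"
    by (rule bij[THEN iffD1, OF _ prod]) (use val in auto)
  have fin: "finite {d. d dvd n}" if "n \<in> P" for n :: nat using that by (auto simp: P_def)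
  have inner: "(\<Sum>d | d dvd n. h (n, d)) = dirichlet_conv a b n / of_nat n powr s" for n
    by (simp add: h_def dirichlet_conv_def sum_divide_distrib)
  have "((\<lambda>n. dirichlet_conv a b n / of_nat n powr s) has_sum dirichlet_sum a s * dirichlet_sum b s) P"
    by (rule has_sum_Sigma'[OF hT[unfolded T_def]])
      (use fin in \<open>auto simp: inner[symmetric] intro!: has_sum_finite\<close>)
  then have "((\<lambda>n. dirichlet_conv a b n / of_nat n powr s) has_sum dirichlet_sum a s * dirichlet_sum b s) UNIV"
    by (subst (asm) restrict) auto
  then show ?thesis
    unfolding dirichlet_sum_def by (rule infsumI)
qed

lemma card_divisors_mult_le:
  fixes x y :: nat
  assumes "x > 0" "y > 0"
  shows "card {d. d dvd x * y} \<le> card {d. d dvd x} * card {d. d dvd y}"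
proof -
  have "{d. d dvd x * y} \<subseteq> (\<lambda>(b, c). b * c) ` ({d. d dvd x} \<times> {d. d dvd y})"
  proof
    fix d assume "d \<in> {d. d dvd x * y}"
    then obtain b c where "d = b * c" "b dvd x" "c dvd y" using division_decomp[of d x y] by auto
    then show "d \<in> (\<lambda>(b, c). b * c) ` ({d. d dvd x} \<times> {d. d dvd y})" by auto
  qed
  then have "card {d. d dvd x * y} \<le> card ((\<lambda>(b, c). b * c) ` ({d. d dvd x} \<times> {d. d dvd y}))"
    using assms by (intro card_mono) auto
  also have "\<dots> \<le> card ({d. d dvd x} \<times> {d. d dvd y})" using assms by (intro card_image_le) auto
  finally show ?thesis by (simp add: card_cartesian_product)
qed

lemma card_divisors_prime_power:
  fixes p :: nat
  assumes "prime p"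
  shows "card {d. d dvd p ^ a} \<le> a + 1"
proof -
  have "{d. d dvd p ^ a} = (\<lambda>i. p ^ i) ` {..a}"
    using divides_primepow_nat[OF assms] by auto
  then have "card {d. d dvd p ^ a} \<le> card {..a}" by (metis card_image_le finite_atMost)
  then show ?thesis by simp
qed

text \<open>
  Each prime power \<open>p ^ a\<close> exactly dividing \<open>n\<close> contributes a factor \<open>a + 1\<close> to the number of divisors.
  If \<open>p powr \<epsilon> \<ge> 2\<close> this is at most \<open>(p ^ a) powr \<epsilon>\<close>; for the finitely many smaller primes it
  is so up to a constant that does not depend on \<open>a\<close>.
\<close>
lemma divisor_bound:
  fixes \<epsilon> :: real
  assumes \<epsilon>: "\<epsilon> > 0"
  shows "\<exists>C. \<forall>n\<ge>1. real (card {d. d dvd n}) \<le> C * real n powr \<epsilon>"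
proof -
  \<comment> \<open>Primes from \<open>P\<close> on satisfy \<open>p powr \<epsilon> \<ge> 2\<close>; \<open>C\<close> is the factor lost at each smaller prime.\<close>
  define P where "P = nat \<lceil>2 powr (1 / \<epsilon>)\<rceil>"
  define C where "C = max 1 (1 / (\<epsilon> * ln 2))"
  define h where "h p = (if p < P then C else 1)" for p
  have C: "C \<ge> 1" "C * (\<epsilon> * ln 2) \<ge> 1"
  proof -
    show "C \<ge> 1" by (simp add: C_def)
    have "1 / (\<epsilon> * ln 2) * (\<epsilon> * ln 2) \<le> C * (\<epsilon> * ln 2)"
      using \<epsilon> by (intro mult_right_mono) (auto simp: C_def)
    then show "C * (\<epsilon> * ln 2) \<ge> 1" using \<epsilon> by simp
  qed
  have h1: "h p \<ge> 1" for p using C by (simp add: h_def)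
  have key: "real a + 1 \<le> h p * real p powr (real a * \<epsilon>)" if "prime p" for p a
  proof (cases "p < P")
    case True
    have "real a * \<epsilon> * ln 2 + 1 \<le> exp (real a * \<epsilon> * ln 2)" by (subst add.commute) (rule exp_ge_add_one_self)
    also have "\<dots> = 2 powr (real a * \<epsilon>)" by (simp add: powr_def)
    also have "\<dots> \<le> real p powr (real a * \<epsilon>)"
      using prime_ge_2_nat[OF that] \<epsilon> by (intro powr_mono2) auto
    finally have "C * (real a * \<epsilon> * ln 2 + 1) \<le> C * real p powr (real a * \<epsilon>)"
      using C by (intro mult_left_mono) auto
    moreover have "C * (real a * \<epsilon> * ln 2 + 1) \<ge> real a * 1 + 1"
    proof -
      have "C * (real a * \<epsilon> * ln 2 + 1) = real a * (C * (\<epsilon> * ln 2)) + C" by (simp add: algebra_simps)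
      also have "\<dots> \<ge> real a * 1 + 1" using C by (intro add_mono mult_left_mono) auto
      finally show ?thesis .
    qed
    ultimately show ?thesis using True by (simp add: h_def)
  next
    case False
    then have "2 powr (1 / \<epsilon>) \<le> real p" unfolding P_def by linarith
    then have "(2 powr (1 / \<epsilon>)) powr (real a * \<epsilon>) \<le> real p powr (real a * \<epsilon>)"
      using \<epsilon> by (intro powr_mono2) auto
    then have "2 ^ a \<le> real p powr (real a * \<epsilon>)" using \<epsilon> by (simp add: powr_powr powr_realpow)
    moreover have "real a + 1 \<le> 2 ^ a"
    proof -
      have "Suc a \<le> 2 ^ a" by (induction a) auto
      then have "real (Suc a) \<le> real (2 ^ a)" by (rule of_nat_mono)
      then show ?thesis by simp
    qed
    ultimately show ?thesis using False by (simp add: h_def)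
  qed
  have main: "real (card {d. d dvd n}) \<le> (\<Prod>p\<in>prime_factors n. h p) * real n powr \<epsilon>" if "n \<ge> 1" for n :: nat
    using that
  proof (induction n rule: less_induct)
    case (less n)
    show ?case
    proof (cases "n = 1")
      case True then show ?thesis by simp
    next
      case False
      then obtain p where p: "prime p" "p dvd n" using less.prems prime_factor_nat by blast
      obtain m where m: "n = p ^ multiplicity p n * m" "\<not> p dvd m"
        using multiplicity_decompose'[of n p] p less.prems by (metis not_one_le_zero not_prime_unit)
      define a where "a = multiplicity p n"
      have n: "n = p ^ a * m" and m0: "m > 0" using m by (auto simp: a_def intro: Nat.gr0I)
      have a: "a \<ge> 1" using p less.prems by (simp add: a_def multiplicity_geI[of n p 1] Suc_le_eq prime_multiplicity_gt_zero_iff)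
      have "p ^ a > 1" using a p by (intro one_less_power prime_gt_1_nat) auto
      then have mn: "m < n" using m0 n by simp
      have pf: "prime_factors n = insert p (prime_factors m)" "p \<notin> prime_factors m"
        using p m m0 n a by (auto simp: prime_factors_product prime_factorization_prime_power prime_factors_dvd prime_dvd_power_iff dest: prime_dvd_power prime_dvd_multD primes_dvd_imp_eq)
      have "real (card {d. d dvd n}) \<le> real (card {d. d dvd p ^ a}) * real (card {d. d dvd m})"
        using card_divisors_mult_le[of "p ^ a" m] p m0 n by (metis of_nat_le_iff of_nat_mult prime_gt_0_nat zero_less_power)
      also have "\<dots> \<le> (h p * real p powr (real a * \<epsilon>)) * ((\<Prod>p\<in>prime_factors m. h p) * real m powr \<epsilon>)"
      proof (intro mult_mono)
        have "real (card {d. d dvd p ^ a}) \<le> real a + 1" using card_divisors_prime_power[OF p(1), of a] by simp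
        also note key[OF p(1), of a]
        finally show "real (card {d. d dvd p ^ a}) \<le> h p * real p powr (real a * \<epsilon>)" .
        show "real (card {d. d dvd m}) \<le> (\<Prod>p\<in>prime_factors m. h p) * real m powr \<epsilon>"
          using less.IH[OF mn] m0 by simp
        have "h p \<ge> 0" using h1[of p] by simp
        then show "0 \<le> h p * real p powr (real a * \<epsilon>)" by simp
      qed simp
      also have "\<dots> = (\<Prod>p\<in>prime_factors n. h p) * real n powr \<epsilon>"
      proof -
        have "real n powr \<epsilon> = real p powr (real a * \<epsilon>) * real m powr \<epsilon>"
          using prime_gt_0_nat[OF p(1)] by (simp add: n powr_mult powr_realpow[symmetric] powr_powr)
        then show ?thesis using pf by (simp add: mult_ac)
      qed
      finally show ?thesis .
    qed
  qed
  have "real (card {d. d dvd n}) \<le> (\<Prod>p<P. C) * real n powr \<epsilon>" if n: "n \<ge> 1" for n :: nat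
  proof -
    have "(\<Prod>p\<in>prime_factors n. h p) \<le> (\<Prod>p\<in>prime_factors n \<union> {..<P}. h p)"
      using h1 by (intro prod_mono2) (auto intro: order_trans[OF zero_le_one])
    also have "\<dots> = (\<Prod>p<P. h p)" by (rule prod.mono_neutral_right) (auto simp: h_def)
    also have "\<dots> = (\<Prod>p<P. C)" by (simp add: h_def)
    finally show ?thesis using main[OF n] by (meson mult_right_mono order_trans powr_ge_zero)
  qed
  then show ?thesis by blast
qed

text \<open>
  The Ramanujan hypothesis as a property of the coefficients, with a bound from the first
  coefficient on instead of an asymptotic one.
\<close>
definition ramanujan_bounded :: "(nat \<Rightarrow> complex) \<Rightarrow> bool" where
  "ramanujan_bounded a \<longleftrightarrow> a 0 = 0 \<and> (\<forall>\<epsilon>>0. \<exists>C. \<forall>n\<ge>1. norm (a n) \<le> C * real n powr \<epsilon>)"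

lemma ramanujan_bounded_conv:
  assumes "ramanujan_bounded a" "ramanujan_bounded b"
  shows "ramanujan_bounded (dirichlet_conv a b)"
  unfolding ramanujan_bounded_def
proof (intro conjI allI impI)
  fix \<epsilon> :: real assume "\<epsilon> > 0"
  then have e: "\<epsilon> / 2 > 0" by simp
  obtain A where A: "\<And>n. n \<ge> 1 \<Longrightarrow> norm (a n) \<le> A * real n powr (\<epsilon> / 2)"
    using assms(1) e unfolding ramanujan_bounded_def by blast
  obtain B where B: "\<And>n. n \<ge> 1 \<Longrightarrow> norm (b n) \<le> B * real n powr (\<epsilon> / 2)"
    using assms(2) e unfolding ramanujan_bounded_def by blast
  obtain D where D: "\<And>n. n \<ge> 1 \<Longrightarrow> real (card {d. d dvd n}) \<le> D * real n powr (\<epsilon> / 2)"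
    using divisor_bound[OF e] by blast
  have A0: "A \<ge> 0" using A[of 1] by (simp add: order_trans[OF norm_ge_zero])
  have B0: "B \<ge> 0" using B[of 1] by (simp add: order_trans[OF norm_ge_zero])
  have "norm (dirichlet_conv a b n) \<le> (A * B * D) * real n powr \<epsilon>" if n: "n \<ge> 1" for n
  proof -
    have "norm (dirichlet_conv a b n) \<le> (\<Sum>d | d dvd n. A * B * real n powr (\<epsilon> / 2))"
      unfolding dirichlet_conv_def
    proof (rule sum_norm_le)
      fix d assume "d \<in> {d. d dvd n}"
      then obtain e where e: "n = d * e" by auto
      then have de: "d \<ge> 1" "e \<ge> 1" using n by (auto intro: Nat.gr0I simp: Suc_le_eq)
      have "norm (a d * b (n div d)) = norm (a d) * norm (b e)" using e de by (simp add: norm_mult)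
      also have "\<dots> \<le> (A * real d powr (\<epsilon> / 2)) * (B * real e powr (\<epsilon> / 2))"
        using A[OF de(1)] B[OF de(2)] A0 by (intro mult_mono) auto
      also have "\<dots> = A * B * real n powr (\<epsilon> / 2)" by (simp add: e powr_mult)
      finally show "norm (a d * b (n div d)) \<le> A * B * real n powr (\<epsilon> / 2)" .
    qed
    also have "\<dots> = A * B * real n powr (\<epsilon> / 2) * real (card {d. d dvd n})" by simp
    also have "\<dots> \<le> A * B * real n powr (\<epsilon> / 2) * (D * real n powr (\<epsilon> / 2))"
      using D[OF n] A0 B0 by (intro mult_left_mono) auto
    also have "\<dots> = A * B * D * (real n powr (\<epsilon> / 2) * real n powr (\<epsilon> / 2))" by (simp add: mult_ac)
    also have "real n powr (\<epsilon> / 2) * real n powr (\<epsilon> / 2) = real n powr \<epsilon>"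
      by (simp add: powr_add[symmetric])
    finally show ?thesis .
  qed
  then show "\<exists>C. \<forall>n\<ge>1. norm (dirichlet_conv a b n) \<le> C * real n powr \<epsilon>" by blast
qed simp

lemma summable_on_nat_powr: "\<sigma> > 1 \<Longrightarrow> (\<lambda>n. C / real n powr \<sigma>) summable_on (UNIV :: nat set)"
  using summable_nonneg_imp_summable_on[of "\<lambda>n. real n powr (- \<sigma>)"] summable_real_powr_iff[of "- \<sigma>"]
  by (auto simp: powr_minus divide_inverse intro: summable_on_cmult_right)

lemma ramanujan_bounded_abs_conv:
  assumes "ramanujan_bounded a" "\<sigma> > 1"
  shows "dirichlet_abs_conv a \<sigma>"
proof -
  define \<epsilon> where "\<epsilon> = (\<sigma> - 1) / 2"
  have "\<epsilon> > 0" using assms by (simp add: \<epsilon>_def)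
  then obtain C where C: "\<And>n. n \<ge> 1 \<Longrightarrow> norm (a n) \<le> C * real n powr \<epsilon>"
    using assms(1) unfolding ramanujan_bounded_def by blast
  have "(\<lambda>n. C / real n powr (\<sigma> - \<epsilon>)) summable_on (UNIV :: nat set)"
    using assms(2) by (intro summable_on_nat_powr) (simp add: \<epsilon>_def field_simps)
  then show ?thesis unfolding dirichlet_abs_conv_def
  proof (rule summable_on_comparison_test)
    fix n :: nat
    show "norm (a n) / real n powr \<sigma> \<le> C / real n powr (\<sigma> - \<epsilon>)"
      using C[of n] by (cases "n = 0") (auto simp: powr_diff field_simps Suc_le_eq)
  qed auto
qed

lemma ramanujan_bounded_square_summable:
  assumes "ramanujan_bounded a" "\<sigma> > 1 / 2"
  shows "(\<lambda>n. (norm (a n))\<^sup>2 / real n powr (2 * \<sigma>)) summable_on UNIV"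
proof -
  define \<epsilon> where "\<epsilon> = (2 * \<sigma> - 1) / 4"
  have "\<epsilon> > 0" using assms by (simp add: \<epsilon>_def)
  then obtain C where C: "\<And>n. n \<ge> 1 \<Longrightarrow> norm (a n) \<le> C * real n powr \<epsilon>"
    using assms(1) unfolding ramanujan_bounded_def by blast
  have "(\<lambda>n. C\<^sup>2 / real n powr (2 * \<sigma> - 2 * \<epsilon>)) summable_on (UNIV :: nat set)"
    using assms(2) by (intro summable_on_nat_powr) (simp add: \<epsilon>_def field_simps)
  then show ?thesis
  proof (rule summable_on_comparison_test)
    fix n :: nat
    show "(norm (a n))\<^sup>2 / real n powr (2 * \<sigma>) \<le> C\<^sup>2 / real n powr (2 * \<sigma> - 2 * \<epsilon>)"
    proof (cases "n = 0")
      case False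
      then have "(norm (a n))\<^sup>2 \<le> (C * real n powr \<epsilon>)\<^sup>2" using C[of n] by (intro power_mono) auto
      also have "\<dots> = C\<^sup>2 * real n powr (2 * \<epsilon>)"
        by (simp add: power_mult_distrib power2_eq_square powr_add[symmetric])
      finally show ?thesis using False by (simp add: powr_diff field_simps)
    qed simp
  qed auto
qed

primrec dirichlet_pow :: "(nat \<Rightarrow> complex) \<Rightarrow> nat \<Rightarrow> nat \<Rightarrow> complex" where
  "dirichlet_pow a 0 = (\<lambda>n. if n = 1 then 1 else 0)"
| "dirichlet_pow a (Suc k) = dirichlet_conv a (dirichlet_pow a k)"

lemma ramanujan_bounded_pow:
  assumes "ramanujan_bounded a"
  shows "ramanujan_bounded (dirichlet_pow a k)"
proof (induction k)
  case 0
  have "norm (if n = 1 then 1 else 0 :: complex) \<le> 1 * real n powr \<epsilon>" if "n \<ge> 1" "\<epsilon> > 0" for n \<epsilon>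
    using that by auto
  then show ?case unfolding ramanujan_bounded_def by auto
qed (auto intro: ramanujan_bounded_conv assms)

lemma dirichlet_sum_pow:
  assumes "ramanujan_bounded a" "Re s > 1"
  shows "dirichlet_sum (dirichlet_pow a k) s = dirichlet_sum a s ^ k"
proof (induction k)
  case 0
  have "((\<lambda>n. (if n = 1 then 1 else 0) / of_nat n powr s) has_sum (\<Sum>n\<in>{1::nat}. 1)) UNIV"
    by (subst has_sum_cong_neutral[where T = "{1}" and g = "\<lambda>_. 1"]) (auto intro!: has_sum_finiteI)
  then show ?case unfolding dirichlet_sum_def by (simp add: infsumI)
next
  case (Suc k)
  then show ?case using assms
    by (simp add: dirichlet_sum_conv ramanujan_bounded_abs_conv ramanujan_bounded_pow)
qed

lemma ramanujan_bounded_has_dirichlet_series: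
  assumes "ramanujan_bounded a" "\<And>s. Re s > 1 \<Longrightarrow> f s = dirichlet_sum a s"
  shows "has_dirichlet_series f a"
  using assms dirichlet_sums[OF ramanujan_bounded_abs_conv[OF assms(1)]]
  by (auto simp: has_dirichlet_series_def ramanujan_bounded_def)

lemma has_dirichlet_series_imp_dirichlet_sum:
  assumes "has_dirichlet_series f a" "ramanujan_bounded a" "Re s > 1"
  shows "f s = dirichlet_sum a s"
  using assms dirichlet_sums[OF ramanujan_bounded_abs_conv[OF assms(2,3)]]
  by (auto simp: has_dirichlet_series_def intro: sums_unique2)

lemma dirichlet_coeffs_power:
  assumes "has_dirichlet_series f a" "ramanujan_bounded a"
  shows "dirichlet_coeffs (\<lambda>s. f s ^ k) = dirichlet_pow a k"
  using assms by (intro dirichlet_coeffs_eqI ramanujan_bounded_has_dirichlet_series)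
    (auto simp: ramanujan_bounded_pow dirichlet_sum_pow has_dirichlet_series_imp_dirichlet_sum)

lemma ramanujan_hypothesis_imp_bounded:
  assumes "ramanujan_hypothesis f" "has_dirichlet_series f a"
  shows "ramanujan_bounded a"
  unfolding ramanujan_bounded_def
proof (intro conjI allI impI)
  show "a 0 = 0" using assms(2) by (simp add: has_dirichlet_series_def)
  fix \<epsilon> :: real assume "\<epsilon> > 0"
  then have "(\<lambda>n. norm (a n)) \<in> O(\<lambda>n. real n powr \<epsilon>)"
    using assms dirichlet_coeffs_eqI[OF assms(2)] by (simp add: ramanujan_hypothesis_def)
  then obtain c where "eventually (\<lambda>n. norm (norm (a n)) \<le> c * norm (real n powr \<epsilon>)) sequentially"
    by (elim landau_o.bigE)
  then obtain N where N: "\<And>n. n \<ge> N \<Longrightarrow> norm (a n) \<le> c * real n powr \<epsilon>"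
    by (auto simp: eventually_sequentially)
  define C where "C = \<bar>c\<bar> + (\<Sum>m<N. norm (a m))"
  have "norm (a n) \<le> C * real n powr \<epsilon>" if n: "n \<ge> 1" for n
  proof (cases "n < N")
    case True
    have "norm (a n) \<le> (\<Sum>m<N. norm (a m))" using True by (intro member_le_sum) auto
    also have "\<dots> \<le> C * 1" by (simp add: C_def)
    also have "\<dots> \<le> C * real n powr \<epsilon>"
      using n \<open>\<epsilon> > 0\<close> by (intro mult_left_mono) (auto simp: C_def ge_one_powr_ge_zero sum_nonneg add_nonneg_nonneg)
    finally show ?thesis .
  next
    case False
    then have "norm (a n) \<le> c * real n powr \<epsilon>" using N by simp
    also have "\<dots> \<le> C * real n powr \<epsilon>"
      by (intro mult_right_mono) (auto simp: C_def intro!: order_trans[OF abs_ge_self[of c]] sum_nonneg)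
    finally show ?thesis .
  qed
  then show "\<exists>C. \<forall>n\<ge>1. norm (a n) \<le> C * real n powr \<epsilon>" by blast
qed

section \<open>Mean values of Dirichlet polynomials along vertical shifts\<close>

text \<open>
  The characters \<open>n \<mapsto> m^(-i n l)\<close> for \<open>m \<in> S\<close> are pairwise distinct. This is what makes them
  orthogonal in the mean over \<open>n\<close>.
\<close>
definition frequency_independent :: "real \<Rightarrow> nat set \<Rightarrow> bool" where
  "frequency_independent l S \<longleftrightarrow> S \<subseteq> {1..} \<and>
     (\<forall>m\<in>S. \<forall>n\<in>S. m \<noteq> n \<longrightarrow> (\<forall>z::int. l * (ln (real m) - ln (real n)) \<noteq> 2 * pi * of_int z))"

lemma frequency_independentD:
  assumes "frequency_independent l S" "m \<in> S" "n \<in> S" "m \<noteq> n"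
  shows "l * (ln (real m) - ln (real n)) \<noteq> 2 * pi * of_int z"
  using assms(1)[unfolded frequency_independent_def] assms(2-4) by simp

lemma frequency_independent_subset: "frequency_independent l S \<Longrightarrow> S \<subseteq> {1..}"
  by (simp add: frequency_independent_def)

definition dirichlet_poly :: "(nat \<Rightarrow> complex) \<Rightarrow> nat set \<Rightarrow> complex \<Rightarrow> complex" where
  "dirichlet_poly a I s = (\<Sum>m\<in>I. a m / of_nat m powr s)"

abbreviation vshift :: "real \<Rightarrow> nat \<Rightarrow> complex \<Rightarrow> complex" where
  "vshift l n s \<equiv> s + \<i> * of_real (real n * l)"

lemma dirichlet_term_vshift:
  assumes "m \<ge> 1"
  shows "a m / of_nat m powr vshift l n s = a m / of_nat m powr s * cis (- (l * ln (real m))) ^ n"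
proof -
  have "of_nat m powr (\<i> * of_real (real n * l)) = cis (real n * (l * ln (real m)))"
    using assms by (simp add: powr_def cis_conv_exp mult_ac Ln_of_nat)
  then have "a m / of_nat m powr vshift l n s = a m / of_nat m powr s * inverse (cis (real n * (l * ln (real m))))"
    by (simp add: powr_add divide_inverse)
  also have "inverse (cis (real n * (l * ln (real m)))) = cis (- (l * ln (real m))) ^ n"
    unfolding Complex.DeMoivre by (simp add: cis_inverse)
  finally show ?thesis .
qed

lemma dirichlet_poly_vshift:
  assumes "I \<subseteq> {1..}"
  shows "dirichlet_poly a I (vshift l n s) = (\<Sum>m\<in>I. a m / of_nat m powr s * cis (- (l * ln (real m))) ^ n)"
  unfolding dirichlet_poly_def using assms by (intro sum.cong dirichlet_term_vshift refl) auto

lemma geometric_sum_cis_bounded: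
  assumes "\<And>z::int. \<theta> \<noteq> 2 * pi * of_int z"
  shows "norm (\<Sum>n=1..N. cis \<theta> ^ n) \<le> 2 / norm (1 - cis \<theta>)"
proof -
  have "cis \<theta> \<noteq> 1"
  proof
    assume "cis \<theta> = 1"
    then have "cos \<theta> = 1" by (simp add: complex_eq_iff)
    then obtain z :: int where "\<theta> = of_int z * 2 * pi" using cos_one_2pi_int by blast
    then show False using assms[of z] by (simp add: mult_ac)
  qed
  then have "norm (\<Sum>n=1..N. cis \<theta> ^ n) \<le> norm (cis \<theta> ^ 1 - cis \<theta> ^ (N + 1)) / norm (1 - cis \<theta>)"
    by (simp add: sum_gp norm_divide)
  also have "\<dots> \<le> 2 / norm (1 - cis \<theta>)"
  proof (rule divide_right_mono)
    have "norm (cis \<theta> ^ 1 - cis \<theta> ^ (N + 1)) \<le> norm (cis \<theta> ^ 1) + norm (cis \<theta> ^ (N + 1))"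
      by (rule norm_triangle_ineq4)
    then show "norm (cis \<theta> ^ 1 - cis \<theta> ^ (N + 1)) \<le> 2" by (simp add: norm_power norm_mult)
  qed simp
  finally show ?thesis .
qed

lemma norm_dirichlet_coeff_div_le:
  assumes "Re s \<ge> 0" "m \<ge> 1"
  shows "norm (a m / of_nat m powr s) \<le> norm (a m)"
proof -
  have "real m powr Re s \<ge> 1" using assms by (intro ge_one_powr_ge_zero) auto
  then show ?thesis unfolding norm_dirichlet_term by (simp add: divide_le_eq mult_le_cancel_left1)
qed

text \<open>
  The diagonal terms give the main term. The off-diagonal terms are geometric sums with ratio
  different from \<open>1\<close>, which are bounded uniformly in \<open>N\<close> and in \<open>s\<close>.
\<close>
lemma dirichlet_poly_mean_square_aux:
  assumes S: "frequency_independent l S" and I: "finite I" "I \<subseteq> S"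
  shows "\<exists>C. \<forall>N s. Re s \<ge> 0 \<longrightarrow>
     \<bar>(\<Sum>n=1..N. (norm (dirichlet_poly a I (vshift l n s)))\<^sup>2)
        - real N * (\<Sum>m\<in>I. (norm (a m))\<^sup>2 / real m powr (2 * Re s))\<bar> \<le> C"
proof -
  define w where "w m = cis (- (l * ln (real m)))" for m
  define q where "q m k = w m * cnj (w k)" for m k
  define C where "C = (\<Sum>m\<in>I. \<Sum>k\<in>I - {m}. norm (a m) * norm (a k) * (2 / norm (1 - q m k)))"
  have I1: "I \<subseteq> {1..}" using frequency_independent_subset[OF S] I(2) by (rule order_trans[rotated])
  have "\<bar>(\<Sum>n=1..N. (norm (dirichlet_poly a I (vshift l n s)))\<^sup>2)
        - real N * (\<Sum>m\<in>I. (norm (a m))\<^sup>2 / real m powr (2 * Re s))\<bar> \<le> C"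
    if s: "Re s \<ge> 0" for N s
  proof -
    define b where "b m = a m / of_nat m powr s" for m
    have bm: "norm (b m) \<le> norm (a m)" if "m \<in> I" for m
      unfolding b_def using that I1 s by (intro norm_dirichlet_coeff_div_le) auto
    have b2: "(norm (a m))\<^sup>2 / real m powr (2 * Re s) = (norm (b m))\<^sup>2" for m
      unfolding b_def norm_dirichlet_term
      by (simp add: power_divide power2_eq_square powr_add[symmetric])
    have sq: "of_real ((norm (dirichlet_poly a I (vshift l n s)))\<^sup>2)
        = (\<Sum>m\<in>I. \<Sum>k\<in>I. b m * cnj (b k) * q m k ^ n)" for n
      unfolding complex_norm_square dirichlet_poly_vshift[OF I1] cnj_sum sum_product
      by (simp add: b_def w_def q_def power_mult_distrib mult_ac)
    have "of_real (\<Sum>n=1..N. (norm (dirichlet_poly a I (vshift l n s)))\<^sup>2)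
        = (\<Sum>n=1..N. \<Sum>m\<in>I. \<Sum>k\<in>I. b m * cnj (b k) * q m k ^ n)"
      unfolding of_real_sum sq ..
    also have "\<dots> = (\<Sum>m\<in>I. \<Sum>k\<in>I. \<Sum>n=1..N. b m * cnj (b k) * q m k ^ n)"
      by (subst sum.swap) (intro sum.cong refl sum.swap)
    also have "\<dots> = (\<Sum>m\<in>I. \<Sum>k\<in>I. b m * cnj (b k) * (\<Sum>n=1..N. q m k ^ n))"
      by (simp add: sum_distrib_left)
    also have "\<dots> = (\<Sum>m\<in>I. of_real (real N * (norm (b m))\<^sup>2)
        + (\<Sum>k\<in>I - {m}. b m * cnj (b k) * (\<Sum>n=1..N. q m k ^ n)))"
    proof (rule sum.cong[OF refl])
      fix m assume m: "m \<in> I"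
      have "q m m = 1" by (simp add: q_def w_def cis_cnj cis_mult)
      then have "b m * cnj (b m) * (\<Sum>n=1..N. q m m ^ n) = of_real (real N * (norm (b m))\<^sup>2)"
        by (simp add: complex_norm_square[symmetric] mult_ac)
      then show "(\<Sum>k\<in>I. b m * cnj (b k) * (\<Sum>n=1..N. q m k ^ n)) = of_real (real N * (norm (b m))\<^sup>2)
        + (\<Sum>k\<in>I - {m}. b m * cnj (b k) * (\<Sum>n=1..N. q m k ^ n))"
        by (simp only: sum.remove[OF I(1) m])
    qed
    finally have eq: "of_real ((\<Sum>n=1..N. (norm (dirichlet_poly a I (vshift l n s)))\<^sup>2)
        - real N * (\<Sum>m\<in>I. (norm (b m))\<^sup>2))
      = (\<Sum>m\<in>I. \<Sum>k\<in>I - {m}. b m * cnj (b k) * (\<Sum>n=1..N. q m k ^ n))"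
      by (simp add: sum.distrib sum_distrib_left)
    have "\<bar>(\<Sum>n=1..N. (norm (dirichlet_poly a I (vshift l n s)))\<^sup>2)
        - real N * (\<Sum>m\<in>I. (norm (b m))\<^sup>2)\<bar>
      = norm (\<Sum>m\<in>I. \<Sum>k\<in>I - {m}. b m * cnj (b k) * (\<Sum>n=1..N. q m k ^ n))"
      unfolding eq[symmetric] norm_of_real ..
    also have "\<dots> \<le> C"
      unfolding C_def
    proof (intro sum_norm_le)
      fix m k assume m: "m \<in> I" and k: "k \<in> I - {m}"
      define \<theta> where "\<theta> = - (l * (ln (real m) - ln (real k)))"
      have q: "q m k = cis \<theta>" by (simp add: q_def w_def cis_cnj cis_mult \<theta>_def algebra_simps)
      have "\<theta> \<noteq> 2 * pi * of_int z" for z :: int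
      proof
        assume "\<theta> = 2 * pi * of_int z"
        then have "l * (ln (real m) - ln (real k)) = 2 * pi * of_int (- z)" by (simp add: \<theta>_def)
        moreover have "m \<in> S" "k \<in> S" "m \<noteq> k" using m k I by auto
        ultimately show False using frequency_independentD[OF S, of m k] by blast
      qed
      then have "norm (\<Sum>n=1..N. q m k ^ n) \<le> 2 / norm (1 - q m k)"
        unfolding q by (rule geometric_sum_cis_bounded)
      then show "norm (b m * cnj (b k) * (\<Sum>n=1..N. q m k ^ n)) \<le> norm (a m) * norm (a k) * (2 / norm (1 - q m k))"
        unfolding norm_mult complex_mod_cnj using bm m k by (intro mult_mono) auto
    qed
    finally show ?thesis by (simp add: b2)
  qed
  then show ?thesis by blast
qed

lemma dirichlet_poly_mean_square:
  assumes S: "frequency_independent l S" and I: "finite I" and supp: "\<And>m. m \<notin> S \<Longrightarrow> a m = 0"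
    and e: "e > 0"
  shows "\<forall>\<^sub>F N in sequentially. \<forall>s. Re s \<ge> 0 \<longrightarrow>
     \<bar>(\<Sum>n=1..N. (norm (dirichlet_poly a I (vshift l n s)))\<^sup>2)
        - real N * (\<Sum>m\<in>I. (norm (a m))\<^sup>2 / real m powr (2 * Re s))\<bar> \<le> e * real N"
proof -
  have red: "dirichlet_poly a I s = dirichlet_poly a (I \<inter> S) s" for s
    unfolding dirichlet_poly_def using I supp by (intro sum.mono_neutral_right) auto
  have red2: "(\<Sum>m\<in>I. (norm (a m))\<^sup>2 / real m powr (2 * Re s))
      = (\<Sum>m\<in>I \<inter> S. (norm (a m))\<^sup>2 / real m powr (2 * Re s))" for s
    using I supp by (intro sum.mono_neutral_right) auto
  obtain C where C: "\<And>N s. Re s \<ge> 0 \<Longrightarrow>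
     \<bar>(\<Sum>n=1..N. (norm (dirichlet_poly a I (vshift l n s)))\<^sup>2)
        - real N * (\<Sum>m\<in>I. (norm (a m))\<^sup>2 / real m powr (2 * Re s))\<bar> \<le> C"
    using dirichlet_poly_mean_square_aux[OF S, of "I \<inter> S" a] I unfolding red red2 by auto
  have "\<forall>\<^sub>F N in sequentially. real N \<ge> C / e" by (rule eventually_sequentiallyI[of "nat \<lceil>C / e\<rceil>"]) linarith
  then show ?thesis
  proof eventually_elim
    case (elim N)
    then have "C \<le> e * real N" using e by (simp add: field_simps)
    then show ?case using C order_trans by blast
  qed
qed

lemma dirichlet_poly_mean:
  assumes S: "frequency_independent l S" "1 \<in> S" and I: "finite I" "1 \<in> I"
    and supp: "\<And>m. m \<notin> S \<Longrightarrow> a m = 0" and e: "e > 0"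
  shows "\<forall>\<^sub>F N in sequentially. \<forall>s. Re s \<ge> 0 \<longrightarrow>
     norm ((\<Sum>n=1..N. dirichlet_poly a I (vshift l n s)) - of_nat N * a 1) \<le> e * real N"
proof -
  define w where "w m = cis (- (l * ln (real m)))" for m
  define I' where "I' = I \<inter> S"
  have I': "finite I'" "1 \<in> I'" "I' \<subseteq> {1..}" using I S(2) frequency_independent_subset[OF S(1)] by (auto simp: I'_def)
  have red: "dirichlet_poly a I s = dirichlet_poly a I' s" for s
    unfolding dirichlet_poly_def I'_def using I supp by (intro sum.mono_neutral_right) auto
  define C where "C = (\<Sum>m\<in>I' - {1}. norm (a m) * (2 / norm (1 - w m)))"
  have C: "norm ((\<Sum>n=1..N. dirichlet_poly a I (vshift l n s)) - of_nat N * a 1) \<le> C"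
    if s: "Re s \<ge> 0" for N s
  proof -
    have "(\<Sum>n=1..N. dirichlet_poly a I (vshift l n s)) = (\<Sum>m\<in>I'. \<Sum>n=1..N. a m / of_nat m powr s * w m ^ n)"
      unfolding red dirichlet_poly_vshift[OF I'(3)] w_def by (rule sum.swap)
    also have "\<dots> = (\<Sum>m\<in>I'. a m / of_nat m powr s * (\<Sum>n=1..N. w m ^ n))" by (simp add: sum_distrib_left)
    also have "\<dots> = of_nat N * a 1 + (\<Sum>m\<in>I' - {1}. a m / of_nat m powr s * (\<Sum>n=1..N. w m ^ n))"
      unfolding sum.remove[OF I'(1,2)] by (simp add: w_def mult_ac)
    finally have "norm ((\<Sum>n=1..N. dirichlet_poly a I (vshift l n s)) - of_nat N * a 1)
        = norm (\<Sum>m\<in>I' - {1}. a m / of_nat m powr s * (\<Sum>n=1..N. w m ^ n))" by simp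
    also have "\<dots> \<le> C" unfolding C_def
    proof (rule sum_norm_le)
      fix m assume m: "m \<in> I' - {1}"
      have "- (l * ln (real m)) \<noteq> 2 * pi * of_int z" for z :: int
      proof
        assume "- (l * ln (real m)) = 2 * pi * of_int z"
        then have "l * (ln (real m) - ln (real 1)) = 2 * pi * of_int (- z)" by simp
        moreover have "m \<in> S" "m \<noteq> 1" using m by (auto simp: I'_def)
        ultimately show False using frequency_independentD[OF S(1) _ S(2), of m] by blast
      qed
      then have "norm (\<Sum>n=1..N. w m ^ n) \<le> 2 / norm (1 - w m)"
        unfolding w_def by (rule geometric_sum_cis_bounded)
      then show "norm (a m / of_nat m powr s * (\<Sum>n=1..N. w m ^ n)) \<le> norm (a m) * (2 / norm (1 - w m))"
        unfolding norm_mult using m s I'(3) by (intro mult_mono norm_dirichlet_coeff_div_le) auto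
    qed
    finally show ?thesis .
  qed
  have "\<forall>\<^sub>F N in sequentially. real N \<ge> C / e" by (rule eventually_sequentiallyI[of "nat \<lceil>C / e\<rceil>"]) linarith
  then show ?thesis
  proof eventually_elim
    case (elim N)
    then have "C \<le> e * real N" using e by (simp add: field_simps)
    then show ?case using C order_trans by blast
  qed
qed

text \<open>
  Cauchy's formula on the circle of radius \<open>2 * r\<close>, applied to the squares of all functions at once.
  The points \<open>z n\<close> may be chosen freely in the smaller disc, so this bounds the sum over \<open>n\<close> of the
  suprema over the disc by a supremum of sums.
\<close>
lemma sum_sup_square_le_circle:
  fixes f :: "nat \<Rightarrow> complex \<Rightarrow> complex"
  assumes r: "r > 0" and hol: "\<And>n. n \<in> A \<Longrightarrow> f n holomorphic_on UNIV" and A: "finite A"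
    and z: "\<And>n. n \<in> A \<Longrightarrow> z n \<in> cball c r"
    and T: "\<And>u. norm (u - c) = 2 * r \<Longrightarrow> (\<Sum>n\<in>A. (norm (f n u))\<^sup>2) \<le> T"
  shows "(\<Sum>n\<in>A. (norm (f n (z n)))\<^sup>2) \<le> 2 * T"
proof -
  \<comment> \<open>Unimodular factors that make all summands nonnegative, so that a single contour integral suffices.\<close>
  define \<omega> where "\<omega> n = cnj (sgn ((f n (z n))\<^sup>2))" for n
  have om: "\<omega> n * (f n (z n))\<^sup>2 = of_real ((norm (f n (z n)))\<^sup>2)" and om1: "norm (\<omega> n) \<le> 1" for n
  proof -
    show "norm (\<omega> n) \<le> 1" by (simp add: \<omega>_def norm_sgn)
    show "\<omega> n * (f n (z n))\<^sup>2 = of_real ((norm (f n (z n)))\<^sup>2)"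
    proof (cases "f n (z n) = 0")
      case False
      define v where "v = (f n (z n))\<^sup>2"
      have v: "v \<noteq> 0" using False by (simp add: v_def)
      have "cnj (sgn v) * v = v * cnj v / of_real (norm v)" by (simp add: sgn_div_norm scaleR_conv_of_real divide_inverse mult_ac)
      also have "\<dots> = of_real (norm v)"
        using v by (simp add: complex_norm_square[symmetric] power2_eq_square)
      finally show ?thesis by (simp add: \<omega>_def v_def norm_power)
    qed simp
  qed
  have "((\<lambda>u. \<omega> n * ((f n u)\<^sup>2 / (u - z n))) has_contour_integral \<omega> n * (2 * of_real pi * \<i> * (f n (z n))\<^sup>2))
      (circlepath c (2 * r))" if n: "n \<in> A" for n
  proof (rule has_contour_integral_lmul, rule Cauchy_integral_circlepath_simple)
    show "(\<lambda>u. (f n u)\<^sup>2) holomorphic_on cball c (2 * r)"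
      using hol[OF n] by (intro holomorphic_intros) (auto intro: holomorphic_on_subset)
    show "norm (z n - c) < 2 * r" using z[OF n] r by (simp add: dist_norm norm_minus_commute)
  qed
  then have int: "((\<lambda>u. \<Sum>n\<in>A. \<omega> n * ((f n u)\<^sup>2 / (u - z n))) has_contour_integral
      (\<Sum>n\<in>A. \<omega> n * (2 * of_real pi * \<i> * (f n (z n))\<^sup>2))) (circlepath c (2 * r))"
    by (intro has_contour_integral_sum A)
  have tot: "(\<Sum>n\<in>A. \<omega> n * (2 * of_real pi * \<i> * (f n (z n))\<^sup>2))
      = 2 * of_real pi * \<i> * of_real (\<Sum>n\<in>A. (norm (f n (z n)))\<^sup>2)"
    unfolding of_real_sum sum_distrib_left om[symmetric] by (simp add: mult_ac)
  have "T \<ge> 0"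
  proof -
    have "norm ((c + of_real (2 * r)) - c) = 2 * r" using r by simp
    then have "(\<Sum>n\<in>A. (norm (f n (c + of_real (2 * r))))\<^sup>2) \<le> T" by (rule T)
    then show ?thesis by (meson order_trans sum_nonneg zero_le_power2)
  qed
  have "norm (\<Sum>n\<in>A. \<omega> n * (2 * of_real pi * \<i> * (f n (z n))\<^sup>2)) \<le> T / r * (2 * pi * (2 * r))"
  proof (rule has_contour_integral_bound_circlepath[OF int])
    show "0 \<le> T / r" using \<open>T \<ge> 0\<close> r by simp
    fix u assume u: "norm (u - c) = 2 * r"
    have "norm (\<Sum>n\<in>A. \<omega> n * ((f n u)\<^sup>2 / (u - z n))) \<le> (\<Sum>n\<in>A. (norm (f n u))\<^sup>2 / r)"
    proof (rule sum_norm_le)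
      fix n assume n: "n \<in> A"
      have "norm (u - c) \<le> norm (u - z n) + norm (z n - c)"
        using norm_triangle_ineq[of "u - z n" "z n - c"] by simp
      moreover have "norm (z n - c) \<le> r" using z[OF n] by (simp add: dist_norm norm_minus_commute)
      ultimately have d: "norm (u - z n) \<ge> r" using u by simp
      have "norm (\<omega> n * ((f n u)\<^sup>2 / (u - z n))) = norm (\<omega> n) * ((norm (f n u))\<^sup>2 / norm (u - z n))"
        by (simp add: norm_mult norm_divide norm_power)
      also have "\<dots> \<le> 1 * ((norm (f n u))\<^sup>2 / r)"
        using om1 d r by (intro mult_mono frac_le) auto
      finally show "norm (\<omega> n * ((f n u)\<^sup>2 / (u - z n))) \<le> (norm (f n u))\<^sup>2 / r" by simp
    qed
    also have "\<dots> \<le> T / r" unfolding sum_divide_distrib[symmetric] using T[OF u] r by (intro divide_right_mono) auto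
    finally show "norm (\<Sum>n\<in>A. \<omega> n * ((f n u)\<^sup>2 / (u - z n))) \<le> T / r" .
  qed (use r in auto)
  then have "2 * pi * (\<Sum>n\<in>A. (norm (f n (z n)))\<^sup>2) \<le> 2 * pi * (2 * T)"
    unfolding tot norm_mult norm_of_real using r
    by (simp add: abs_of_nonneg sum_nonneg mult_ac)
  then show ?thesis by simp
qed

lemma dirichlet_poly_holomorphic [holomorphic_intros]:
  "dirichlet_poly a I holomorphic_on A"
proof -
  have "(\<lambda>s. a m / of_nat m powr s) holomorphic_on A" for m
    by (cases "m = 0") (auto intro!: holomorphic_intros)
  then show ?thesis unfolding dirichlet_poly_def[abs_def] by (rule holomorphic_on_sum)
qed

lemma square_mean_le_tail:
  assumes sq: "(\<lambda>n. (norm (a n))\<^sup>2 / real n powr (2 * \<beta>)) summable_on UNIV"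
    and \<beta>: "0 \<le> \<beta>" "\<beta> \<le> \<sigma>" and I: "finite I" "I \<subseteq> J"
  shows "(\<Sum>m\<in>I. (norm (a m))\<^sup>2 / real m powr (2 * \<sigma>)) \<le> (\<Sum>\<^sub>\<infinity>m\<in>J. (norm (a m))\<^sup>2 / real m powr (2 * \<beta>))"
proof -
  have "(\<Sum>m\<in>I. (norm (a m))\<^sup>2 / real m powr (2 * \<sigma>)) \<le> (\<Sum>m\<in>I. (norm (a m))\<^sup>2 / real m powr (2 * \<beta>))"
  proof (rule sum_mono)
    fix m
    show "(norm (a m))\<^sup>2 / real m powr (2 * \<sigma>) \<le> (norm (a m))\<^sup>2 / real m powr (2 * \<beta>)"
    proof (cases "m = 0")
      case False
      then have "real m powr (2 * \<beta>) \<le> real m powr (2 * \<sigma>)" using \<beta> by (intro powr_mono) auto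
      then show ?thesis using False by (intro divide_left_mono mult_pos_pos) auto
    qed simp
  qed
  also have "\<dots> \<le> (\<Sum>\<^sub>\<infinity>m\<in>J. (norm (a m))\<^sup>2 / real m powr (2 * \<beta>))"
    by (rule finite_sum_le_infsum) (use I summable_on_subset_banach[OF sq, of J] in auto)
  finally show ?thesis .
qed

text \<open>
  The constant \<open>C\<close> does not depend on the length \<open>i\<close>. A mean-square bound at each point becomes
  a bound for suprema over finitely many discs covering \<open>X\<close>; Chebyshev's inequality
  then counts the exceptions.
\<close>
lemma dirichlet_poly_mostly_bounded:
  fixes X :: "complex set"
  assumes S: "frequency_independent l S" and supp: "\<And>m. m \<notin> S \<Longrightarrow> a m = 0"
    and sq: "(\<lambda>n. (norm (a n))\<^sup>2 / real n powr (2 * \<beta>)) summable_on UNIV"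
    and \<beta>: "0 \<le> \<beta>" "\<beta> < \<beta>'" and X: "compact X" "\<And>z. z \<in> X \<Longrightarrow> Re z \<ge> \<beta>'" and \<epsilon>: "\<epsilon> > 0"
  shows "\<exists>C>0. \<forall>i. \<forall>\<^sub>F N in sequentially.
     real (card {n\<in>{1..N}. \<exists>z\<in>X. norm (dirichlet_poly a {1..i} (vshift l n z)) > C}) \<le> \<epsilon> * real N"
proof -
  define r where "r = (\<beta>' - \<beta>) / 2"
  have r: "r > 0" using \<beta> by (simp add: r_def)
  obtain T where T: "T \<subseteq> X" "finite T" "X \<subseteq> (\<Union>c\<in>T. ball c r)"
  proof (rule compactE_image[OF X(1), of X "\<lambda>c. ball c r"])
    show "X \<subseteq> (\<Union>c\<in>X. ball c r)" using r by force
  qed auto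
  define M where "M = (\<Sum>\<^sub>\<infinity>m. (norm (a m))\<^sup>2 / real m powr (2 * \<beta>)) + 1"
  have M: "M \<ge> 1" by (simp add: M_def infsum_nonneg)
  define C where "C = sqrt (2 * M * (real (card T) + 1) / \<epsilon>)"
  have C: "C > 0" "C\<^sup>2 = 2 * M * (real (card T) + 1) / \<epsilon>" using M \<epsilon> by (auto simp: C_def)
  have "\<forall>\<^sub>F N in sequentially.
     real (card {n\<in>{1..N}. \<exists>z\<in>X. norm (dirichlet_poly a {1..i} (vshift l n z)) > C}) \<le> \<epsilon> * real N" for i
  proof -
    have "\<forall>\<^sub>F N in sequentially. \<forall>s. Re s \<ge> 0 \<longrightarrow>
     \<bar>(\<Sum>n=1..N. (norm (dirichlet_poly a {1..i} (vshift l n s)))\<^sup>2)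
        - real N * (\<Sum>m\<in>{1..i}. (norm (a m))\<^sup>2 / real m powr (2 * Re s))\<bar> \<le> 1 * real N"
      by (rule dirichlet_poly_mean_square[OF S]) (use supp in auto)
    then show ?thesis
    proof eventually_elim
      case (elim N)
      have sum_le: "(\<Sum>n\<in>{1..N}. (norm (dirichlet_poly a {1..i} (vshift l n u)))\<^sup>2) \<le> M * real N"
        if "Re u \<ge> \<beta>" for u
      proof -
        have "(\<Sum>m\<in>{1..i}. (norm (a m))\<^sup>2 / real m powr (2 * Re u)) \<le> M - 1"
          using square_mean_le_tail[OF sq \<beta>(1) that, of "{1..i}" UNIV] by (simp add: M_def)
        then have "real N * (\<Sum>m\<in>{1..i}. (norm (a m))\<^sup>2 / real m powr (2 * Re u)) \<le> real N * (M - 1)"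
          by (intro mult_left_mono) auto
        moreover have "Re u \<ge> 0" using that \<beta> by simp
        then have "\<bar>(\<Sum>n=1..N. (norm (dirichlet_poly a {1..i} (vshift l n u)))\<^sup>2)
          - real N * (\<Sum>m\<in>{1..i}. (norm (a m))\<^sup>2 / real m powr (2 * Re u))\<bar> \<le> 1 * real N"
          using elim by blast
        ultimately show ?thesis by (simp add: algebra_simps abs_le_iff)
      qed
      define bad where "bad c = {n\<in>{1..N}. \<exists>z\<in>cball c r. norm (dirichlet_poly a {1..i} (vshift l n z)) > C}" for c
      have bad: "C\<^sup>2 * real (card (bad c)) \<le> 2 * (M * real N)" if c: "c \<in> T" for c
      proof -
        have "\<forall>n\<in>bad c. \<exists>z. z \<in> cball c r \<and> norm (dirichlet_poly a {1..i} (vshift l n z)) > C"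
          unfolding bad_def by blast
        from bchoice[OF this] obtain z where z: "\<And>n. n \<in> bad c \<Longrightarrow> z n \<in> cball c r"
          "\<And>n. n \<in> bad c \<Longrightarrow> norm (dirichlet_poly a {1..i} (vshift l n (z n))) > C" by blast
        have "C\<^sup>2 * real (card (bad c)) = (\<Sum>n\<in>bad c. C\<^sup>2)" by simp
        also have "\<dots> \<le> (\<Sum>n\<in>bad c. (norm (dirichlet_poly a {1..i} (vshift l n (z n))))\<^sup>2)"
          using z(2) C(1) by (intro sum_mono power_mono) (auto intro: less_imp_le)
        also have "\<dots> \<le> 2 * (M * real N)"
        proof (rule sum_sup_square_le_circle[where f = "\<lambda>n z. dirichlet_poly a {1..i} (vshift l n z)" and c = c and r = r])
          show "(\<lambda>z. dirichlet_poly a {1..i} (vshift l n z)) holomorphic_on UNIV" for n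
            by (rule holomorphic_on_compose[of "vshift l n" UNIV "dirichlet_poly a {1..i}", unfolded o_def])
              (intro holomorphic_intros)+
          show "finite (bad c)" by (simp add: bad_def)
          fix u assume u: "norm (u - c) = 2 * r"
          have "Re c - Re u \<le> 2 * r" using abs_Re_le_cmod[of "u - c"] u by simp
          moreover have "Re c \<ge> \<beta>'" using X(2) T(1) c by blast
          ultimately have "Re u \<ge> \<beta>" by (simp add: r_def)
          have "(\<Sum>n\<in>bad c. (norm (dirichlet_poly a {1..i} (vshift l n u)))\<^sup>2)
            \<le> (\<Sum>n\<in>{1..N}. (norm (dirichlet_poly a {1..i} (vshift l n u)))\<^sup>2)"
            by (intro sum_mono2) (auto simp: bad_def)
          also have "\<dots> \<le> M * real N" by (rule sum_le[OF \<open>Re u \<ge> \<beta>\<close>])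
          finally show "(\<Sum>n\<in>bad c. (norm (dirichlet_poly a {1..i} (vshift l n u)))\<^sup>2) \<le> M * real N" .
        qed (use r z in auto)
        finally show ?thesis .
      qed
      have "{n\<in>{1..N}. \<exists>z\<in>X. norm (dirichlet_poly a {1..i} (vshift l n z)) > C} \<subseteq> (\<Union>c\<in>T. bad c)"
      proof
        fix n assume "n \<in> {n\<in>{1..N}. \<exists>z\<in>X. norm (dirichlet_poly a {1..i} (vshift l n z)) > C}"
        then obtain z where z: "n \<in> {1..N}" "z \<in> X" "norm (dirichlet_poly a {1..i} (vshift l n z)) > C" by blast
        then obtain c where "c \<in> T" "z \<in> ball c r" using T(3) by blast
        then show "n \<in> (\<Union>c\<in>T. bad c)" using z by (force simp: bad_def)
      qed
      then have "card {n\<in>{1..N}. \<exists>z\<in>X. norm (dirichlet_poly a {1..i} (vshift l n z)) > C} \<le> card (\<Union>c\<in>T. bad c)"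
        by (intro card_mono) (use T(2) in \<open>auto simp: bad_def\<close>)
      also have "\<dots> \<le> (\<Sum>c\<in>T. card (bad c))" by (rule card_UN_le[OF T(2)])
      finally have "C\<^sup>2 * real (card {n\<in>{1..N}. \<exists>z\<in>X. norm (dirichlet_poly a {1..i} (vshift l n z)) > C})
        \<le> C\<^sup>2 * real (\<Sum>c\<in>T. card (bad c))" by (intro mult_left_mono of_nat_mono) auto
      also have "\<dots> = (\<Sum>c\<in>T. C\<^sup>2 * real (card (bad c)))" by (simp add: sum_distrib_left)
      also have "\<dots> \<le> (\<Sum>c\<in>T. 2 * (M * real N))" by (intro sum_mono bad)
      also have "\<dots> \<le> (real (card T) + 1) * (2 * (M * real N))" using M by (simp add: algebra_simps)
      also have "\<dots> = C\<^sup>2 * (\<epsilon> * real N)" using C(2) \<epsilon> by simp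
      finally show ?case using C(1) by simp
    qed
  qed
  then show ?thesis using C(1) by blast
qed

section \<open>Approximation of powers by partial sums for most shifts\<close>

lemma open_half_strip: "open (half_strip \<beta> t u)"
proof -
  have "half_strip \<beta> t u = {z. \<beta> < Re z} \<inter> {z. t < Im z} \<inter> {z. Im z < u}"
    by (auto simp: half_strip_def)
  then show ?thesis
    by (auto intro!: open_Int open_halfspace_Re_gt open_halfspace_Im_gt open_halfspace_Im_lt)
qed

lemma connected_half_strip: "connected (half_strip \<beta> t u)"
proof -
  have "half_strip \<beta> t u = {z. \<beta> < Re z} \<inter> {z. t < Im z} \<inter> {z. Im z < u}"
    by (auto simp: half_strip_def)
  then show ?thesis
    by (auto intro!: convex_connected convex_Int convex_halfspace_Re_gt convex_halfspace_Im_gt convex_halfspace_Im_lt)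
qed

text \<open>
  Two half-strips containing \<open>s\<close> meet in a half-strip, which reaches into \<open>Re z > 1\<close>.
\<close>
lemma continuation_value_unique:
  assumes "continuation_value L s v" "continuation_value L s w"
  shows "v = w"
proof -
  obtain F a t1 t2 where F: "s \<in> half_strip a t1 t2" "F holomorphic_on half_strip a t1 t2"
    "\<And>z. z \<in> half_strip a t1 t2 \<Longrightarrow> Re z > 1 \<Longrightarrow> F z = L z" "F s = v"
    using assms(1) unfolding continuation_value_def by blast
  obtain G b u1 u2 where G: "s \<in> half_strip b u1 u2" "G holomorphic_on half_strip b u1 u2"
    "\<And>z. z \<in> half_strip b u1 u2 \<Longrightarrow> Re z > 1 \<Longrightarrow> G z = L z" "G s = w"
    using assms(2) unfolding continuation_value_def by blast
  define H where "H = half_strip (max a b) (max t1 u1) (min t2 u2)"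
  define V where "V = half_strip (max 1 (max a b)) (max t1 u1) (min t2 u2)"
  have H: "H \<subseteq> half_strip a t1 t2" "H \<subseteq> half_strip b u1 u2" "s \<in> H" "V \<subseteq> H"
    using F(1) G(1) by (auto simp: H_def V_def half_strip_def)
  have "Complex (max 1 (max a b) + 1) (Im s) \<in> V"
    using F(1) G(1) by (auto simp: V_def half_strip_def)
  then have "V \<noteq> {}" by blast
  have "F z = G z" if "z \<in> V" for z
  proof -
    have "Re z > 1" "z \<in> H" using that H(4) by (auto simp: V_def half_strip_def)
    then have "F z = L z" "G z = L z" using F(3)[of z] G(3)[of z] H(1,2) by blast+
    then show ?thesis by simp
  qed
  then have "F s = G s"
    by (intro analytic_continuation_open[of V H F G s])
      (use H F(2) G(2) \<open>V \<noteq> {}\<close> in \<open>auto simp: V_def H_def intro: open_half_strip connected_half_strip holomorphic_on_subset\<close>)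
  then show ?thesis using F G by simp
qed

lemma continuation_eqI:
  assumes "continuation_value L s w"
  shows "continuation L s = w"
  unfolding continuation_def
  by (rule the_equality) (use assms continuation_value_unique in blast)+

lemma continuation_vshift_eq:
  assumes F: "F holomorphic_on half_strip \<beta> t u"
    and eq: "\<And>s. s \<in> half_strip \<beta> t u \<Longrightarrow> Re s > 1 \<Longrightarrow> F s = L (vshift l n s)"
    and s: "s \<in> half_strip \<beta> t u"
  shows "continuable_at L (vshift l n s)" "continuation L (vshift l n s) = F s"
proof -
  define c where "c = \<i> * complex_of_real (real n * l)"
  have c: "Re c = 0" "Im c = real n * l" by (auto simp: c_def)
  have mem: "z - c \<in> half_strip \<beta> t u" if "z \<in> half_strip \<beta> (t + real n * l) (u + real n * l)" for z
    using that c by (simp add: half_strip_def)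
  have "(F \<circ> (\<lambda>z. z - c)) holomorphic_on half_strip \<beta> (t + real n * l) (u + real n * l)"
    by (rule holomorphic_on_compose_gen[OF _ F]) (use mem in \<open>auto intro!: holomorphic_intros\<close>)
  moreover have "(F \<circ> (\<lambda>z. z - c)) z = L z"
    if "z \<in> half_strip \<beta> (t + real n * l) (u + real n * l)" "Re z > 1" for z
    using eq[OF mem[OF that(1)]] that c by (simp add: c_def)
  moreover have "vshift l n s \<in> half_strip \<beta> (t + real n * l) (u + real n * l)"
    using s by (simp add: half_strip_def)
  moreover have "(F \<circ> (\<lambda>z. z - c)) (vshift l n s) = F s" by (simp add: c_def)
  ultimately have "continuation_value L (vshift l n s) (F s)"
    unfolding continuation_value_def by blast
  then show "continuable_at L (vshift l n s)" "continuation L (vshift l n s) = F s"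
    using continuation_eqI by (auto simp: continuable_at_def)
qed

text \<open>
  The part of the class condition that is used for a fixed \<open>l\<close>, with normality replaced by local
  boundedness. In this form it passes from \<open>L\<close> to the product of \<open>L\<close> with a function of period \<open>i l\<close>.
\<close>
definition locally_bounded_shifts :: "(complex \<Rightarrow> complex) \<Rightarrow> real \<Rightarrow> real \<Rightarrow> bool" where
  "locally_bounded_shifts L \<beta> l \<longleftrightarrow> (\<forall>\<epsilon>>0. \<exists>J \<subseteq> {1..}. lower_density J > ereal (1 - \<epsilon>) \<and>
     (\<exists>F. (\<forall>n\<in>J. F n holomorphic_on half_strip \<beta> (- l) (2 * l) \<and>
              (\<forall>s\<in>half_strip \<beta> (- l) (2 * l). Re s > 1 \<longrightarrow> F n s = L (vshift l n s))) \<and>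
          (\<forall>X. compact X \<longrightarrow> X \<subseteq> half_strip \<beta> (- l) (2 * l) \<longrightarrow>
              (\<exists>B. \<forall>n\<in>J. \<forall>s\<in>X. norm (F n s) \<le> B))))"

lemma lower_density_complement:
  assumes "lower_density J > ereal (1 - \<epsilon>)"
  shows "\<forall>\<^sub>F N in sequentially. real (card ({1..N} - J)) \<le> \<epsilon> * real N"
proof -
  have "\<forall>\<^sub>F N in sequentially. ereal (real (card (J \<inter> {1..N})) / real N) > ereal (1 - \<epsilon>)"
    using assms unfolding lower_density_def by (rule less_LiminfD)
  then show ?thesis using eventually_gt_at_top[of 0]
  proof eventually_elim
    case (elim N)
    then have "real (card (J \<inter> {1..N})) > (1 - \<epsilon>) * real N" by (simp add: field_simps)
    moreover have "card (J \<inter> {1..N}) + card ({1..N} - J) = N"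
      using card_Int_Diff[of "{1..N}" J] by (simp add: Int_commute)
    then have "real (card (J \<inter> {1..N})) + real (card ({1..N} - J)) = real N"
      unfolding of_nat_add[symmetric] by simp
    ultimately show ?case by (simp add: algebra_simps)
  qed
qed

lemma sums_tail_eventually_small:
  fixes t :: "nat \<Rightarrow> real"
  assumes t: "t summable_on UNIV" "\<And>m. t m \<ge> 0" and \<eta>: "\<eta> > 0"
  shows "\<forall>\<^sub>F i in sequentially. \<forall>j. sum t {i<..j} \<le> \<eta>"
proof -
  have "t sums infsum t UNIV" using t(1) by (intro has_sum_imp_sums has_sum_infsum)
  then have "(\<lambda>i. sum t {..i}) \<longlonglongrightarrow> infsum t UNIV" by (simp add: sums_def_le)
  then have "\<forall>\<^sub>F i in sequentially. dist (sum t {..i}) (infsum t UNIV) < \<eta>"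
    using \<eta> by (rule tendstoD)
  then show ?thesis
  proof eventually_elim
    case (elim i)
    show ?case
    proof
      fix j
      have "sum t {i<..j} + sum t {..i} = sum t ({i<..j} \<union> {..i})"
        by (subst sum.union_disjoint) auto
      also have "\<dots> \<le> infsum t UNIV" by (rule finite_sum_le_infsum) (use t in auto)
      finally show "sum t {i<..j} \<le> \<eta>" using elim by (simp add: dist_real_def abs_if split: if_splits)
    qed
  qed
qed

lemma dirichlet_poly_uniform_approx:
  assumes b: "dirichlet_abs_conv b \<sigma>" "b 0 = 0" and \<eta>: "\<eta> > 0"
  shows "\<forall>\<^sub>F i in sequentially. \<forall>z. Re z \<ge> \<sigma> \<longrightarrow> norm (dirichlet_sum b z - dirichlet_poly b {1..i} z) \<le> \<eta>"
proof -
  have "\<forall>\<^sub>F i in sequentially. \<forall>j. (\<Sum>m\<in>{i<..j}. norm (b m) / real m powr \<sigma>) \<le> \<eta>"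
    by (rule sums_tail_eventually_small[OF b(1)[unfolded dirichlet_abs_conv_def] _ \<eta>]) simp
  then show ?thesis
  proof eventually_elim
    case (elim i)
    show ?case
    proof (intro allI impI)
      fix z assume z: "Re z \<ge> \<sigma>"
      define f where "f m = b m / of_nat m powr z" for m
      have "f sums dirichlet_sum b z"
        unfolding f_def using dirichlet_abs_conv_mono[OF b(1) z] by (rule dirichlet_sums)
      then have "(\<lambda>j. sum f {..j}) \<longlonglongrightarrow> dirichlet_sum b z" by (simp add: sums_def_le)
      then have lim: "(\<lambda>j. norm (sum f {..j} - sum f {..i})) \<longlonglongrightarrow> norm (dirichlet_sum b z - sum f {..i})"
        by (intro tendsto_intros)
      have "norm (sum f {..j} - sum f {..i}) \<le> \<eta>" if "j \<ge> i" for j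
      proof -
        have "{..j} = {..i} \<union> {i<..j}" using that by auto
        then have "sum f {..j} = sum f {..i} + sum f {i<..j}"
          by (simp only:) (rule sum.union_disjoint, auto)
        then have "norm (sum f {..j} - sum f {..i}) = norm (sum f {i<..j})" by simp
        also have "\<dots> \<le> (\<Sum>m\<in>{i<..j}. norm (b m) / real m powr \<sigma>)"
        proof (rule sum_norm_le)
          fix m assume m: "m \<in> {i<..j}"
          then have "real m powr \<sigma> \<le> real m powr Re z" using z by (intro powr_mono) auto
          then show "norm (f m) \<le> norm (b m) / real m powr \<sigma>"
            unfolding f_def norm_dirichlet_term using m by (intro divide_left_mono mult_pos_pos) auto
        qed
        also have "\<dots> \<le> \<eta>" using elim by blast
        finally show ?thesis .
      qed
      then have "norm (dirichlet_sum b z - sum f {..i}) \<le> \<eta>"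
        by (intro LIMSEQ_le_const2[OF lim]) blast
      moreover have "sum f {..i} = dirichlet_poly b {1..i} z"
        unfolding dirichlet_poly_def f_def
        by (rule sum.mono_neutral_right) (use b(2) in \<open>auto simp: Suc_le_eq\<close>)
      ultimately show "norm (dirichlet_sum b z - dirichlet_poly b {1..i} z) \<le> \<eta>" by simp
    qed
  qed
qed

text \<open>
  The part \<open>\<alpha> \<le> Re s \<le> 2\<close>, \<open>n l \<le> Im s \<le> (n + 1) l\<close> of the plane is the image of this rectangle
  under \<open>vshift l n\<close>.
\<close>
abbreviation block :: "real \<Rightarrow> real \<Rightarrow> complex set" where
  "block \<alpha> l \<equiv> cbox (Complex \<alpha> 0) (Complex 2 l)"

definition continuable_block :: "(complex \<Rightarrow> complex) \<Rightarrow> real \<Rightarrow> real \<Rightarrow> nat \<Rightarrow> bool" where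
  "continuable_block L \<alpha> l n \<longleftrightarrow>
     (\<forall>s\<in>block \<alpha> l. continuable_at L (vshift l n s)) \<and>
     bounded ((\<lambda>s. continuation L (vshift l n s)) ` block \<alpha> l)"

text \<open>
  The difference between \<open>L^k\<close> and a partial sum is studied on a rectangle that contains the block
  and reaches beyond \<open>Re s = 3\<close>. For most \<open>n\<close> it is bounded there: the power by local
  boundedness, the partial sum by its mean square. It is small where \<open>Re s > 3\<close>, and therefore on the block.
\<close>
lemma power_mostly_near_dirichlet_poly:
  assumes l: "l > 0" and \<alpha>: "1 / 2 < \<beta>" "\<beta> < \<alpha>" "\<alpha> \<le> 1"
    and ram: "ramanujan_bounded a" and L: "\<And>s. Re s > 1 \<Longrightarrow> L s = dirichlet_sum a s"
    and lb: "locally_bounded_shifts L \<beta> l"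
    and S: "frequency_independent l S" and supp: "\<And>m. m \<notin> S \<Longrightarrow> dirichlet_pow a k m = 0"
    and \<delta>: "\<delta> > 0" and \<epsilon>: "\<epsilon> > 0"
  shows "\<forall>\<^sub>F i in sequentially. \<forall>\<^sub>F N in sequentially.
     real (card {n\<in>{1..N}. \<not> (continuable_block L \<alpha> l n \<and> (\<forall>s\<in>block \<alpha> l.
        norm (continuation L (vshift l n s) ^ k - dirichlet_poly (dirichlet_pow a k) {1..i} (vshift l n s)) \<le> \<delta>))})
     \<le> \<epsilon> * real N"
proof -
  define b where "b = dirichlet_pow a k"
  have rb: "ramanujan_bounded b" unfolding b_def by (rule ramanujan_bounded_pow[OF ram])
  define \<beta>' where "\<beta>' = (\<beta> + \<alpha>) / 2"
  have \<beta>': "\<beta> < \<beta>'" "\<beta>' < \<alpha>" "\<beta>' < 4" using \<alpha> by (auto simp: \<beta>'_def)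
  define Q where "Q = box (Complex \<beta>' (- (l / 2))) (Complex 4 (3 * l / 2))"
  define X where "X = cbox (Complex \<beta>' (- (l / 2))) (Complex 4 (3 * l / 2))"
  define H where "H = half_strip \<beta> (- l) (2 * l)"
  \<comment> \<open>The part of the rectangle where the Dirichlet series converges absolutely and uniformly.\<close>
  define V where "V = Q \<inter> {z. Re z > 3}"
  have QX: "Q \<subseteq> X" and XH: "X \<subseteq> H" and KQ: "block \<alpha> l \<subseteq> Q"
    using \<beta>' \<alpha> l by (auto simp: Q_def X_def H_def half_strip_def in_box_complex_iff in_cbox_complex_iff)
  have Q: "open Q" "connected Q" by (auto simp: Q_def open_box intro: convex_connected)
  have V: "open V" "V \<subseteq> Q" "V \<noteq> {}"
  proof -
    show "open V" unfolding V_def using Q(1) by (intro open_Int open_halfspace_Re_gt)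
    have "Complex (7 / 2) (l / 2) \<in> V" using \<beta>' \<alpha> l by (simp add: V_def Q_def in_box_complex_iff)
    then show "V \<noteq> {}" by blast
  qed (auto simp: V_def)
  obtain J F where J: "J \<subseteq> {1..}" "lower_density J > ereal (1 - \<epsilon> / 2)"
    and F0: "\<forall>n\<in>J. F n holomorphic_on H \<and> (\<forall>s\<in>H. Re s > 1 \<longrightarrow> F n s = L (vshift l n s))"
    and bd: "\<forall>X. compact X \<longrightarrow> X \<subseteq> H \<longrightarrow> (\<exists>B. \<forall>n\<in>J. \<forall>s\<in>X. norm (F n s) \<le> B)"
    using lb[unfolded locally_bounded_shifts_def, rule_format, OF half_gt_zero[OF \<epsilon>]]
    unfolding H_def[symmetric] by (elim exE conjE) (rule that)
  have F: "F n holomorphic_on H" "\<And>s. s \<in> H \<Longrightarrow> Re s > 1 \<Longrightarrow> F n s = L (vshift l n s)"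
    if "n \<in> J" for n using bspec[OF F0 that] by blast+
  have compX: "compact X" by (simp add: X_def)
  from bd[rule_format, OF this XH] obtain B where "\<forall>n\<in>J. \<forall>s\<in>X. norm (F n s) \<le> B" ..
  then have B: "norm (F n s) \<le> B" if "n \<in> J" "s \<in> X" for n s using that by simp
  have sq: "(\<lambda>n. (norm (b n))\<^sup>2 / real n powr (2 * \<beta>)) summable_on UNIV"
    by (rule ramanujan_bounded_square_summable[OF rb \<alpha>(1)])
  have Xre: "Re z \<ge> \<beta>'" if "z \<in> X" for z using that by (simp add: X_def in_cbox_complex_iff)
  have "\<exists>C>0. \<forall>i. \<forall>\<^sub>F N in sequentially.
     real (card {n\<in>{1..N}. \<exists>z\<in>X. norm (dirichlet_poly b {1..i} (vshift l n z)) > C}) \<le> \<epsilon> / 2 * real N"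
    by (rule dirichlet_poly_mostly_bounded[OF S _ sq _ \<beta>'(1) compX])
      (use supp Xre \<alpha> \<epsilon> in \<open>auto simp: b_def\<close>)
  then obtain C where C: "C > 0" "\<And>i. \<forall>\<^sub>F N in sequentially.
     real (card {n\<in>{1..N}. \<exists>z\<in>X. norm (dirichlet_poly b {1..i} (vshift l n z)) > C}) \<le> \<epsilon> / 2 * real N"
    by blast
  obtain \<eta> where \<eta>: "\<eta> > 0" and small0: "\<forall>f. f holomorphic_on Q \<and> (\<forall>z\<in>Q. norm (f z) \<le> B ^ k + C)
      \<and> (\<forall>z\<in>V. norm (f z) \<le> \<eta>) \<longrightarrow> (\<forall>z\<in>block \<alpha> l. norm (f z) \<le> \<delta>)"
    using small_on_open_imp_small_on_compact[OF Q compact_cbox KQ V \<delta>, of "B ^ k + C"] by (elim exE conjE)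
  have small: "norm (f z) \<le> \<delta>" if "f holomorphic_on Q" "\<And>z. z \<in> Q \<Longrightarrow> norm (f z) \<le> B ^ k + C"
    "\<And>z. z \<in> V \<Longrightarrow> norm (f z) \<le> \<eta>" "z \<in> block \<alpha> l" for f z
    using small0[rule_format, of f z] that by simp
  have b0: "b 0 = 0" using rb by (simp add: ramanujan_bounded_def)
  have ab: "dirichlet_abs_conv b 3" by (rule ramanujan_bounded_abs_conv[OF rb]) simp
  show ?thesis unfolding b_def[symmetric]
    using dirichlet_poly_uniform_approx[OF ab b0 \<eta>]
  proof eventually_elim
    case (elim i)
    define P where "P n = (\<lambda>z. dirichlet_poly b {1..i} (vshift l n z))" for n
    have good: "continuable_block L \<alpha> l n \<and> (\<forall>s\<in>block \<alpha> l. norm (continuation L (vshift l n s) ^ k - P n s) \<le> \<delta>)"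
      if n: "n \<in> J" and PC: "\<And>z. z \<in> X \<Longrightarrow> norm (P n z) \<le> C" for n
    proof -
      have cont: "continuable_at L (vshift l n s)" "continuation L (vshift l n s) = F n s" if "s \<in> H" for s
        using continuation_vshift_eq[of "F n" \<beta> "- l" "2 * l" L n l s] F n that unfolding H_def by blast+
      have KX: "block \<alpha> l \<subseteq> X" "block \<alpha> l \<subseteq> H" using KQ QX XH by auto
      have "bounded ((\<lambda>s. continuation L (vshift l n s)) ` block \<alpha> l)"
        unfolding bounded_iff
      proof (intro exI ballI)
        fix x assume "x \<in> (\<lambda>s. continuation L (vshift l n s)) ` block \<alpha> l"
        then obtain s where s: "x = continuation L (vshift l n s)" "s \<in> block \<alpha> l" by blast
        then have "x = F n s" using cont(2) KX by auto
        then show "norm x \<le> B" using B[OF n, of s] s KX by auto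
      qed
      then have "continuable_block L \<alpha> l n"
        using cont KX by (auto simp: continuable_block_def)
      moreover have "norm (F n s ^ k - P n s) \<le> \<delta>" if "s \<in> block \<alpha> l" for s
      proof (rule small[OF _ _ _ that])
        have "F n holomorphic_on Q" using F(1)[OF n] QX XH by (meson holomorphic_on_subset order_trans)
        moreover have "P n holomorphic_on Q" unfolding P_def
          by (rule holomorphic_on_compose[of "vshift l n" Q "dirichlet_poly b {1..i}", unfolded o_def])
            (intro holomorphic_intros)+
        ultimately show "(\<lambda>s. F n s ^ k - P n s) holomorphic_on Q" by (intro holomorphic_intros)
        show "norm (F n z ^ k - P n z) \<le> B ^ k + C" if "z \<in> Q" for z
        proof -
          have zX: "z \<in> X" using that QX by blast
          have "norm (F n z ^ k - P n z) \<le> norm (F n z ^ k) + norm (P n z)" by (rule norm_triangle_ineq4)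
          also have "\<dots> \<le> B ^ k + C"
            unfolding norm_power using B[OF n zX] PC[OF zX] by (intro add_mono power_mono) auto
          finally show ?thesis .
        qed
        show "norm (F n z ^ k - P n z) \<le> \<eta>" if "z \<in> V" for z
        proof -
          have re: "Re z > 3" "z \<in> H" using that V(2) QX XH by (auto simp: V_def)
          then have "F n z = dirichlet_sum a (vshift l n z)" using F(2)[OF n] L by simp
          then have "F n z ^ k = dirichlet_sum b (vshift l n z)"
            unfolding b_def using dirichlet_sum_pow[OF ram, of "vshift l n z"] re by simp
          then show ?thesis using elim re by (simp add: P_def)
        qed
      qed
      ultimately show ?thesis using cont(2) KX by auto
    qed
    show ?case using C(2)[of i] lower_density_complement[OF J(2)]
    proof eventually_elim
      case (elim N)
      have "{n\<in>{1..N}. \<not> (continuable_block L \<alpha> l n \<and> (\<forall>s\<in>block \<alpha> l. norm (continuation L (vshift l n s) ^ k - P n s) \<le> \<delta>))}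
        \<subseteq> {n\<in>{1..N}. \<exists>z\<in>X. norm (P n z) > C} \<union> ({1..N} - J)" (is "?bad \<subseteq> ?A \<union> ?B")
      proof
        fix n assume n: "n \<in> ?bad"
        show "n \<in> ?A \<union> ?B"
        proof (rule ccontr)
          assume "n \<notin> ?A \<union> ?B"
          with n have "n \<in> J" "\<And>z. z \<in> X \<Longrightarrow> norm (P n z) \<le> C" by (auto simp: not_less)
          from good[OF this] n show False by blast
        qed
      qed
      then have "card ?bad \<le> card (?A \<union> ?B)" by (intro card_mono) auto
      also have "\<dots> \<le> card ?A + card ?B" by (rule card_Un_le)
      finally have "real (card ?bad) \<le> real (card ?A) + real (card ?B)" by simp
      then show ?case using elim unfolding P_def by simp
    qed
  qed
qed

section \<open>A diagonal choice of the exceptional set\<close>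

text \<open>
  The index \<open>j\<close> with \<open>M j \<le> n < M (Suc j)\<close>, and \<open>0\<close> for \<open>n < M 0\<close>.
\<close>
definition block_index :: "(nat \<Rightarrow> nat) \<Rightarrow> nat \<Rightarrow> nat" where
  "block_index M n = (LEAST j. n < M (Suc j))"

context
  fixes M :: "nat \<Rightarrow> nat"
  assumes doubling: "\<And>j. M (Suc j) \<ge> 2 * M j" and positive: "M 0 \<ge> 1"
begin

lemma block_start_mono: "i \<le> j \<Longrightarrow> M i \<le> M j"
proof (rule lift_Suc_mono_le[of M])
  show "M n \<le> M (Suc n)" for n using doubling[of n] by simp
qed auto

lemma block_start_gt: "M (Suc n) > n"
proof (induction n)
  case 0
  then show ?case using doubling[of 0] positive by simp
next
  case (Suc n)
  then show ?case using doubling[of "Suc n"] by simp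
qed

lemma less_next_block_start: "n < M (Suc (block_index M n))"
  unfolding block_index_def by (rule LeastI[of _ n]) (rule block_start_gt)

lemma block_index_ge:
  assumes "M j \<le> n"
  shows "j \<le> block_index M n"
proof (rule ccontr)
  assume "\<not> j \<le> block_index M n"
  then have "M (Suc (block_index M n)) \<le> M j" by (intro block_start_mono) simp
  then show False using less_next_block_start[of n] assms by simp
qed

lemma block_index_le: "n < M (Suc j) \<Longrightarrow> block_index M n \<le> j"
  unfolding block_index_def by (rule Least_le)

lemma block_index_eq: "M j \<le> n \<Longrightarrow> n < M (Suc j) \<Longrightarrow> block_index M n = j"
  by (rule antisym[OF block_index_le block_index_ge])

lemma block_start_le:
  assumes "M 0 \<le> n"
  shows "M (block_index M n) \<le> n"
proof (cases "block_index M n")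
  case 0
  then show ?thesis using assms by simp
next
  case (Suc j)
  have "\<not> n < M (Suc j)" using block_index_le[of n j] Suc by linarith
  then show ?thesis using Suc by simp
qed

text \<open>
  A bound linear in \<open>N\<close> for each \<open>h j\<close> on its own survives if \<open>h j\<close> is used only on the \<open>j\<close>-th
  interval: the lengths at least double, so that the earlier intervals contribute a geometric series.
\<close>
lemma sum_over_blocks_le:
  fixes h :: "nat \<Rightarrow> nat \<Rightarrow> real"
  assumes nonneg: "\<And>j n. h j n \<ge> 0" and \<tau>: "\<tau> \<ge> 0"
    and h: "\<And>j N. j \<ge> j0 \<Longrightarrow> N \<ge> M j \<Longrightarrow> (\<Sum>n=1..N. h j n) \<le> \<tau> * real N"
  shows "(\<Sum>n\<in>{M j0..N}. h (block_index M n) n) \<le> 3 * \<tau> * real N"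
proof -
  have seg: "(\<Sum>n\<in>{M j..<R}. h (block_index M n) n) \<le> \<tau> * real R'"
    if "j \<ge> j0" "R \<le> M (Suc j)" "{M j..<R} \<subseteq> {1..R'}" "M j \<le> R'" for j R R'
  proof -
    have "(\<Sum>n\<in>{M j..<R}. h (block_index M n) n) = (\<Sum>n\<in>{M j..<R}. h j n)"
      using that(2) block_index_eq[of j] by (intro sum.cong) auto
    also have "\<dots> \<le> (\<Sum>n=1..R'. h j n)" using that(3) nonneg by (intro sum_mono2) auto
    also have "\<dots> \<le> \<tau> * real R'" using that by (intro h)
    finally show ?thesis .
  qed
  have M1: "M j \<ge> 1" for j using block_start_mono[of 0 j] positive by simp
  have full: "(\<Sum>n\<in>{M j0..<M j}. h (block_index M n) n) \<le> 2 * \<tau> * real (M j)" if "j \<ge> j0" for j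
    using that
  proof (induction j rule: dec_induct)
    case base
    then show ?case using \<tau> by simp
  next
    case (step j)
    have "{M j0..<M (Suc j)} = {M j0..<M j} \<union> {M j..<M (Suc j)}"
      using block_start_mono[OF step(1)] block_start_mono[of j "Suc j"] by auto
    then have "(\<Sum>n\<in>{M j0..<M (Suc j)}. h (block_index M n) n)
      = (\<Sum>n\<in>{M j0..<M j}. h (block_index M n) n) + (\<Sum>n\<in>{M j..<M (Suc j)}. h (block_index M n) n)"
      by (simp only:) (rule sum.union_disjoint, auto)
    also have "\<dots> \<le> 2 * \<tau> * real (M j) + \<tau> * real (M (Suc j))"
    proof (rule add_mono[OF step.IH seg])
      show "{M j..<M (Suc j)} \<subseteq> {1..M (Suc j)}" using M1[of j] by auto
      show "M j \<le> M (Suc j)" by (rule block_start_mono) simp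
    qed (use step in auto)
    finally have "(\<Sum>n\<in>{M j0..<M (Suc j)}. h (block_index M n) n)
      \<le> \<tau> * real (2 * M j) + \<tau> * real (M (Suc j))" by simp
    moreover have "\<tau> * real (2 * M j) \<le> \<tau> * real (M (Suc j))"
      using \<tau> doubling[of j] by (intro mult_left_mono of_nat_mono)
    ultimately show ?case by linarith
  qed
  show ?thesis
  proof (cases "M j0 \<le> N")
    case False
    then show ?thesis using \<tau> by simp
  next
    case True
    define j where "j = block_index M N"
    have j: "j \<ge> j0" unfolding j_def by (rule block_index_ge[OF True])
    have "M 0 \<le> N" using True block_start_mono[of 0 j0] by simp
    then have jN: "M j \<le> N" "N < M (Suc j)"
      unfolding j_def using block_start_le less_next_block_start by auto
    have "{M j0..N} = {M j0..<M j} \<union> {M j..<Suc N}"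
      using block_start_mono[OF j] jN by auto
    then have "(\<Sum>n\<in>{M j0..N}. h (block_index M n) n)
      = (\<Sum>n\<in>{M j0..<M j}. h (block_index M n) n) + (\<Sum>n\<in>{M j..<Suc N}. h (block_index M n) n)"
      by (simp only:) (rule sum.union_disjoint, auto)
    also have "\<dots> \<le> 2 * \<tau> * real (M j) + \<tau> * real N"
    proof (rule add_mono[OF full[OF j] seg[OF j]])
      show "{M j..<Suc N} \<subseteq> {1..N}" using M1[of j] by auto
    qed (use jN in auto)
    finally have "(\<Sum>n\<in>{M j0..N}. h (block_index M n) n) \<le> 2 * \<tau> * real (M j) + \<tau> * real N" .
    moreover have "2 * \<tau> * real (M j) \<le> 2 * \<tau> * real N" using \<tau> jN by (intro mult_left_mono) auto
    ultimately show ?thesis by linarith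
  qed
qed

end

lemma has_density_zeroI:
  assumes "\<And>\<tau>. \<tau> > 0 \<Longrightarrow> \<forall>\<^sub>F N in sequentially. real (card (Z \<inter> {1..N})) \<le> \<tau> * real N"
  shows "has_density Z 0"
  unfolding has_density_def
proof (rule tendstoI)
  fix e :: real assume "e > 0"
  then have "\<forall>\<^sub>F N in sequentially. real (card (Z \<inter> {1..N})) \<le> e / 2 * real N" by (intro assms) simp
  then show "\<forall>\<^sub>F N in sequentially. dist (real (card (Z \<inter> {1..N})) / real N) 0 < e"
  proof eventually_elim
    case (elim N)
    show ?case
    proof (cases "N = 0")
      case False
      then have "real (card (Z \<inter> {1..N})) / real N \<le> e / 2" using elim by (simp add: divide_le_eq)
      then have "real (card (Z \<inter> {1..N})) / real N < e" using \<open>e > 0\<close> by linarith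
      then show ?thesis by simp
    qed (use \<open>e > 0\<close> in simp)
  qed
qed

lemma eventually_const_le_linear: "\<tau> > 0 \<Longrightarrow> \<forall>\<^sub>F N in sequentially. C \<le> \<tau> * real N"
  by (rule eventually_sequentiallyI[of "nat \<lceil>C / \<tau>\<rceil>"]) (simp add: field_simps nat_le_iff ceiling_le_iff)

lemma square_norm_add_le: "(norm (x + y))\<^sup>2 \<le> 2 * (norm x)\<^sup>2 + 2 * (norm (y :: complex))\<^sup>2"
proof -
  have "(norm (x + y))\<^sup>2 \<le> (norm x + norm y)\<^sup>2" by (intro power_mono norm_triangle_ineq) simp
  also have "\<dots> \<le> 2 * (norm x)\<^sup>2 + 2 * (norm y)\<^sup>2"
    using sum_squares_bound[of "norm x" "norm y"] by (simp add: power2_sum)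
  finally show ?thesis .
qed

text \<open>
  The index \<open>\<iota> j\<close> makes the approximation to within \<open>\<delta> j\<close> fail rarely for all \<open>k \<le> j\<close>, and the
  threshold \<open>M j\<close> is so large that from there on the finitely many asymptotic statements about
  the stages up to \<open>j\<close> hold. At \<open>n\<close> in the \<open>j\<close>-th interval the \<open>\<iota> j\<close>-th approximation is required
  to be good; \<open>Z\<close> is the set where it is not. Outside \<open>Z\<close> the function differs from \<open>D k i\<close> by
  \<open>\<delta> j\<close> plus the difference of two approximations, which is small in mean square.
\<close>
lemma diagonal_approximation:
  fixes f :: "nat \<Rightarrow> nat \<Rightarrow> 'a \<Rightarrow> complex" and D :: "nat \<Rightarrow> nat \<Rightarrow> nat \<Rightarrow> 'a \<Rightarrow> complex"
  assumes f_bounded: "\<And>n k. c n \<Longrightarrow> \<exists>B. \<forall>s\<in>K. norm (f k n s) \<le> B"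
    and D_bounded: "\<And>k i. \<exists>B. \<forall>n. \<forall>s\<in>K. norm (D k i n s) \<le> B"
    and T: "\<And>k. T k \<longlonglongrightarrow> 0"
    and mean_square: "\<And>k i j. i \<le> j \<Longrightarrow> \<forall>\<^sub>F N in sequentially. \<forall>s\<in>K.
       (\<Sum>n=1..N. (norm (D k j n s - D k i n s))\<^sup>2) \<le> T k i * real N"
    and approx: "\<And>k \<delta> \<epsilon>. \<delta> > 0 \<Longrightarrow> \<epsilon> > 0 \<Longrightarrow> \<forall>\<^sub>F i in sequentially. \<forall>\<^sub>F N in sequentially.
       real (card {n\<in>{1..N}. \<not> (c n \<and> (\<forall>s\<in>K. norm (f k n s - D k i n s) \<le> \<delta>))}) \<le> \<epsilon> * real N"
  shows "\<exists>Z \<subseteq> {1..}. has_density Z 0 \<and> (\<forall>n\<ge>1. n \<notin> Z \<longrightarrow> c n) \<and>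
    (\<forall>k. \<forall>\<tau>>0. \<forall>\<^sub>F i in sequentially. \<forall>\<^sub>F N in sequentially. \<forall>s\<in>K.
       (\<Sum>n=1..N. (norm ((if n \<in> Z then 0 else f k n s) - D k i n s))\<^sup>2) \<le> \<tau> * real N)"
proof -
  define \<delta> where "\<delta> j = 1 / (real j + 1)" for j
  have \<delta>: "\<delta> j > 0" for j by (simp add: \<delta>_def)
  have \<delta>_mono: "\<delta> j \<le> \<delta> i" if "i \<le> j" for i j using that by (simp add: \<delta>_def frac_le)
  have \<delta>_small: "\<exists>j\<ge>m. \<delta> j \<le> \<tau>" if \<tau>: "\<tau> > 0" for \<tau> m
  proof (intro exI conjI)
    define j where "j = max m (nat \<lceil>1 / \<tau>\<rceil>)"
    have "real j \<ge> 1 / \<tau>" unfolding j_def by linarith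
    then have "real j + 1 \<ge> 1 / \<tau>" by simp
    then show "\<delta> j \<le> \<tau>" using \<tau> by (simp add: \<delta>_def field_simps)
    show "j \<ge> m" by (simp add: j_def)
  qed
  define good where "good k i j n \<longleftrightarrow> c n \<and> (\<forall>s\<in>K. norm (f k n s - D k i n s) \<le> \<delta> j)" for k i j n
  define bad where "bad j i n \<longleftrightarrow> (\<exists>k\<le>j. \<not> good k i j n)" for j i n
  have "\<exists>i\<ge>j. \<forall>\<^sub>F N in sequentially. real (card {n\<in>{1..N}. bad j i n}) \<le> \<delta> j * real N" for j
  proof -
    have "\<forall>\<^sub>F i in sequentially. \<forall>k\<in>{..j}. \<forall>\<^sub>F N in sequentially.
       real (card {n\<in>{1..N}. \<not> good k i j n}) \<le> \<delta> j * \<delta> j * real N"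
      unfolding good_def by (intro eventually_ball_finite ballI approx) (auto intro: \<delta> mult_pos_pos)
    with eventually_ge_at_top[of j]
    have "\<forall>\<^sub>F i in sequentially. i \<ge> j \<and> (\<forall>k\<in>{..j}. \<forall>\<^sub>F N in sequentially.
       real (card {n\<in>{1..N}. \<not> good k i j n}) \<le> \<delta> j * \<delta> j * real N)" by (rule eventually_conj)
    from eventually_happens[OF this] obtain i where i: "i \<ge> j" "\<forall>k\<in>{..j}. \<forall>\<^sub>F N in sequentially.
       real (card {n\<in>{1..N}. \<not> good k i j n}) \<le> \<delta> j * \<delta> j * real N" by auto
    have "\<forall>\<^sub>F N in sequentially. \<forall>k\<in>{..j}. real (card {n\<in>{1..N}. \<not> good k i j n}) \<le> \<delta> j * \<delta> j * real N"
      using i(2) by (intro eventually_ball_finite) auto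
    then have "\<forall>\<^sub>F N in sequentially. real (card {n\<in>{1..N}. bad j i n}) \<le> \<delta> j * real N"
    proof eventually_elim
      case (elim N)
      have "{n\<in>{1..N}. bad j i n} = (\<Union>k\<in>{..j}. {n\<in>{1..N}. \<not> good k i j n})" by (auto simp: bad_def)
      then have "card {n\<in>{1..N}. bad j i n} \<le> (\<Sum>k\<in>{..j}. card {n\<in>{1..N}. \<not> good k i j n})"
        by (simp only:) (rule card_UN_le, simp)
      then have "real (card {n\<in>{1..N}. bad j i n}) \<le> (\<Sum>k\<in>{..j}. real (card {n\<in>{1..N}. \<not> good k i j n}))"
        unfolding of_nat_sum[symmetric] by (rule of_nat_mono)
      also have "\<dots> \<le> (\<Sum>k\<in>{..j}. \<delta> j * \<delta> j * real N)" using elim by (intro sum_mono) auto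
      also have "\<dots> = (real (Suc j) * \<delta> j) * (\<delta> j * real N)" by (simp add: mult_ac)
      also have "real (Suc j) * \<delta> j = 1" by (simp add: \<delta>_def)
      finally show ?case by simp
    qed
    with i(1) show ?thesis by blast
  qed
  then have "\<exists>\<iota>. \<forall>j. \<iota> j \<ge> j \<and> (\<forall>\<^sub>F N in sequentially. real (card {n\<in>{1..N}. bad j (\<iota> j) n}) \<le> \<delta> j * real N)"
    by (intro choice allI) blast
  then obtain \<iota> where \<iota>: "\<And>j. \<iota> j \<ge> j"
    "\<And>j. \<forall>\<^sub>F N in sequentially. real (card {n\<in>{1..N}. bad j (\<iota> j) n}) \<le> \<delta> j * real N" by blast
  define ok where "ok j N \<longleftrightarrow> real (card {n\<in>{1..N}. bad j (\<iota> j) n}) \<le> \<delta> j * real N \<and>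
     (\<forall>k\<in>{..j}. \<forall>i\<in>{..\<iota> j}. \<forall>s\<in>K. (\<Sum>n=1..N. (norm (D k (\<iota> j) n s - D k i n s))\<^sup>2) \<le> T k i * real N)" for j N
  have "\<forall>\<^sub>F N in sequentially. ok j N" for j
    unfolding ok_def
    by (intro eventually_conj eventually_ball_finite ballI \<iota>(2) mean_square) auto
  then have "\<forall>j. \<exists>M. \<forall>N\<ge>M. ok j N" unfolding eventually_sequentially by blast
  from choice[OF this] obtain M0 where M0: "\<And>j N. N \<ge> M0 j \<Longrightarrow> ok j N" by blast
  \<comment> \<open>The power of \<open>2\<close> makes the thresholds at least double.\<close>
  define M where "M j = 2 ^ j * (1 + (\<Sum>i\<le>j. M0 i))" for j
  have doubling: "M (Suc j) \<ge> 2 * M j" for j by (simp add: M_def algebra_simps)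
  have M_pos: "M j \<ge> 1" for j
  proof -
    have "1 * 1 \<le> M j" unfolding M_def by (intro mult_mono) auto
    then show ?thesis by simp
  qed
  have M_ge: "M j \<ge> M0 j" for j
  proof -
    have "M0 j \<le> (\<Sum>i\<le>j. M0 i)" by (rule member_le_sum) auto
    also have "\<dots> \<le> 1 * (1 + (\<Sum>i\<le>j. M0 i))" by simp
    also have "\<dots> \<le> M j" unfolding M_def by (intro mult_right_mono) auto
    finally show ?thesis .
  qed
  note blocks = doubling M_pos[of 0]
  define J where "J = block_index M"
  have J_ge: "j \<le> J n" if "M j \<le> n" for j n unfolding J_def by (rule block_index_ge[OF blocks that])
  define Z where "Z = {n. n \<ge> 1 \<and> (n < M 0 \<or> bad (J n) (\<iota> (J n)) n)}"
  have Z_good: "good k (\<iota> (J n)) (J n) n" if "n \<ge> 1" "n \<notin> Z" "k \<le> J n" for n k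
    using that by (auto simp: Z_def bad_def)
  have dens: "\<forall>\<^sub>F N in sequentially. real (card (Z \<inter> {1..N})) \<le> \<tau> * real N" if \<tau>: "\<tau> > 0" for \<tau>
  proof -
    obtain j0 where j0: "\<delta> j0 \<le> \<tau> / 6" using \<delta>_small[of "\<tau> / 6" 0] \<tau> by auto
    define h where "h j n = (if bad j (\<iota> j) n then 1 else 0 :: real)" for j n
    have count: "(\<Sum>n\<in>A. h (g n) n) = real (card {n\<in>A. bad (g n) (\<iota> (g n)) n})" if "finite A" for A g
      using that by (simp add: h_def sum.If_cases Int_def)
    have blk: "(\<Sum>n\<in>{M j0..N}. h (J n) n) \<le> 3 * \<delta> j0 * real N" for N
      unfolding J_def
    proof (rule sum_over_blocks_le[OF blocks])
      fix j N assume "j \<ge> j0" "N \<ge> M j"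
      then have "ok j N" using M_ge[of j] by (intro M0) simp
      then have "(\<Sum>n=1..N. h j n) \<le> \<delta> j * real N"
        using count[of "{1..N}" "\<lambda>_. j"] by (simp add: ok_def)
      also have "\<dots> \<le> \<delta> j0 * real N" using \<delta>_mono[OF \<open>j \<ge> j0\<close>] by (intro mult_right_mono) auto
      finally show "(\<Sum>n=1..N. h j n) \<le> \<delta> j0 * real N" .
    qed (use \<delta>[of j0] in \<open>auto simp: h_def\<close>)
    have "\<forall>\<^sub>F N in sequentially. real (M j0) \<le> \<tau> / 2 * real N"
      by (rule eventually_const_le_linear) (use \<tau> in simp)
    then show ?thesis
    proof eventually_elim
      case (elim N)
      have MM: "M 0 \<le> M j0" by (rule block_start_mono[OF blocks]) simp
      have "Z \<inter> {1..N} \<subseteq> {1..<M j0} \<union> {n\<in>{M j0..N}. bad (J n) (\<iota> (J n)) n}"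
        using MM by (auto simp: Z_def)
      then have "card (Z \<inter> {1..N}) \<le> card ({1..<M j0} \<union> {n\<in>{M j0..N}. bad (J n) (\<iota> (J n)) n})"
        by (intro card_mono) auto
      also have "\<dots> \<le> card {1..<M j0} + card {n\<in>{M j0..N}. bad (J n) (\<iota> (J n)) n}" by (rule card_Un_le)
      finally have "real (card (Z \<inter> {1..N})) \<le> real (M j0) + (\<Sum>n\<in>{M j0..N}. h (J n) n)"
        unfolding count[OF finite_atLeastAtMost] by simp
      moreover note blk[of N] elim
      moreover have "3 * \<delta> j0 * real N \<le> \<tau> / 2 * real N" using j0 by (intro mult_right_mono) auto
      ultimately show ?case by linarith
    qed
  qed
  have close: "\<forall>\<^sub>F i in sequentially. \<forall>\<^sub>F N in sequentially. \<forall>s\<in>K.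
       (\<Sum>n=1..N. (norm ((if n \<in> Z then 0 else f k n s) - D k i n s))\<^sup>2) \<le> \<tau> * real N"
    if \<tau>: "\<tau> > 0" for k \<tau>
  proof -
    define \<theta> where "\<theta> = \<tau> / 10"
    have \<theta>: "\<theta> > 0" using \<tau> by (simp add: \<theta>_def)
    have "\<forall>\<^sub>F i in sequentially. T k i < \<theta>" using T[of k] \<theta> by (rule order_tendstoD)
    then show ?thesis
    proof eventually_elim
      case (elim i)
      obtain j0 where j0: "j0 \<ge> max k i" "\<delta> j0 \<le> min 1 \<theta>" using \<delta>_small[of "min 1 \<theta>" "max k i"] \<theta> by auto
      have \<delta>sq: "\<delta> j * \<delta> j \<le> \<theta>" if "j \<ge> j0" for j
      proof -
        have "\<delta> j \<le> min 1 \<theta>" using \<delta>_mono[OF that] j0 by simp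
        then have "\<delta> j * \<delta> j \<le> 1 * \<theta>" using \<delta>[of j] by (intro mult_mono) auto
        then show ?thesis by simp
      qed
      obtain B where B: "\<forall>n. \<forall>s\<in>K. norm (D k i n s) \<le> B" using D_bounded by blast
      define g where "g n s = (if n \<in> Z then 0 else f k n s) - D k i n s" for n s
      have "\<exists>E. \<forall>s\<in>K. (norm (g n s))\<^sup>2 \<le> E" if "n \<ge> 1" for n
      proof (cases "n \<in> Z")
        case True
        have "(norm (g n s))\<^sup>2 \<le> B\<^sup>2" if "s \<in> K" for s
          using B that True by (auto simp: g_def intro!: power_mono)
        then show ?thesis by blast
      next
        case False
        then have "c n" using Z_good[of n 0] that by (simp add: good_def)
        then obtain B' where B': "\<forall>s\<in>K. norm (f k n s) \<le> B'" using f_bounded by blast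
        have "(norm (g n s))\<^sup>2 \<le> (B' + B)\<^sup>2" if "s \<in> K" for s
        proof (rule power_mono)
          have "norm (g n s) \<le> norm (f k n s) + norm (D k i n s)"
            using False by (simp add: g_def norm_triangle_ineq4)
          also have "\<dots> \<le> B' + B" using B B' that by (intro add_mono) auto
          finally show "norm (g n s) \<le> B' + B" .
        qed simp
        then show ?thesis by blast
      qed
      then have "\<forall>n\<in>{1..}. \<exists>E. \<forall>s\<in>K. (norm (g n s))\<^sup>2 \<le> E" by simp
      from bchoice[OF this] obtain E where E: "\<forall>n\<in>{1..}. \<forall>s\<in>K. (norm (g n s))\<^sup>2 \<le> E n" ..
      define E0 where "E0 = (\<Sum>n\<in>{1..<M j0}. \<bar>E n\<bar>)"
      have "B\<^sup>2 \<ge> 0" by simp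
      have "\<forall>\<^sub>F N in sequentially. real (card (Z \<inter> {1..N})) \<le> \<theta> / (B\<^sup>2 + 1) * real N"
        by (rule dens) (use \<theta> in \<open>simp add: add_nonneg_pos\<close>)
      moreover have "\<forall>\<^sub>F N in sequentially. E0 \<le> \<theta> * real N" by (rule eventually_const_le_linear[OF \<theta>])
      ultimately show ?case
      proof eventually_elim
        case (elim N)
        have Zc: "B\<^sup>2 * real (card (Z \<inter> {1..N})) \<le> \<theta> * real N"
        proof -
          have "B\<^sup>2 * real (card (Z \<inter> {1..N})) \<le> (B\<^sup>2 + 1) * real (card (Z \<inter> {1..N}))"
            by (intro mult_right_mono) auto
          also have "\<dots> \<le> (B\<^sup>2 + 1) * (\<theta> / (B\<^sup>2 + 1) * real N)" using elim by (intro mult_left_mono) auto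
          also have "\<dots> = \<theta> * real N" using \<open>B\<^sup>2 \<ge> 0\<close> by (simp add: add_nonneg_eq_0_iff)
          finally show ?thesis .
        qed
        show ?case
        proof
          fix s assume s: "s \<in> K"
          \<comment> \<open>The maximum is \<open>\<iota> j\<close> for \<open>j \<ge> j0\<close>; only such \<open>j\<close> occur below.\<close>
          define h where "h j n = (norm (D k (max i (\<iota> j)) n s - D k i n s))\<^sup>2" for j n
          have blk: "(\<Sum>n\<in>{M j0..N}. h (J n) n) \<le> 3 * \<theta> * real N"
            unfolding J_def
          proof (rule sum_over_blocks_le[OF blocks])
            fix j N assume j: "j \<ge> j0" and N: "N \<ge> M j"
            then have "ok j N" using M_ge[of j] by (intro M0) simp
            moreover have "i \<le> \<iota> j" "k \<le> j" using \<iota>(1)[of j] j j0(1) by auto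
            ultimately have "(\<Sum>n=1..N. h j n) \<le> T k i * real N"
              using s by (simp add: ok_def h_def max_absorb2)
            also have "\<dots> \<le> \<theta> * real N" using \<open>T k i < \<theta>\<close> by (intro mult_right_mono) auto
            finally show "(\<Sum>n=1..N. h j n) \<le> \<theta> * real N" .
          qed (use \<theta> in \<open>auto simp: h_def\<close>)
          have pt: "(norm (g n s))\<^sup>2 \<le> (if n \<in> Z then B\<^sup>2 else 0) + 2 * \<theta> + 2 * h (J n) n"
            if n: "n \<ge> M j0" for n
          proof (cases "n \<in> Z")
            case True
            then have "(norm (g n s))\<^sup>2 \<le> B\<^sup>2" using B s by (auto simp: g_def intro!: power_mono)
            moreover have "h (J n) n \<ge> 0" by (simp add: h_def)
            ultimately show ?thesis using True \<theta> by (simp add: add_increasing2)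
          next
            case False
            have Jn: "J n \<ge> j0" by (rule J_ge[OF n])
            have n1: "n \<ge> 1" using n M_pos[of j0] by simp
            have "k \<le> J n" "i \<le> \<iota> (J n)" using Jn j0(1) \<iota>(1)[of "J n"] by auto
            then have "norm (f k n s - D k (\<iota> (J n)) n s) \<le> \<delta> (J n)"
              using Z_good[OF n1 False, of k] s by (simp add: good_def)
            then have "(norm (f k n s - D k (\<iota> (J n)) n s))\<^sup>2 \<le> (\<delta> (J n))\<^sup>2" by (intro power_mono) auto
            also have "\<dots> \<le> \<theta>" using \<delta>sq[OF Jn] by (simp add: power2_eq_square)
            finally have 1: "(norm (f k n s - D k (\<iota> (J n)) n s))\<^sup>2 \<le> \<theta>" .
            have "g n s = (f k n s - D k (\<iota> (J n)) n s) + (D k (\<iota> (J n)) n s - D k i n s)"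
              using False by (simp add: g_def)
            then have "(norm (g n s))\<^sup>2 \<le> 2 * (norm (f k n s - D k (\<iota> (J n)) n s))\<^sup>2
               + 2 * (norm (D k (\<iota> (J n)) n s - D k i n s))\<^sup>2"
              by (simp only: square_norm_add_le)
            then show ?thesis using 1 False \<open>i \<le> \<iota> (J n)\<close> by (simp add: h_def max_absorb2)
          qed
          have "(\<Sum>n=1..N. (norm (g n s))\<^sup>2) \<le> (\<Sum>n\<in>{1..<M j0} \<union> {M j0..N}. (norm (g n s))\<^sup>2)"
            by (rule sum_mono2) auto
          also have "\<dots> = (\<Sum>n\<in>{1..<M j0}. (norm (g n s))\<^sup>2) + (\<Sum>n\<in>{M j0..N}. (norm (g n s))\<^sup>2)"
            by (rule sum.union_disjoint) auto
          finally have split: "(\<Sum>n=1..N. (norm (g n s))\<^sup>2)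
            \<le> (\<Sum>n\<in>{1..<M j0}. (norm (g n s))\<^sup>2) + (\<Sum>n\<in>{M j0..N}. (norm (g n s))\<^sup>2)" .
          have part1: "(\<Sum>n\<in>{1..<M j0}. (norm (g n s))\<^sup>2) \<le> E0"
            unfolding E0_def using E s by (intro sum_mono order_trans[OF _ abs_ge_self]) auto
          have "(\<Sum>n\<in>{M j0..N}. (norm (g n s))\<^sup>2)
            \<le> (\<Sum>n\<in>{M j0..N}. (if n \<in> Z then B\<^sup>2 else 0) + 2 * \<theta> + 2 * h (J n) n)"
            by (intro sum_mono pt) simp
          also have "\<dots> = (\<Sum>n\<in>{M j0..N}. if n \<in> Z then B\<^sup>2 else 0) + real (card {M j0..N}) * (2 * \<theta>)
              + 2 * (\<Sum>n\<in>{M j0..N}. h (J n) n)"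
            by (simp add: sum.distrib sum_distrib_left)
          also have "(\<Sum>n\<in>{M j0..N}. if n \<in> Z then B\<^sup>2 else 0) = B\<^sup>2 * real (card ({M j0..N} \<inter> Z))"
            by (simp add: sum.If_cases)
          finally have part2: "(\<Sum>n\<in>{M j0..N}. (norm (g n s))\<^sup>2) \<le> B\<^sup>2 * real (card ({M j0..N} \<inter> Z))
              + real (card {M j0..N}) * (2 * \<theta>) + 2 * (\<Sum>n\<in>{M j0..N}. h (J n) n)" .
          have "B\<^sup>2 * real (card ({M j0..N} \<inter> Z)) \<le> B\<^sup>2 * real (card (Z \<inter> {1..N}))"
            using M_pos[of j0] by (intro mult_left_mono of_nat_mono card_mono) auto
          moreover have "real (card {M j0..N}) * (2 * \<theta>) \<le> real N * (2 * \<theta>)"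
            using \<theta> M_pos[of j0] by (intro mult_right_mono of_nat_mono) auto
          moreover have "E0 \<le> \<theta> * real N" using elim by simp
          ultimately have "(\<Sum>n=1..N. (norm (g n s))\<^sup>2) \<le> 10 * \<theta> * real N"
            using split part1 part2 Zc blk by (simp add: algebra_simps)
          then show "(\<Sum>n=1..N. (norm ((if n \<in> Z then 0 else f k n s) - D k i n s))\<^sup>2) \<le> \<tau> * real N"
            by (simp add: g_def \<theta>_def)
        qed
      qed
    qed
  qed
  show ?thesis
  proof (intro exI[of _ Z] conjI allI impI)
    show "Z \<subseteq> {1..}" by (auto simp: Z_def)
    show "has_density Z 0" by (rule has_density_zeroI[OF dens])
    show "c n" if "n \<ge> 1" "n \<notin> Z" for n using Z_good[OF that, of 0] by (simp add: good_def)
  qed (rule close)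
qed

section \<open>Moments outside a set of density zero\<close>

lemma norm_dirichlet_poly_le:
  assumes "Re s \<ge> 0"
  shows "norm (dirichlet_poly b {1..i} s) \<le> (\<Sum>m\<in>{1..i}. norm (b m))"
  unfolding dirichlet_poly_def
  by (rule sum_norm_le) (use assms in \<open>auto intro!: norm_dirichlet_coeff_div_le\<close>)

lemma norm_dirichlet_sum_le:
  assumes "dirichlet_abs_conv a (Re s)"
  shows "norm (dirichlet_sum a s) \<le> (\<Sum>\<^sub>\<infinity>n. norm (a n) / real n powr Re s)"
  unfolding dirichlet_sum_def norm_dirichlet_term[symmetric]
  by (rule norm_infsum_bound) (use assms in \<open>simp add: dirichlet_abs_conv_def norm_dirichlet_term\<close>)

lemma class_N_imp_locally_bounded_shifts:
  assumes N: "L \<in> class_N u" and ram: "ramanujan_bounded a"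
    and L: "\<And>s. Re s > 1 \<Longrightarrow> L s = dirichlet_sum a s" and \<beta>: "u < \<beta>" "\<beta> \<le> 1" and l: "l > 0"
  shows "locally_bounded_shifts L \<beta> l"
  unfolding locally_bounded_shifts_def
proof (intro allI impI)
  fix \<epsilon> :: real assume \<epsilon>: "\<epsilon> > 0"
  define H where "H = half_strip \<beta> (- l) (2 * l)"
  have "\<forall>\<alpha>\<in>{u<..1}. \<forall>l>0. \<forall>\<epsilon>>0. \<exists>J \<subseteq> {1..}. lower_density J > ereal (1 - \<epsilon>) \<and>
        (\<exists>F :: nat \<Rightarrow> complex \<Rightarrow> complex.
           (\<forall>n\<in>J. F n holomorphic_on half_strip \<alpha> (- l) (2 * l) \<and>
              (\<forall>s\<in>half_strip \<alpha> (- l) (2 * l). Re s > 1 \<longrightarrow> F n s = L (vshift l n s))) \<and>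
           normal_family (half_strip \<alpha> (- l) (2 * l)) (F ` J))"
    using N unfolding class_N_def by simp
  from bspec[OF this, of \<beta>, rule_format, OF _ l \<epsilon>] \<beta>
  obtain J F where J: "J \<subseteq> {1..}" "lower_density J > ereal (1 - \<epsilon>)"
    and F: "\<forall>n\<in>J. F n holomorphic_on H \<and> (\<forall>s\<in>H. Re s > 1 \<longrightarrow> F n s = L (vshift l n s))"
    and nf: "normal_family H (F ` J)"
    unfolding H_def[symmetric] by auto
  define z1 where "z1 = Complex 2 0"
  have z1: "z1 \<in> H" "Re z1 > 1" using \<beta> l by (auto simp: z1_def H_def half_strip_def)
  define B where "B = (\<Sum>\<^sub>\<infinity>n. norm (a n) / real n powr 2)"
  have B: "norm (F n z1) \<le> B" if "n \<in> J" for n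
  proof -
    have "F n z1 = dirichlet_sum a (vshift l n z1)"
      using bspec[OF F that] z1 L[of "vshift l n z1"] by simp
    moreover have "norm (dirichlet_sum a (vshift l n z1)) \<le> B"
      using norm_dirichlet_sum_le[of a "vshift l n z1"] ramanujan_bounded_abs_conv[OF ram, of 2]
      by (simp add: B_def z1_def)
    ultimately show ?thesis by simp
  qed
  have "\<exists>C. \<forall>n\<in>J. \<forall>z\<in>X. norm (F n z) \<le> C" if X: "compact X" "X \<subseteq> H" for X
  proof -
    have "\<exists>C. \<forall>f\<in>F ` J. \<forall>z\<in>X. norm (f z) \<le> C"
    proof (rule normal_family_imp_locally_bounded[OF _ _ _ nf z1(1) _ X])
      show "open H" "connected H" unfolding H_def by (rule open_half_strip, rule connected_half_strip)
    qed (use F B in auto)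
    then show ?thesis by auto
  qed
  with J F show "\<exists>J \<subseteq> {1..}. lower_density J > ereal (1 - \<epsilon>) \<and>
     (\<exists>F. (\<forall>n\<in>J. F n holomorphic_on half_strip \<beta> (- l) (2 * l) \<and>
              (\<forall>s\<in>half_strip \<beta> (- l) (2 * l). Re s > 1 \<longrightarrow> F n s = L (vshift l n s))) \<and>
          (\<forall>X. compact X \<longrightarrow> X \<subseteq> half_strip \<beta> (- l) (2 * l) \<longrightarrow>
              (\<exists>B. \<forall>n\<in>J. \<forall>s\<in>X. norm (F n s) \<le> B)))"
    unfolding H_def[symmetric] by (intro exI[of _ J] conjI exI[of _ F]) auto
qed

text \<open>
  Linear in the squares, so that it can be summed over \<open>n\<close> without taking roots.
\<close>
lemma abs_square_diff_le:
  fixes x y :: complex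
  assumes "\<theta> > 0"
  shows "\<bar>(norm x)\<^sup>2 - (norm y)\<^sup>2\<bar> \<le> (1 + 1 / \<theta>) * (norm (x - y))\<^sup>2 + \<theta> * (norm y)\<^sup>2"
proof -
  define d where "d = norm (x - y)"
  have "\<bar>norm x - norm y\<bar> \<le> d" unfolding d_def by (rule norm_triangle_ineq3)
  moreover have "norm x + norm y \<le> d + 2 * norm y" using norm_triangle_sub[of x y] by (simp add: d_def)
  ultimately have "\<bar>norm x - norm y\<bar> * (norm x + norm y) \<le> d * (d + 2 * norm y)"
    by (intro mult_mono) (auto simp: d_def)
  moreover have "\<bar>(norm x)\<^sup>2 - (norm y)\<^sup>2\<bar> = \<bar>norm x - norm y\<bar> * (norm x + norm y)"
  proof -
    have "(norm x)\<^sup>2 - (norm y)\<^sup>2 = (norm x - norm y) * (norm x + norm y)"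
      by (simp add: power2_eq_square algebra_simps)
    then show ?thesis by (simp add: abs_mult)
  qed
  moreover have "2 * (d * norm y) \<le> (1 / \<theta>) * d\<^sup>2 + \<theta> * (norm y)\<^sup>2"
  proof -
    have "0 \<le> (d - \<theta> * norm y)\<^sup>2 / \<theta>" using assms by simp
    also have "\<dots> = (1 / \<theta>) * d\<^sup>2 + \<theta> * (norm y)\<^sup>2 - 2 * (d * norm y)"
      using assms by (simp add: field_simps power2_eq_square)
    finally show ?thesis by simp
  qed
  ultimately show ?thesis by (simp add: d_def[symmetric] power2_eq_square algebra_simps)
qed

lemma le_const_plus_square:
  fixes d \<theta> :: real
  assumes "\<theta> > 0"
  shows "d \<le> \<theta> + d\<^sup>2 / \<theta>"
proof (cases "d \<le> \<theta>")
  case True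
  have "d\<^sup>2 / \<theta> \<ge> 0" using assms by simp
  with True show ?thesis by simp
next
  case False
  then have "d * \<theta> \<le> d * d" using assms by (intro mult_left_mono) auto
  then have "d \<le> d\<^sup>2 / \<theta>" using assms by (simp add: field_simps power2_eq_square)
  then show ?thesis using assms by simp
qed

text \<open>
  Closeness in mean square to partial sums transfers the first two moments of the partial sums, which
  orthogonality evaluates: the mean square is a partial sum of the series of squares, and in the mean only
  the coefficient at \<open>1\<close> survives.
\<close>
lemma moments_of_approximable:
  fixes x :: "nat \<Rightarrow> complex \<Rightarrow> complex" and b :: "nat \<Rightarrow> complex"
  assumes \<alpha>: "\<alpha> \<ge> 0" and K: "\<And>s. s \<in> K \<Longrightarrow> Re s \<ge> \<alpha>"
    and sq: "(\<lambda>m. (norm (b m))\<^sup>2 / real m powr (2 * \<alpha>)) summable_on UNIV"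
    and S: "frequency_independent l S" "1 \<in> S" and supp: "\<And>m. m \<notin> S \<Longrightarrow> b m = 0"
    and close: "\<And>\<tau>. \<tau> > 0 \<Longrightarrow> \<forall>\<^sub>F i in sequentially. \<forall>\<^sub>F N in sequentially. \<forall>s\<in>K.
       (\<Sum>n=1..N. (norm (x n s - dirichlet_poly b {1..i} (vshift l n s)))\<^sup>2) \<le> \<tau> * real N"
  shows "uniform_limit K (\<lambda>N s. (\<Sum>n=1..N. (norm (x n s))\<^sup>2) / real N)
      (\<lambda>s. \<Sum>\<^sub>\<infinity>m. (norm (b m))\<^sup>2 / real m powr (2 * Re s)) sequentially"
    and "uniform_limit K (\<lambda>N s. (\<Sum>n=1..N. x n s) / of_nat N) (\<lambda>s. b 1) sequentially"
proof -
  define y where "y i n s = dirichlet_poly b {1..i} (vshift l n s)" for i n s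
  define t where "t s m = (norm (b m))\<^sup>2 / real m powr (2 * Re s)" for s m
  define t0 where "t0 m = (norm (b m))\<^sup>2 / real m powr (2 * \<alpha>)" for m
  define S0 where "S0 = infsum t0 UNIV"
  have b0: "b 0 = 0" by (rule supp) (use frequency_independent_subset[OF S(1)] in auto)
  have S0: "S0 \<ge> 0" unfolding S0_def t0_def by (intro infsum_nonneg) auto
  have tt0: "t s m \<le> t0 m" if "s \<in> K" for s m
  proof (cases "m = 0")
    case False
    then have "real m powr (2 * \<alpha>) \<le> real m powr (2 * Re s)" using K[OF that] by (intro powr_mono) auto
    then show ?thesis using False unfolding t_def t0_def by (intro divide_left_mono mult_pos_pos) auto
  qed (simp add: t_def t0_def)
  have tsum: "t s summable_on UNIV" if "s \<in> K" for s
  proof (rule summable_on_comparison_test[OF sq[folded t0_def[abs_def]]])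
    show "t s m \<le> t0 m" for m by (rule tt0[OF that])
  qed (simp add: t_def)
  have Si_le: "(\<Sum>m\<in>{1..i}. t s m) \<le> S0" if "s \<in> K" for s i
  proof -
    have "(\<Sum>m\<in>{1..i}. t s m) \<le> (\<Sum>m\<in>{1..i}. t0 m)" by (intro sum_mono tt0 that)
    also have "\<dots> \<le> S0" unfolding S0_def
      by (rule finite_sum_le_infsum) (use sq in \<open>auto simp: t0_def[abs_def]\<close>)
    finally show ?thesis .
  qed
  have tail: "\<forall>\<^sub>F i in sequentially. \<forall>s\<in>K. \<bar>infsum (t s) UNIV - (\<Sum>m\<in>{1..i}. t s m)\<bar> \<le> \<theta>"
    if \<theta>: "\<theta> > 0" for \<theta>
  proof -
    have "\<forall>\<^sub>F i in sequentially. \<forall>j. sum t0 {i<..j} \<le> \<theta>"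
      by (rule sums_tail_eventually_small[OF sq[folded t0_def[abs_def]] _ \<theta>]) (simp add: t0_def)
    then show ?thesis
    proof eventually_elim
      case (elim i)
      show ?case
      proof
        fix s assume s: "s \<in> K"
        have t00: "t s 0 = 0" by (simp add: t_def)
        have split: "sum (t s) {..j} = (\<Sum>m\<in>{1..i}. t s m) + sum (t s) {i<..j}" if "j \<ge> i" for j
        proof -
          have "{..j} = insert 0 ({1..i} \<union> {i<..j})" using that by auto
          then have "sum (t s) {..j} = t s 0 + sum (t s) ({1..i} \<union> {i<..j})" by simp
          also have "sum (t s) ({1..i} \<union> {i<..j}) = (\<Sum>m\<in>{1..i}. t s m) + sum (t s) {i<..j}"
            by (rule sum.union_disjoint) auto
          finally show ?thesis by (simp add: t00)
        qed
        have "t s sums infsum (t s) UNIV" using tsum[OF s] by (intro has_sum_imp_sums has_sum_infsum)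
        then have "(\<lambda>j. sum (t s) {..j}) \<longlonglongrightarrow> infsum (t s) UNIV" by (simp add: sums_def_le)
        then have "infsum (t s) UNIV \<le> (\<Sum>m\<in>{1..i}. t s m) + \<theta>"
        proof (rule LIMSEQ_le_const2, intro exI[of _ i] allI impI)
          fix j assume j: "i \<le> j"
          have "sum (t s) {i<..j} \<le> sum t0 {i<..j}" by (intro sum_mono tt0 s)
          then show "sum (t s) {..j} \<le> (\<Sum>m\<in>{1..i}. t s m) + \<theta>"
            using split[OF j] elim[rule_format, of j] by simp
        qed
        moreover have "(\<Sum>m\<in>{1..i}. t s m) \<le> infsum (t s) UNIV"
          by (rule finite_sum_le_infsum[OF tsum[OF s]]) (auto simp: t_def)
        ultimately show "\<bar>infsum (t s) UNIV - (\<Sum>m\<in>{1..i}. t s m)\<bar> \<le> \<theta>" by simp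
      qed
    qed
  qed
  have y_square: "\<forall>\<^sub>F N in sequentially. \<forall>s\<in>K.
      \<bar>(\<Sum>n=1..N. (norm (y i n s))\<^sup>2) - real N * (\<Sum>m\<in>{1..i}. t s m)\<bar> \<le> \<theta> * real N" if "\<theta> > 0" for \<theta> i
  proof -
    have "\<forall>\<^sub>F N in sequentially. \<forall>s. Re s \<ge> 0 \<longrightarrow>
     \<bar>(\<Sum>n=1..N. (norm (dirichlet_poly b {1..i} (vshift l n s)))\<^sup>2)
        - real N * (\<Sum>m\<in>{1..i}. (norm (b m))\<^sup>2 / real m powr (2 * Re s))\<bar> \<le> \<theta> * real N"
      by (rule dirichlet_poly_mean_square[OF S(1)]) (use supp that in auto)
    then show ?thesis
      by eventually_elim (use K \<alpha> in \<open>fastforce simp: y_def t_def\<close>)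
  qed
  have y_mean: "\<forall>\<^sub>F N in sequentially. \<forall>s\<in>K.
      norm ((\<Sum>n=1..N. y i n s) - of_nat N * b 1) \<le> \<theta> * real N" if "\<theta> > 0" "i \<ge> 1" for \<theta> i
  proof -
    have "\<forall>\<^sub>F N in sequentially. \<forall>s. Re s \<ge> 0 \<longrightarrow>
     norm ((\<Sum>n=1..N. dirichlet_poly b {1..i} (vshift l n s)) - of_nat N * b 1) \<le> \<theta> * real N"
      by (rule dirichlet_poly_mean[OF S]) (use supp that in auto)
    then show ?thesis
      by eventually_elim (use K \<alpha> in \<open>fastforce simp: y_def\<close>)
  qed
  show "uniform_limit K (\<lambda>N s. (\<Sum>n=1..N. (norm (x n s))\<^sup>2) / real N)
      (\<lambda>s. \<Sum>\<^sub>\<infinity>m. (norm (b m))\<^sup>2 / real m powr (2 * Re s)) sequentially"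
  proof (rule uniform_limitI)
    fix e :: real assume e: "e > 0"
    define \<theta> where "\<theta> = min 1 (e / (2 * (S0 + 4)))"
    have \<theta>: "\<theta> > 0" "\<theta> \<le> 1" "\<theta> * (S0 + 4) \<le> e / 2"
    proof -
      show "\<theta> > 0" "\<theta> \<le> 1" using e S0 by (auto simp: \<theta>_def)
      have "\<theta> * (S0 + 4) \<le> e / (2 * (S0 + 4)) * (S0 + 4)" using S0 by (intro mult_right_mono) (auto simp: \<theta>_def)
      also have "e / (2 * (S0 + 4)) * (S0 + 4) = e / 2"
      proof -
        have "S0 + 4 \<noteq> 0" using S0 by simp
        then show ?thesis unfolding times_divide_eq_left by (rule mult_divide_mult_cancel_right)
      qed
      finally show "\<theta> * (S0 + 4) \<le> e / 2" .
    qed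
    define \<tau> where "\<tau> = \<theta> / (1 + 1 / \<theta>)"
    have th1: "1 + 1 / \<theta> > 0" using \<theta> by (simp add: add_pos_pos)
    have \<tau>: "\<tau> > 0" "(1 + 1 / \<theta>) * \<tau> = \<theta>" using \<theta> th1 by (auto simp: \<tau>_def)
    have "\<forall>\<^sub>F i in sequentially. (\<forall>\<^sub>F N in sequentially. \<forall>s\<in>K. (\<Sum>n=1..N. (norm (x n s - y i n s))\<^sup>2) \<le> \<tau> * real N)
        \<and> (\<forall>s\<in>K. \<bar>infsum (t s) UNIV - (\<Sum>m\<in>{1..i}. t s m)\<bar> \<le> \<theta>)"
      unfolding y_def by (intro eventually_conj close[OF \<tau>(1)] tail[OF \<theta>(1)])
    from eventually_happens[OF this] obtain i where
      i1: "\<forall>\<^sub>F N in sequentially. \<forall>s\<in>K. (\<Sum>n=1..N. (norm (x n s - y i n s))\<^sup>2) \<le> \<tau> * real N"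
      and i2: "\<forall>s\<in>K. \<bar>infsum (t s) UNIV - (\<Sum>m\<in>{1..i}. t s m)\<bar> \<le> \<theta>" by auto
    show "\<forall>\<^sub>F N in sequentially. \<forall>s\<in>K. dist ((\<Sum>n=1..N. (norm (x n s))\<^sup>2) / real N)
        (\<Sum>\<^sub>\<infinity>m. (norm (b m))\<^sup>2 / real m powr (2 * Re s)) < e"
      using i1 y_square[OF \<theta>(1), of i] eventually_gt_at_top[of 0]
    proof eventually_elim
      case (elim N)
      show ?case
      proof
        fix s assume s: "s \<in> K"
        define A where "A = (\<Sum>n=1..N. (norm (x n s))\<^sup>2)"
        define Y where "Y = (\<Sum>n=1..N. (norm (y i n s))\<^sup>2)"
        define Si where "Si = (\<Sum>m\<in>{1..i}. t s m)"
        have 1: "\<bar>Y - real N * Si\<bar> \<le> \<theta> * real N" using elim(2) s by (simp add: Y_def Si_def)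
        have "real N * Si \<le> real N * S0" unfolding Si_def using Si_le[OF s] by (intro mult_left_mono) auto
        then have Y_le: "Y \<le> (S0 + \<theta>) * real N" using 1 by (simp add: algebra_simps abs_le_iff)
        have "\<bar>A - Y\<bar> = \<bar>\<Sum>n=1..N. (norm (x n s))\<^sup>2 - (norm (y i n s))\<^sup>2\<bar>"
          by (simp add: A_def Y_def sum_subtractf)
        also have "\<dots> \<le> (\<Sum>n=1..N. \<bar>(norm (x n s))\<^sup>2 - (norm (y i n s))\<^sup>2\<bar>)" by (rule sum_abs)
        also have "\<dots> \<le> (\<Sum>n=1..N. (1 + 1 / \<theta>) * (norm (x n s - y i n s))\<^sup>2 + \<theta> * (norm (y i n s))\<^sup>2)"
          by (intro sum_mono abs_square_diff_le \<theta>(1))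
        also have "\<dots> = (1 + 1 / \<theta>) * (\<Sum>n=1..N. (norm (x n s - y i n s))\<^sup>2) + \<theta> * Y"
          by (simp add: sum.distrib sum_distrib_left Y_def)
        also have "\<dots> \<le> (1 + 1 / \<theta>) * (\<tau> * real N) + \<theta> * ((S0 + \<theta>) * real N)"
          using elim(1) s \<theta>(1) th1 Y_le by (intro add_mono mult_left_mono) auto
        also have "\<dots> = \<theta> * real N + \<theta> * (S0 + \<theta>) * real N" by (simp add: \<tau>(2) mult.assoc[symmetric])
        finally have 2: "\<bar>A - Y\<bar> \<le> \<theta> * real N + \<theta> * (S0 + \<theta>) * real N" .
        have 3: "\<bar>real N * infsum (t s) UNIV - real N * Si\<bar> \<le> \<theta> * real N"
        proof -
          have "\<bar>real N * infsum (t s) UNIV - real N * Si\<bar> = real N * \<bar>infsum (t s) UNIV - Si\<bar>"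
            by (simp add: abs_mult right_diff_distrib[symmetric])
          also have "\<dots> \<le> real N * \<theta>" using i2 s by (intro mult_left_mono) (auto simp: Si_def)
          finally show ?thesis by (simp add: mult.commute)
        qed
        have "\<bar>A - real N * infsum (t s) UNIV\<bar> \<le> (\<theta> + \<theta> * (S0 + \<theta>) + 2 * \<theta>) * real N"
          using 1 2 3 by (simp add: algebra_simps)
        also have "\<theta> + \<theta> * (S0 + \<theta>) + 2 * \<theta> \<le> e / 2"
        proof -
          have "\<theta> * (S0 + \<theta>) \<le> \<theta> * (S0 + 1)" using \<theta> by (intro mult_left_mono) auto
          then show ?thesis using \<theta>(3) by (simp add: algebra_simps)
        qed
        finally have "\<bar>A - real N * infsum (t s) UNIV\<bar> \<le> e / 2 * real N" by (simp add: mult_right_mono)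
        then have "\<bar>A - real N * infsum (t s) UNIV\<bar> / real N \<le> e / 2" using elim(3) by (simp add: divide_le_eq)
        moreover have "\<bar>A - real N * infsum (t s) UNIV\<bar> / real N = \<bar>A / real N - infsum (t s) UNIV\<bar>"
        proof -
          have "(A - real N * infsum (t s) UNIV) / real N = A / real N - infsum (t s) UNIV"
            using elim(3) by (simp add: diff_divide_distrib)
          then show ?thesis by (metis abs_divide abs_of_nat)
        qed
        ultimately have "\<bar>A / real N - infsum (t s) UNIV\<bar> < e" using e by simp
        then show "dist ((\<Sum>n=1..N. (norm (x n s))\<^sup>2) / real N)
          (\<Sum>\<^sub>\<infinity>m. (norm (b m))\<^sup>2 / real m powr (2 * Re s)) < e"
          by (simp add: dist_real_def A_def t_def[abs_def])
      qed
    qed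
  qed
  show "uniform_limit K (\<lambda>N s. (\<Sum>n=1..N. x n s) / of_nat N) (\<lambda>s. b 1) sequentially"
  proof (rule uniform_limitI)
    fix e :: real assume e: "e > 0"
    define \<theta> where "\<theta> = e / 6"
    have \<theta>: "\<theta> > 0" using e by (simp add: \<theta>_def)
    have "\<forall>\<^sub>F i in sequentially. (\<forall>\<^sub>F N in sequentially. \<forall>s\<in>K. (\<Sum>n=1..N. (norm (x n s - y i n s))\<^sup>2) \<le> (\<theta> * \<theta>) * real N)
        \<and> i \<ge> 1"
      unfolding y_def by (intro eventually_conj close mult_pos_pos \<theta> eventually_ge_at_top)
    from eventually_happens[OF this] obtain i where i: "i \<ge> 1"
      "\<forall>\<^sub>F N in sequentially. \<forall>s\<in>K. (\<Sum>n=1..N. (norm (x n s - y i n s))\<^sup>2) \<le> (\<theta> * \<theta>) * real N" by auto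
    show "\<forall>\<^sub>F N in sequentially. \<forall>s\<in>K. dist ((\<Sum>n=1..N. x n s) / of_nat N) (b 1) < e"
      using i(2) y_mean[OF \<theta> i(1)] eventually_gt_at_top[of 0]
    proof eventually_elim
      case (elim N)
      show ?case
      proof
        fix s assume s: "s \<in> K"
        define A where "A = (\<Sum>n=1..N. x n s)"
        define Y where "Y = (\<Sum>n=1..N. y i n s)"
        have 1: "norm (Y - of_nat N * b 1) \<le> \<theta> * real N" using elim(2) s by (simp add: Y_def)
        have "norm (A - Y) \<le> (\<Sum>n=1..N. norm (x n s - y i n s))"
          unfolding A_def Y_def sum_subtractf[symmetric] by (rule norm_sum)
        also have "\<dots> \<le> (\<Sum>n=1..N. \<theta> + (norm (x n s - y i n s))\<^sup>2 / \<theta>)"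
          by (intro sum_mono le_const_plus_square \<theta>)
        also have "\<dots> = \<theta> * real N + (\<Sum>n=1..N. (norm (x n s - y i n s))\<^sup>2) / \<theta>"
          by (simp add: sum.distrib sum_divide_distrib)
        also have "\<dots> \<le> \<theta> * real N + (\<theta> * \<theta> * real N) / \<theta>"
          using elim(1) s \<theta> by (intro add_mono divide_right_mono) auto
        finally have 2: "norm (A - Y) \<le> 2 * \<theta> * real N" using \<theta> by simp
        have "norm (A - of_nat N * b 1) \<le> norm (A - Y) + norm (Y - of_nat N * b 1)"
          using norm_triangle_ineq[of "A - Y" "Y - of_nat N * b 1"] by simp
        then have 3: "norm (A - of_nat N * b 1) \<le> e / 2 * real N" using 1 2 by (simp add: \<theta>_def)
        have "A / of_nat N - b 1 = (A - of_nat N * b 1) / of_nat N"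
          using elim(3) by (simp add: diff_divide_distrib)
        then have "norm (A / of_nat N - b 1) = norm (A - of_nat N * b 1) / real N" by (simp add: norm_divide)
        also have "\<dots> \<le> e / 2" using 3 elim(3) by (simp add: divide_le_eq)
        finally show "dist ((\<Sum>n=1..N. x n s) / of_nat N) (b 1) < e"
          using e by (simp add: dist_norm A_def)
      qed
    qed
  qed
qed

text \<open>
  The exceptional \<open>n \<le> N\<close> contribute \<open>0\<close> to the sums but are counted in the denominator \<open>N\<close>.
\<close>
definition block_moments ::
    "(complex \<Rightarrow> complex) \<Rightarrow> real \<Rightarrow> real \<Rightarrow> nat set \<Rightarrow> nat \<Rightarrow> (complex \<Rightarrow> real) \<Rightarrow> (complex \<Rightarrow> complex) \<Rightarrow> bool"
  where "block_moments L \<alpha> l Z k M2 M1 \<longleftrightarrow>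
     uniform_limit (block \<alpha> l)
       (\<lambda>N s. (\<Sum>n=1..N. (norm (if n \<in> Z then 0 else continuation L (vshift l n s) ^ k))\<^sup>2) / real N)
       M2 sequentially \<and>
     uniform_limit (block \<alpha> l)
       (\<lambda>N s. (\<Sum>n=1..N. if n \<in> Z then 0 else continuation L (vshift l n s) ^ k) / of_nat N)
       M1 sequentially"

text \<open>
  One exceptional set serves all \<open>k\<close>, because the diagonal choice treats the exponents up to \<open>j\<close> in the
  \<open>j\<close>-th interval.
\<close>
theorem moments_along_density_one_set:
  assumes l: "l > 0" and \<alpha>: "1 / 2 < \<beta>" "\<beta> < \<alpha>" "\<alpha> \<le> 1"
    and ram: "ramanujan_bounded a" and L: "\<And>s. Re s > 1 \<Longrightarrow> L s = dirichlet_sum a s"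
    and lb: "locally_bounded_shifts L \<beta> l"
    and S: "frequency_independent l S" "1 \<in> S" and supp: "\<And>k m. m \<notin> S \<Longrightarrow> dirichlet_pow a k m = 0"
  shows "\<exists>Z \<subseteq> {1..}. has_density Z 0 \<and> (\<forall>n\<ge>1. n \<notin> Z \<longrightarrow> continuable_block L \<alpha> l n) \<and>
    (\<forall>k. block_moments L \<alpha> l Z k
        (\<lambda>s. \<Sum>\<^sub>\<infinity>m. (norm (dirichlet_pow a k m))\<^sup>2 / real m powr (2 * Re s)) (\<lambda>s. dirichlet_pow a k 1))"
proof -
  define K where "K = block \<alpha> l"
  define b where "b k = dirichlet_pow a k" for k
  define D where "D k i n s = dirichlet_poly (b k) {1..i} (vshift l n s)" for k i n s
  define f where "f k n s = continuation L (vshift l n s) ^ k" for k n s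
  define c where "c n = continuable_block L \<alpha> l n" for n
  define t where "t k m = (norm (b k m))\<^sup>2 / real m powr (2 * \<alpha>)" for k m
  define T where "T k i = infsum (t k) UNIV - sum (t k) {..i} + inverse (real (Suc i))" for k i
  have K: "Re s \<ge> \<alpha>" if "s \<in> K" for s using that by (simp add: K_def in_cbox_complex_iff)
  have ts: "t k summable_on UNIV" for k
    unfolding t_def[abs_def] b_def
    by (rule ramanujan_bounded_square_summable[OF ramanujan_bounded_pow[OF ram]]) (use \<alpha> in simp)
  have fb: "\<exists>B. \<forall>s\<in>K. norm (f k n s) \<le> B" if n: "c n" for n k
  proof -
    have "bounded ((\<lambda>s. continuation L (vshift l n s)) ` K)"
      using n by (simp add: c_def continuable_block_def K_def)
    then obtain B where B: "\<forall>x\<in>(\<lambda>s. continuation L (vshift l n s)) ` K. norm x \<le> B"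
      unfolding bounded_iff ..
    have "norm (f k n s) \<le> B ^ k" if "s \<in> K" for s
      unfolding f_def norm_power using B that by (intro power_mono) auto
    then show ?thesis by blast
  qed
  have Db: "\<exists>B. \<forall>n. \<forall>s\<in>K. norm (D k i n s) \<le> B" for k i
  proof (intro exI allI ballI)
    fix n s assume "s \<in> K"
    then show "norm (D k i n s) \<le> (\<Sum>m\<in>{1..i}. norm (b k m))"
      unfolding D_def using K[of s] \<alpha> by (intro norm_dirichlet_poly_le) simp
  qed
  have T0: "T k \<longlonglongrightarrow> 0" for k
  proof -
    have "t k sums infsum (t k) UNIV" using ts by (intro has_sum_imp_sums has_sum_infsum)
    then have "(\<lambda>i. sum (t k) {..i}) \<longlonglongrightarrow> infsum (t k) UNIV" by (simp add: sums_def_le)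
    then have "(\<lambda>i. infsum (t k) UNIV - sum (t k) {..i} + inverse (real (Suc i)))
        \<longlonglongrightarrow> infsum (t k) UNIV - infsum (t k) UNIV + 0"
      by (intro tendsto_intros LIMSEQ_inverse_real_of_nat)
    then show ?thesis by (simp add: T_def[abs_def])
  qed
  have ms: "\<forall>\<^sub>F N in sequentially. \<forall>s\<in>K. (\<Sum>n=1..N. (norm (D k j n s - D k i n s))\<^sup>2) \<le> T k i * real N"
    if ij: "i \<le> j" for k i j
  proof -
    have diff: "D k j n s - D k i n s = dirichlet_poly (b k) {i<..j} (vshift l n s)" for n s
    proof -
      have "{1..j} = {1..i} \<union> {i<..j}" using ij by auto
      then have "dirichlet_poly (b k) {1..j} z = dirichlet_poly (b k) {1..i} z + dirichlet_poly (b k) {i<..j} z" for z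
        unfolding dirichlet_poly_def by (simp only:) (rule sum.union_disjoint, auto)
      then show ?thesis by (simp add: D_def)
    qed
    have "\<forall>\<^sub>F N in sequentially. \<forall>s. Re s \<ge> 0 \<longrightarrow>
     \<bar>(\<Sum>n=1..N. (norm (dirichlet_poly (b k) {i<..j} (vshift l n s)))\<^sup>2)
        - real N * (\<Sum>m\<in>{i<..j}. (norm (b k m))\<^sup>2 / real m powr (2 * Re s))\<bar> \<le> inverse (real (Suc i)) * real N"
      by (rule dirichlet_poly_mean_square[OF S(1)]) (use supp in \<open>auto simp: b_def\<close>)
    then show ?thesis
    proof eventually_elim
      case (elim N)
      show ?case
      proof
        fix s assume s: "s \<in> K"
        have "(\<Sum>m\<in>{i<..j}. (norm (b k m))\<^sup>2 / real m powr (2 * Re s)) + sum (t k) {..i}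
          \<le> sum (t k) {i<..j} + sum (t k) {..i}"
        proof (intro add_mono sum_mono order_refl)
          fix m assume m: "m \<in> {i<..j}"
          then have "real m powr (2 * \<alpha>) \<le> real m powr (2 * Re s)" using K[OF s] by (intro powr_mono) auto
          then show "(norm (b k m))\<^sup>2 / real m powr (2 * Re s) \<le> t k m"
            using m unfolding t_def by (intro divide_left_mono mult_pos_pos) auto
        qed
        also have "\<dots> = sum (t k) ({i<..j} \<union> {..i})" by (rule sum.union_disjoint[symmetric]) auto
        also have "\<dots> \<le> infsum (t k) UNIV"
          by (rule finite_sum_le_infsum[OF ts]) (auto simp: t_def)
        finally have "(\<Sum>m\<in>{i<..j}. (norm (b k m))\<^sup>2 / real m powr (2 * Re s)) \<le> infsum (t k) UNIV - sum (t k) {..i}"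
          by simp
        then have "real N * (\<Sum>m\<in>{i<..j}. (norm (b k m))\<^sup>2 / real m powr (2 * Re s))
          \<le> real N * (infsum (t k) UNIV - sum (t k) {..i})" by (intro mult_left_mono) auto
        moreover have "Re s \<ge> 0" using K[OF s] \<alpha> by simp
        note elim[rule_format, OF this]
        ultimately show "(\<Sum>n=1..N. (norm (D k j n s - D k i n s))\<^sup>2) \<le> T k i * real N"
          unfolding diff T_def by (simp add: algebra_simps abs_le_iff)
      qed
    qed
  qed
  have ap: "\<forall>\<^sub>F i in sequentially. \<forall>\<^sub>F N in sequentially.
       real (card {n\<in>{1..N}. \<not> (c n \<and> (\<forall>s\<in>K. norm (f k n s - D k i n s) \<le> \<delta>))}) \<le> \<epsilon> * real N"
    if "\<delta> > 0" "\<epsilon> > 0" for k \<delta> \<epsilon>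
    unfolding c_def K_def f_def D_def b_def
    by (rule power_mostly_near_dirichlet_poly[OF l \<alpha> ram L lb S(1) supp that])
  have "\<exists>Z \<subseteq> {1..}. has_density Z 0 \<and> (\<forall>n\<ge>1. n \<notin> Z \<longrightarrow> c n) \<and>
    (\<forall>k. \<forall>\<tau>>0. \<forall>\<^sub>F i in sequentially. \<forall>\<^sub>F N in sequentially. \<forall>s\<in>K.
       (\<Sum>n=1..N. (norm ((if n \<in> Z then 0 else f k n s) - D k i n s))\<^sup>2) \<le> \<tau> * real N)"
    by (rule diagonal_approximation[of c K f D T, OF fb Db T0 ms ap])
  then obtain Z where Z: "Z \<subseteq> {1..}" "has_density Z 0" "\<forall>n\<ge>1. n \<notin> Z \<longrightarrow> c n"
    and close: "\<forall>k. \<forall>\<tau>>0. \<forall>\<^sub>F i in sequentially. \<forall>\<^sub>F N in sequentially. \<forall>s\<in>K.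
       (\<Sum>n=1..N. (norm ((if n \<in> Z then 0 else f k n s) - D k i n s))\<^sup>2) \<le> \<tau> * real N"
    by (elim exE conjE) (rule that)
  have "uniform_limit K (\<lambda>N s. (\<Sum>n=1..N. (norm (if n \<in> Z then 0 else f k n s))\<^sup>2) / real N)
      (\<lambda>s. \<Sum>\<^sub>\<infinity>m. (norm (b k m))\<^sup>2 / real m powr (2 * Re s)) sequentially"
    "uniform_limit K (\<lambda>N s. (\<Sum>n=1..N. if n \<in> Z then 0 else f k n s) / of_nat N) (\<lambda>s. b k 1) sequentially" for k
  proof -
    have cl: "\<forall>\<^sub>F i in sequentially. \<forall>\<^sub>F N in sequentially. \<forall>s\<in>K.
       (\<Sum>n=1..N. (norm ((if n \<in> Z then 0 else f k n s) - dirichlet_poly (b k) {1..i} (vshift l n s)))\<^sup>2) \<le> \<tau> * real N"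
      if "\<tau> > 0" for \<tau> using close that by (simp add: D_def)
    have \<alpha>0: "\<alpha> \<ge> 0" using \<alpha> by simp
    have sp: "b k m = 0" if "m \<notin> S" for m using supp[OF that] by (simp add: b_def)
    note * = moments_of_approximable[of \<alpha> K "b k" l S "\<lambda>n s. if n \<in> Z then 0 else f k n s",
        OF \<alpha>0 K ts[of k, unfolded t_def[abs_def]] S sp cl]
    show "uniform_limit K (\<lambda>N s. (\<Sum>n=1..N. (norm (if n \<in> Z then 0 else f k n s))\<^sup>2) / real N)
      (\<lambda>s. \<Sum>\<^sub>\<infinity>m. (norm (b k m))\<^sup>2 / real m powr (2 * Re s)) sequentially"
      "uniform_limit K (\<lambda>N s. (\<Sum>n=1..N. if n \<in> Z then 0 else f k n s) / of_nat N) (\<lambda>s. b k 1) sequentially"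
      by (rule *; assumption)+
  qed
  with Z show ?thesis
    unfolding c_def K_def f_def b_def block_moments_def by (intro exI[of _ Z] conjI allI) auto
qed

section \<open>The Euler factor at a prime\<close>

text \<open>
  The coefficients of the product of a Dirichlet series with \<open>1 - c * q powr (- s)\<close>.
\<close>
definition remove_root :: "nat \<Rightarrow> complex \<Rightarrow> (nat \<Rightarrow> complex) \<Rightarrow> nat \<Rightarrow> complex" where
  "remove_root q c b n = b n - (if q dvd n then c * b (n div q) else 0)"

primrec remove_roots :: "nat \<Rightarrow> (nat \<Rightarrow> complex) \<Rightarrow> nat \<Rightarrow> (nat \<Rightarrow> complex) \<Rightarrow> nat \<Rightarrow> complex" where
  "remove_roots q r 0 b = b"
| "remove_roots q r (Suc j) b = remove_root q (r (Suc j)) (remove_roots q r j b)"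

text \<open>
  A bound for the series of absolute values through its finite partial sums, which makes the
  effect of \<open>remove_root\<close> on the bound a finite computation.
\<close>
definition dirichlet_norm_le :: "(nat \<Rightarrow> complex) \<Rightarrow> real \<Rightarrow> real \<Rightarrow> bool" where
  "dirichlet_norm_le b \<sigma> B \<longleftrightarrow> (\<forall>F. finite F \<longrightarrow> (\<Sum>n\<in>F. norm (b n) / real n powr \<sigma>) \<le> B)"

lemma dirichlet_norm_le_imp_abs_conv:
  assumes "dirichlet_norm_le b \<sigma> B"
  shows "dirichlet_abs_conv b \<sigma>"
  unfolding dirichlet_abs_conv_def
  by (rule nonneg_bdd_above_summable_on)
    (use assms in \<open>auto simp: dirichlet_norm_le_def intro!: bdd_aboveI2[where M = B]\<close>)

lemma dirichlet_abs_conv_imp_norm_le: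
  assumes "dirichlet_abs_conv b \<sigma>"
  shows "dirichlet_norm_le b \<sigma> (\<Sum>\<^sub>\<infinity>n. norm (b n) / real n powr \<sigma>)"
  unfolding dirichlet_norm_le_def
proof (intro allI impI)
  fix F :: "nat set" assume "finite F"
  then show "(\<Sum>n\<in>F. norm (b n) / real n powr \<sigma>) \<le> (\<Sum>\<^sub>\<infinity>n. norm (b n) / real n powr \<sigma>)"
    by (rule finite_sum_le_infsum[OF assms[unfolded dirichlet_abs_conv_def]]) auto
qed

lemma dirichlet_norm_le_nonneg: "dirichlet_norm_le b \<sigma> B \<Longrightarrow> B \<ge> 0"
  unfolding dirichlet_norm_le_def by (metis finite.emptyI sum.empty)

lemma dirichlet_norm_le_remove_root:
  assumes b: "dirichlet_norm_le b \<sigma> B" and q: "q \<ge> 1"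
  shows "dirichlet_norm_le (remove_root q c b) \<sigma> ((1 + norm c / real q powr \<sigma>) * B)"
  unfolding dirichlet_norm_le_def
proof (intro allI impI)
  fix F :: "nat set" assume F: "finite F"
  define F' where "F' = {n\<in>F. q dvd n}"
  have inj: "inj_on (\<lambda>n. n div q) F'" by (rule inj_onI) (auto simp: F'_def dvd_div_eq_iff)
  have "(\<Sum>n\<in>F. norm (remove_root q c b n) / real n powr \<sigma>)
    \<le> (\<Sum>n\<in>F. norm (b n) / real n powr \<sigma> + (if q dvd n then norm c * norm (b (n div q)) / real n powr \<sigma> else 0))"
  proof (rule sum_mono)
    fix n
    have "norm (remove_root q c b n) \<le> norm (b n) + (if q dvd n then norm c * norm (b (n div q)) else 0)"
      using norm_triangle_ineq4[of "b n" "c * b (n div q)"] by (simp add: remove_root_def norm_mult)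
    then have "norm (remove_root q c b n) / real n powr \<sigma>
      \<le> (norm (b n) + (if q dvd n then norm c * norm (b (n div q)) else 0)) / real n powr \<sigma>"
      by (rule divide_right_mono) simp
    then show "norm (remove_root q c b n) / real n powr \<sigma> \<le> norm (b n) / real n powr \<sigma>
      + (if q dvd n then norm c * norm (b (n div q)) / real n powr \<sigma> else 0)"
      by (simp add: add_divide_distrib split: if_splits)
  qed
  also have "\<dots> = (\<Sum>n\<in>F. norm (b n) / real n powr \<sigma>)
      + (\<Sum>n\<in>F'. norm c * norm (b (n div q)) / real n powr \<sigma>)"
    using F by (simp add: sum.distrib F'_def sum.inter_filter)
  also have "(\<Sum>n\<in>F'. norm c * norm (b (n div q)) / real n powr \<sigma>)
      = (\<Sum>n\<in>F'. norm c / real q powr \<sigma> * (norm (b (n div q)) / real (n div q) powr \<sigma>))"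
  proof (rule sum.cong[OF refl])
    fix n assume "n \<in> F'"
    then obtain k where "n = q * k" by (auto simp: F'_def)
    then show "norm c * norm (b (n div q)) / real n powr \<sigma>
      = norm c / real q powr \<sigma> * (norm (b (n div q)) / real (n div q) powr \<sigma>)"
      using q by (simp add: powr_mult)
  qed
  also have "\<dots> = norm c / real q powr \<sigma> * (\<Sum>k\<in>(\<lambda>n. n div q) ` F'. norm (b k) / real k powr \<sigma>)"
    by (simp add: sum.reindex[OF inj] sum_distrib_left)
  also have "(\<Sum>n\<in>F. norm (b n) / real n powr \<sigma>)
      + norm c / real q powr \<sigma> * (\<Sum>k\<in>(\<lambda>n. n div q) ` F'. norm (b k) / real k powr \<sigma>)
     \<le> B + norm c / real q powr \<sigma> * B"
    using b F unfolding dirichlet_norm_le_def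
    by (intro add_mono mult_left_mono) (auto simp: F'_def)
  finally show "(\<Sum>n\<in>F. norm (remove_root q c b n) / real n powr \<sigma>) \<le> (1 + norm c / real q powr \<sigma>) * B"
    by (simp add: algebra_simps)
qed

lemma dirichlet_sum_remove_root:
  assumes b: "dirichlet_abs_conv b (Re s)" and q: "q \<ge> 1"
  shows "dirichlet_sum (remove_root q c b) s = (1 - c / of_nat q powr s) * dirichlet_sum b s"
proof -
  define h where "h n = (if q dvd n then - c * b (n div q) else 0) / of_nat n powr s" for n
  have "inj ((*) q)" using q by (auto intro: injI)
  have hq: "(h \<circ> (*) q) = (\<lambda>k. (- c / of_nat q powr s) * (b k / of_nat k powr s))"
    using q by (auto simp: h_def fun_eq_iff powr_times_real)
  have "((\<lambda>k. (- c / of_nat q powr s) * (b k / of_nat k powr s)) has_sum (- c / of_nat q powr s) * dirichlet_sum b s) UNIV"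
    by (rule has_sum_cmult_right[OF dirichlet_has_sum[OF b]])
  then have "(h has_sum (- c / of_nat q powr s) * dirichlet_sum b s) (range ((*) q))"
    unfolding hq[symmetric] has_sum_reindex[OF \<open>inj ((*) q)\<close>] .
  also have "?this \<longleftrightarrow> (h has_sum (- c / of_nat q powr s) * dirichlet_sum b s) UNIV"
    by (rule has_sum_cong_neutral) (auto simp: h_def elim!: dvdE)
  finally have "((\<lambda>n. b n / of_nat n powr s + h n) has_sum
      dirichlet_sum b s + (- c / of_nat q powr s) * dirichlet_sum b s) UNIV"
    by (intro has_sum_add dirichlet_has_sum[OF b])
  moreover have "b n / of_nat n powr s + h n = remove_root q c b n / of_nat n powr s" for n
    by (cases "q dvd n") (simp_all add: h_def remove_root_def diff_divide_distrib)
  ultimately have "((\<lambda>n. remove_root q c b n / of_nat n powr s) has_sum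
      dirichlet_sum b s + (- c / of_nat q powr s) * dirichlet_sum b s) UNIV" by simp
  then show ?thesis unfolding dirichlet_sum_def[of "remove_root q c b"] by (simp add: infsumI algebra_simps)
qed

lemma remove_root_abs_conv:
  assumes "dirichlet_abs_conv b \<sigma>" "q \<ge> 1"
  shows "dirichlet_abs_conv (remove_root q c b) \<sigma>"
  using dirichlet_norm_le_remove_root[OF dirichlet_abs_conv_imp_norm_le[OF assms(1)] assms(2)]
  by (rule dirichlet_norm_le_imp_abs_conv)

lemma remove_roots_abs_conv:
  assumes "dirichlet_abs_conv b \<sigma>" "q \<ge> 1"
  shows "dirichlet_abs_conv (remove_roots q r m b) \<sigma>"
proof (induction m)
  case 0
  then show ?case using assms(1) by simp
next
  case (Suc m)
  show ?case unfolding remove_roots.simps by (rule remove_root_abs_conv[OF Suc assms(2)])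
qed

lemma dirichlet_sum_remove_roots:
  assumes "dirichlet_abs_conv b (Re s)" "q \<ge> 1"
  shows "dirichlet_sum (remove_roots q r m b) s = (\<Prod>j=1..m. 1 - r j / of_nat q powr s) * dirichlet_sum b s"
proof (induction m)
  case (Suc m)
  then show ?case
    using dirichlet_sum_remove_root[OF remove_roots_abs_conv[OF assms, of r m] assms(2), of "r (Suc m)"]
    by (simp add: mult_ac)
qed simp

lemma dirichlet_norm_le_mono: "dirichlet_norm_le b \<sigma> B \<Longrightarrow> B \<le> B' \<Longrightarrow> dirichlet_norm_le b \<sigma> B'"
  unfolding dirichlet_norm_le_def using order_trans by blast

lemma dirichlet_norm_le_remove_roots:
  assumes b: "dirichlet_norm_le b \<sigma> B" and q: "q \<ge> 1" and r: "\<And>j. j \<in> {1..m} \<Longrightarrow> norm (r j) \<le> real q"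
  shows "dirichlet_norm_le (remove_roots q r m b) \<sigma> (exp (real m * (real q / real q powr \<sigma>)) * B)"
  using r
proof (induction m)
  case 0
  then show ?case using b by simp
next
  case (Suc m)
  define x where "x = real q / real q powr \<sigma>"
  define E where "E = exp (real m * x) * B"
  have IH: "dirichlet_norm_le (remove_roots q r m b) \<sigma> E" using Suc unfolding E_def x_def by simp
  have "norm (r (Suc m)) / real q powr \<sigma> \<le> x" unfolding x_def using Suc.prems by (intro divide_right_mono) auto
  then have "1 + norm (r (Suc m)) / real q powr \<sigma> \<le> exp x" using exp_ge_add_one_self[of x] by linarith
  then have "(1 + norm (r (Suc m)) / real q powr \<sigma>) * E \<le> exp x * E"
    using dirichlet_norm_le_nonneg[OF IH] by (rule mult_right_mono)
  also have "\<dots> = exp (real (Suc m) * x) * B"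
    by (simp add: E_def exp_add[symmetric] algebra_simps)
  finally show ?case
    using dirichlet_norm_le_mono[OF dirichlet_norm_le_remove_root[OF IH q]] unfolding x_def by simp
qed

lemma remove_root_coprime: "\<not> q dvd n \<Longrightarrow> remove_root q c b n = b n"
  by (simp add: remove_root_def)

lemma remove_roots_coprime: "\<not> q dvd n \<Longrightarrow> remove_roots q r m b n = b n"
  by (induction m) (simp_all add: remove_root_coprime)

lemma remove_roots_0: "b 0 = 0 \<Longrightarrow> remove_roots q r m b 0 = 0"
  by (induction m) (simp_all add: remove_root_def)

lemma ramanujan_bounded_remove_root:
  assumes b: "ramanujan_bounded b" and q: "q \<ge> 1"
  shows "ramanujan_bounded (remove_root q c b)"
  unfolding ramanujan_bounded_def
proof (intro conjI allI impI)
  show "remove_root q c b 0 = 0" using b by (simp add: remove_root_def ramanujan_bounded_def)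
  fix \<epsilon> :: real assume e: "\<epsilon> > 0"
  then obtain C where C: "\<forall>n\<ge>1. norm (b n) \<le> C * real n powr \<epsilon>"
    using b unfolding ramanujan_bounded_def by blast
  have "norm (b 1) \<le> C" using C[rule_format, of 1] by simp
  then have C0: "C \<ge> 0" using norm_ge_zero order_trans by blast
  have "norm (remove_root q c b n) \<le> ((1 + norm c) * C) * real n powr \<epsilon>" if n: "n \<ge> 1" for n
  proof -
    have 1: "norm (b n) \<le> C * real n powr \<epsilon>" using C n by blast
    have 2: "norm (if q dvd n then c * b (n div q) else 0) \<le> norm c * (C * real n powr \<epsilon>)"
    proof (cases "q dvd n")
      case True
      then obtain k where k: "n = q * k" by auto
      then have "k \<ge> 1" "k \<le> n" using n q by (auto intro: Nat.gr0I simp: Suc_le_eq)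
      then have "norm (b k) \<le> C * real k powr \<epsilon>" using C by blast
      also have "\<dots> \<le> C * real n powr \<epsilon>"
        using \<open>k \<le> n\<close> e C0 by (intro mult_left_mono powr_mono2) auto
      finally have "norm c * norm (b k) \<le> norm c * (C * real n powr \<epsilon>)" by (rule mult_left_mono) simp
      then show ?thesis using k q by (simp add: norm_mult)
    qed (use C0 in simp)
    have "norm (remove_root q c b n) \<le> norm (b n) + norm (if q dvd n then c * b (n div q) else 0)"
      unfolding remove_root_def by (rule norm_triangle_ineq4)
    then show ?thesis using 1 2 by (simp add: algebra_simps)
  qed
  then show "\<exists>C. \<forall>n\<ge>1. norm (remove_root q c b n) \<le> C * real n powr \<epsilon>" by blast
qed

lemma ramanujan_bounded_remove_roots:
  "ramanujan_bounded b \<Longrightarrow> q \<ge> 1 \<Longrightarrow> ramanujan_bounded (remove_roots q r m b)"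
  by (induction m) (simp_all add: ramanujan_bounded_remove_root)

text \<open>
  Otherwise \<open>q powr s = \<rho> j q\<close> for some \<open>s\<close> with \<open>Re s > 1\<close>, where the Euler factor has no pole.
\<close>
lemma local_root_norm_le:
  assumes E: "polynomial_euler_product L m \<rho>" and q: "prime q" and j: "j \<in> {1..m}"
  shows "norm (\<rho> j q) \<le> real q"
proof (rule ccontr)
  assume "\<not> norm (\<rho> j q) \<le> real q"
  then have big: "norm (\<rho> j q) > real q" by simp
  have q1: "real q > 1" using prime_gt_1_nat[OF q] by simp
  then have nz: "\<rho> j q \<noteq> 0" using big by auto
  define s where "s = Ln (\<rho> j q) / of_real (ln (real q))"
  have lnq: "ln (real q) > 0" using q1 by simp
  have "Re s = ln (norm (\<rho> j q)) / ln (real q)" using nz by (simp add: s_def)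
  moreover have "ln (norm (\<rho> j q)) > ln (real q)" using big q1 by (subst ln_less_cancel_iff) auto
  ultimately have "Re s > 1" using lnq by simp
  have "of_nat q powr s = exp (s * of_real (ln (real q)))" using q1 by (simp add: powr_def Ln_of_nat)
  also have "\<dots> = \<rho> j q" using lnq nz by (simp add: s_def)
  finally have "1 - \<rho> j q / of_nat q powr s = 0" using nz by simp
  then show False using E \<open>Re s > 1\<close> q j unfolding polynomial_euler_product_def by blast
qed

text \<open>
  The series multiplied by the inverses of the Euler factors at the primes up to \<open>x\<close> other than \<open>p\<close>.
\<close>
primrec strip_primes :: "nat \<Rightarrow> nat \<Rightarrow> (nat \<Rightarrow> nat \<Rightarrow> complex) \<Rightarrow> (nat \<Rightarrow> complex) \<Rightarrow> nat \<Rightarrow> nat \<Rightarrow> complex" where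
  "strip_primes p m \<rho> b 0 = b"
| "strip_primes p m \<rho> b (Suc x) = (if prime (Suc x) \<and> Suc x \<noteq> p
     then remove_roots (Suc x) (\<lambda>j. \<rho> j (Suc x)) m (strip_primes p m \<rho> b x) else strip_primes p m \<rho> b x)"

lemma strip_primes_0: "b 0 = 0 \<Longrightarrow> strip_primes p m \<rho> b x 0 = 0"
  by (induction x) (simp_all add: remove_roots_0)

lemma strip_primes_stable:
  assumes "k \<ge> 1" "x \<ge> k"
  shows "strip_primes p m \<rho> b x k = strip_primes p m \<rho> b k k"
  using assms(2)
proof (induction x rule: dec_induct)
  case (step x)
  have "\<not> Suc x dvd k" using step assms(1) by (auto dest: dvd_imp_le)
  then show ?case using step by (simp add: remove_roots_coprime)
qed simp

text \<open>
  A priori the local roots at \<open>q\<close> are only known to be at most \<open>q\<close>, so the bound is uniform in \<open>x\<close> at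
  \<open>\<sigma> = 3\<close>, where \<open>\<Sum> q powr (1 - \<sigma>)\<close> converges.
\<close>
lemma strip_primes_norm_le:
  assumes b: "dirichlet_norm_le b 3 B" and r: "\<And>q j. prime q \<Longrightarrow> j \<in> {1..m} \<Longrightarrow> norm (\<rho> j q) \<le> real q"
  shows "dirichlet_norm_le (strip_primes p m \<rho> b x) 3 (exp (real m * (\<Sum>q\<in>{1..x}. real q powr (-2))) * B)"
proof (induction x)
  case 0
  then show ?case using b by simp
next
  case (Suc x)
  define W where "W = (\<Sum>q\<in>{1..x}. real q powr (-2))"
  have IH: "dirichlet_norm_le (strip_primes p m \<rho> b x) 3 (exp (real m * W) * B)" using Suc by (simp add: W_def)
  have B: "B \<ge> 0" by (rule dirichlet_norm_le_nonneg[OF b])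
  have W: "(\<Sum>q\<in>{1..Suc x}. real q powr (-2)) = W + real (Suc x) powr (-2)" by (simp add: W_def)
  show ?case
  proof (cases "prime (Suc x) \<and> Suc x \<noteq> p")
    case True
    have x: "real (Suc x) / real (Suc x) powr 3 = real (Suc x) powr (-2)"
      using powr_diff[of "real (Suc x)" 1 3] by simp
    have r': "norm (\<rho> j (Suc x)) \<le> real (Suc x)" if "j \<in> {1..m}" for j using r[OF _ that] True by blast
    have "dirichlet_norm_le (remove_roots (Suc x) (\<lambda>j. \<rho> j (Suc x)) m (strip_primes p m \<rho> b x)) 3
      (exp (real m * (real (Suc x) / real (Suc x) powr 3)) * (exp (real m * W) * B))"
      by (rule dirichlet_norm_le_remove_roots[OF IH _ r']) simp
    then have "dirichlet_norm_le (strip_primes p m \<rho> b (Suc x)) 3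
      (exp (real m * real (Suc x) powr (-2)) * (exp (real m * W) * B))"
      unfolding x using True by simp
    then show ?thesis unfolding W by (simp add: distrib_left exp_add mult_ac)
  next
    case False
    have "exp (real m * W) * B \<le> exp (real m * (W + real (Suc x) powr (-2))) * B"
      using B by (intro mult_right_mono) (auto intro!: mult_left_mono)
    then show ?thesis unfolding W using dirichlet_norm_le_mono[OF IH] False by auto
  qed
qed

lemma strip_primes_sum:
  assumes b: "dirichlet_norm_le b 3 B" and r: "\<And>q j. prime q \<Longrightarrow> j \<in> {1..m} \<Longrightarrow> norm (\<rho> j q) \<le> real q"
    and s: "Re s \<ge> 3"
  shows "dirichlet_sum (strip_primes p m \<rho> b x) s
    = (\<Prod>i\<le>x. if prime i \<and> i \<noteq> p then \<Prod>j=1..m. 1 - \<rho> j i / of_nat i powr s else 1) * dirichlet_sum b s"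
proof (induction x)
  case (Suc x)
  have ac: "dirichlet_abs_conv (strip_primes p m \<rho> b x) (Re s)"
    by (rule dirichlet_abs_conv_mono[OF dirichlet_norm_le_imp_abs_conv[OF strip_primes_norm_le[OF b r]] s])
  show ?case
    using Suc dirichlet_sum_remove_roots[OF ac, of "Suc x" "\<lambda>j. \<rho> j (Suc x)" m] by (simp add: mult_ac)
qed simp

text \<open>
  After removal of all Euler factors the coefficients of \<open>1\<close> should remain. The convergence of the
  product is only pointwise, so the limit is taken inside the series by Tannery's theorem, with a
  majorant from the uniform bound at \<open>\<sigma> = 3\<close>; the \<open>n\<close>-th coefficient is constant from stage \<open>n\<close> on.
\<close>
lemma stripped_coefficients:
  assumes E: "polynomial_euler_product L m \<rho>" and ram: "ramanujan_bounded a"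
    and L: "\<And>s. Re s > 1 \<Longrightarrow> L s = dirichlet_sum a s" and p: "prime p" and n: "n \<ge> 1"
  shows "strip_primes p m \<rho> (remove_roots p (\<lambda>j. \<rho> j p) m a) n n = (if n = 1 then 1 else 0)"
proof -
  define g where "g = remove_roots p (\<lambda>j. \<rho> j p) m a"
  define st where "st = strip_primes p m \<rho> g"
  have p1: "p \<ge> 1" using prime_gt_0_nat[OF p] by simp
  have r: "norm (\<rho> j q) \<le> real q" if "prime q" "j \<in> {1..m}" for q j by (rule local_root_norm_le[OF E that])
  have rg: "ramanujan_bounded g" unfolding g_def by (rule ramanujan_bounded_remove_roots[OF ram p1])
  define B where "B = (\<Sum>\<^sub>\<infinity>n. norm (g n) / real n powr 3)"
  have gB: "dirichlet_norm_le g 3 B" unfolding B_def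
    by (rule dirichlet_abs_conv_imp_norm_le[OF ramanujan_bounded_abs_conv[OF rg]]) simp
  have B: "B \<ge> 0" by (rule dirichlet_norm_le_nonneg[OF gB])
  define W where "W = (\<Sum>q. real q powr (-2))"
  have sumW: "summable (\<lambda>q. real q powr (-2))" using summable_real_powr_iff[of "-2"] by simp
  define B' where "B' = exp (real m * W) * B"
  have stB: "dirichlet_norm_le (st x) 3 B'" for x
  proof (rule dirichlet_norm_le_mono)
    show "dirichlet_norm_le (st x) 3 (exp (real m * (\<Sum>q\<in>{1..x}. real q powr (-2))) * B)"
      unfolding st_def by (rule strip_primes_norm_le[OF gB r])
    have "(\<Sum>q\<in>{1..x}. real q powr (-2)) \<le> W" unfolding W_def by (rule sum_le_suminf[OF sumW]) auto
    then show "exp (real m * (\<Sum>q\<in>{1..x}. real q powr (-2))) * B \<le> B'"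
      unfolding B'_def using B by (intro mult_right_mono) (auto intro: mult_left_mono)
  qed
  have g0: "g 0 = 0" using rg by (simp add: ramanujan_bounded_def)
  have st0: "st x 0 = 0" for x unfolding st_def using g0 by (rule strip_primes_0)
  define w where "w k = st k k" for k
  have coeff: "norm (st x k) \<le> B' * real k powr 3" for x k
  proof (cases "k = 0")
    case False
    have "(\<Sum>n\<in>{k}. norm (st x n) / real n powr 3) \<le> B'" using stB[of x] unfolding dirichlet_norm_le_def by blast
    then show ?thesis using False by (simp add: divide_le_eq)
  qed (simp add: st0)
  have "(\<lambda>k. w k / of_nat k powr of_real \<sigma>) sums 1" if \<sigma>: "\<sigma> > 5" for \<sigma> :: real
  proof -
    define s where "s = complex_of_real \<sigma>"
    have s: "Re s = \<sigma>" "Re s > 1" "Re s \<ge> 3" using \<sigma> by (auto simp: s_def)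
    define e where "e i = (if prime i then \<Prod>j=1..m. 1 - \<rho> j i / of_nat i powr s else 1)" for i
    have e_nz: "e i \<noteq> 0" for i using E s(2) unfolding polynomial_euler_product_def e_def by auto
    have "(\<lambda>i. inverse (e i)) has_prod L s"
    proof -
      have "(\<lambda>i. inverse (e i)) = (\<lambda>i. if prime i then \<Prod>j=1..m. inverse (1 - \<rho> j i / of_nat i powr s) else 1)"
        by (auto simp: e_def fun_eq_iff prod_inversef[symmetric] o_def)
      then show ?thesis using E s(2) unfolding polynomial_euler_product_def by simp
    qed
    note hp = this
    have "0 \<notin> range (\<lambda>i. inverse (e i))" using e_nz by auto
    then have Lnz: "L s \<noteq> 0" using has_prod_eq_0_iff[OF hp] by blast
    have "(\<lambda>x. inverse (\<Prod>i\<le>x. inverse (e i)) * L s) \<longlonglongrightarrow> inverse (L s) * L s"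
      by (intro tendsto_intros has_prod_imp_tendsto[OF hp] Lnz)
    then have lim: "(\<lambda>x. (\<Prod>i\<le>x. e i) * L s) \<longlonglongrightarrow> 1" using Lnz by (simp add: prod_inversef[symmetric] o_def)
    have sum_st: "dirichlet_sum (st x) s = (\<Prod>i\<le>x. e i) * L s" if x: "x \<ge> p" for x
    proof -
      have "dirichlet_sum g s = e p * L s"
        unfolding g_def using dirichlet_sum_remove_roots[OF ramanujan_bounded_abs_conv[OF ram s(2)] p1] p s(2)
        by (simp add: e_def L)
      moreover have "(\<Prod>i\<le>x. e i) = e p * (\<Prod>i\<in>{..x} - {p}. e i)" using x by (intro prod.remove) auto
      moreover have "(\<Prod>i\<le>x. if prime i \<and> i \<noteq> p then \<Prod>j=1..m. 1 - \<rho> j i / of_nat i powr s else 1)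
         = (\<Prod>i\<in>{..x} - {p}. e i)"
        by (rule prod.mono_neutral_cong_right) (auto simp: e_def)
      ultimately show ?thesis
        unfolding st_def using strip_primes_sum[OF gB r s(3), where p = p and x = x] by (simp add: mult_ac)
    qed
    have abs_st: "dirichlet_abs_conv (st x) (Re s)" for x
      by (rule dirichlet_abs_conv_mono[OF dirichlet_norm_le_imp_abs_conv[OF stB] s(3)])
    define A where "A k x = st x k / of_nat k powr s" for k x
    have tannery: "eventually (\<lambda>x. summable (\<lambda>k. norm (A k x))) sequentially \<and>
           summable (\<lambda>n. norm (w n / of_nat n powr s)) \<and>
           ((\<lambda>x. suminf (\<lambda>k. A k x)) \<longlongrightarrow> suminf (\<lambda>k. w k / of_nat k powr s)) sequentially"
    proof (rule tannerys_theorem[where M = "\<lambda>k. B' * real k powr (3 - \<sigma>)"])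
      fix k
      have "\<forall>\<^sub>F x in sequentially. A k x = w k / of_nat k powr s"
        using eventually_ge_at_top[of k]
      proof eventually_elim
        case (elim x)
        then show ?case
          using strip_primes_stable[of k x p m \<rho> g] by (cases "k = 0") (auto simp: A_def w_def st_def)
      qed
      then show "((\<lambda>x. A k x) \<longlongrightarrow> w k / of_nat k powr s) sequentially" by (rule tendsto_eventually)
    next
      have "norm (A k x) \<le> B' * real k powr (3 - \<sigma>)" for k x
      proof -
        have "norm (A k x) \<le> B' * real k powr 3 / real k powr \<sigma>"
          unfolding A_def norm_dirichlet_term s(1) using coeff[of x k] by (rule divide_right_mono) simp
        then show ?thesis by (simp add: powr_diff)
      qed
      then show "\<forall>\<^sub>F (k, x) in at_top \<times>\<^sub>F sequentially. norm (A k x) \<le> B' * real k powr (3 - \<sigma>)"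
        by (intro always_eventually) auto
      show "summable (\<lambda>k. B' * real k powr (3 - \<sigma>))"
        using \<sigma> summable_real_powr_iff[of "3 - \<sigma>"] by (intro summable_mult) auto
    qed simp
    note sm' = tannery[THEN conjunct2, THEN conjunct1]
    note lim_A = tannery[THEN conjunct2, THEN conjunct2]
    have sm: "summable (\<lambda>n. w n / of_nat n powr s)" by (rule summable_norm_cancel[OF sm'])
    have "suminf (\<lambda>k. A k x) = dirichlet_sum (st x) s" for x
      unfolding A_def using sums_unique[OF dirichlet_sums[OF abs_st]] by simp
    with lim_A have lim1: "(\<lambda>x. dirichlet_sum (st x) s) \<longlonglongrightarrow> suminf (\<lambda>k. w k / of_nat k powr s)" by simp
    have "\<forall>\<^sub>F x in sequentially. (\<Prod>i\<le>x. e i) * L s = dirichlet_sum (st x) s"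
      using eventually_ge_at_top[of p] by eventually_elim (simp add: sum_st)
    with lim have "(\<lambda>x. dirichlet_sum (st x) s) \<longlonglongrightarrow> 1" by (rule Lim_transform_eventually)
    from LIMSEQ_unique[OF lim1 this] have "suminf (\<lambda>k. w k / of_nat k powr s) = 1" .
    then show ?thesis using summable_sums[OF sm] by (simp add: s_def)
  qed
  moreover have "(\<lambda>k. (if k = 1 then 1 else 0) / of_nat k powr of_real \<sigma>) sums (1::complex)" for \<sigma> :: real
  proof -
    have "(\<lambda>k. (if k = 1 then 1 else 0) / of_nat k powr of_real \<sigma>) = (\<lambda>k. if k = 1 then (\<lambda>_. 1 :: complex) k else 0)"
      by (auto simp: fun_eq_iff)
    then show ?thesis using sums_single[of 1 "\<lambda>_. 1 :: complex"] by simp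
  qed
  moreover have "w 0 = (if (0::nat) = 1 then 1 else 0)" by (simp add: w_def st0)
  ultimately have "w = (\<lambda>k. if k = 1 then 1 else 0)"
    by (rule dirichlet_coefficients_unique[where c = 5 and f = "\<lambda>_. 1"])
  then show ?thesis by (simp add: w_def st_def g_def fun_eq_iff)
qed

text \<open>
  Removing the factors at primes \<open>q \<noteq> p\<close> combines \<open>g n\<close> with values of \<open>g\<close> at smaller multiples of \<open>p\<close>
  only, if \<open>p\<close> divides \<open>n\<close>. If those vanish, \<open>g n\<close> is unchanged by the stripping and equals the
  stripped coefficient, which is \<open>0\<close>.
\<close>
lemma removed_roots_support:
  assumes E: "polynomial_euler_product L m \<rho>" and ram: "ramanujan_bounded a"
    and L: "\<And>s. Re s > 1 \<Longrightarrow> L s = dirichlet_sum a s" and p: "prime p"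
  defines "g \<equiv> remove_roots p (\<lambda>j. \<rho> j p) m a"
  shows "g 1 = 1" and "p dvd n \<Longrightarrow> g n = 0"
proof -
  define st where "st = strip_primes p m \<rho> g"
  have st: "st n n = (if n = 1 then 1 else 0)" if "n \<ge> 1" for n
    unfolding st_def g_def by (rule stripped_coefficients[OF E ram L p that])
  have "st 1 1 = g 1" by (simp add: st_def)
  then show "g 1 = 1" using st[of 1] by simp
  have p1: "p \<ge> 1" using prime_gt_0_nat[OF p] by simp
  have rg: "ramanujan_bounded g" unfolding g_def by (rule ramanujan_bounded_remove_roots[OF ram p1])
  have main: "g n = 0" if "n \<ge> 1" "p dvd n" for n
    using that
  proof (induction n rule: less_induct)
    case (less n)
    \<comment> \<open>The invariant of the stripping: no change at \<open>n\<close>, and zeros at the smaller multiples of \<open>p\<close>.\<close>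
    define inv where "inv b \<longleftrightarrow> (\<forall>k<n. k \<ge> 1 \<longrightarrow> p dvd k \<longrightarrow> b k = 0) \<and> b n = g n" for b
    have step: "inv (remove_root q c b)" if b: "inv b" and q: "prime q" "q \<noteq> p" for q c b
    proof -
      have quot: "b (k div q) = 0" if "q dvd k" "p dvd k" "k \<ge> 1" "k \<le> n" for k
      proof -
        obtain i where i: "k = q * i" using \<open>q dvd k\<close> by auto
        have "p dvd i"
        proof -
          have "p dvd q \<or> p dvd i" using that(2) i p by (simp add: prime_dvd_mult_iff)
          moreover have "\<not> p dvd q" using primes_dvd_imp_eq[OF p q(1)] q(2) by auto
          ultimately show ?thesis by blast
        qed
        moreover have "i \<ge> 1" using that(3) i by (auto intro: Nat.gr0I simp: Suc_le_eq)
        moreover have "i < k" using prime_gt_1_nat[OF q(1)] \<open>i \<ge> 1\<close> i by simp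
        ultimately have "b i = 0" using b that(4) by (simp add: inv_def)
        then show ?thesis using i prime_gt_0_nat[OF q(1)] by simp
      qed
      show ?thesis
        using b quot less.prems by (auto simp: inv_def remove_root_def)
    qed
    have "inv (st x)" for x
    proof (induction x)
      case 0
      show ?case using less.IH by (simp add: st_def inv_def)
    next
      case (Suc x)
      show ?case
      proof (cases "prime (Suc x) \<and> Suc x \<noteq> p")
        case True
        have "inv (remove_roots (Suc x) (\<lambda>j. \<rho> j (Suc x)) i (st x))" for i
          by (induction i) (use Suc step True in auto)
        then show ?thesis using True by (simp add: st_def)
      next
        case False
        then show ?thesis using Suc by (auto simp: st_def)
      qed
    qed
    then have "st n n = g n" by (simp add: inv_def)
    moreover have "n \<noteq> 1" using less.prems p by auto
    ultimately show ?case using st[OF less.prems(1)] by simp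
  qed
  show "g n = 0" if "p dvd n"
    using main[of n] that rg by (cases "n = 0") (auto simp: ramanujan_bounded_def)
qed

lemma power_series_remove_roots:
  assumes V: "(\<lambda>i. b (p ^ i) * z ^ i) sums V" and p: "p > 1"
  shows "(\<lambda>i. remove_roots p r m b (p ^ i) * z ^ i) sums ((\<Prod>j=1..m. 1 - r j * z) * V)"
proof (induction m)
  case 0
  then show ?case using V by simp
next
  case (Suc m)
  define b' where "b' = remove_roots p r m b"
  define V' where "V' = (\<Prod>j=1..m. 1 - r j * z) * V"
  define c where "c = r (Suc m)"
  have IH: "(\<lambda>i. b' (p ^ i) * z ^ i) sums V'" using Suc by (simp add: b'_def V'_def)
  define h where "h i = (case i of 0 \<Rightarrow> 0 | Suc i \<Rightarrow> (c * z) * (b' (p ^ i) * z ^ i))" for i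
  have "(\<lambda>i. h (Suc i)) sums ((c * z) * V')" unfolding h_def by (simp only: nat.case) (rule sums_mult[OF IH])
  then have "h sums ((c * z) * V' + h 0)" by (rule sums_Suc)
  then have "(\<lambda>i. b' (p ^ i) * z ^ i - h i) sums (V' - ((c * z) * V' + h 0))" by (rule sums_diff[OF IH])
  moreover have "b' (p ^ i) * z ^ i - h i = remove_root p c b' (p ^ i) * z ^ i" for i
    using p by (cases i) (auto simp: h_def remove_root_def algebra_simps)
  ultimately show ?case by (simp add: b'_def V'_def c_def h_def algebra_simps)
qed

text \<open>
  The power series \<open>\<Sum> a (p ^ i) * z ^ i\<close> converges in the unit disc by the Ramanujan hypothesis, and
  its product with \<open>\<Prod> (1 - \<rho> j p * z)\<close> is \<open>1\<close>, because the coefficients on powers of \<open>p\<close> become those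
  of the constant \<open>1\<close>. A root of norm greater than \<open>1\<close> would give a zero of the product in
  the unit disc.
\<close>
lemma local_root_norm_le_1:
  assumes E: "polynomial_euler_product L m \<rho>" and ram: "ramanujan_bounded a"
    and L: "\<And>s. Re s > 1 \<Longrightarrow> L s = dirichlet_sum a s" and p: "prime p" and j: "j \<in> {1..m}"
  shows "norm (\<rho> j p) \<le> 1"
proof (rule ccontr)
  assume "\<not> norm (\<rho> j p) \<le> 1"
  then have big: "norm (\<rho> j p) > 1" by simp
  define z where "z = inverse (\<rho> j p)"
  define y where "y = norm z"
  have y: "y > 0" "y < 1" using big by (auto simp: y_def z_def norm_inverse inverse_less_1_iff)
  have p1: "p > 1" by (rule prime_gt_1_nat[OF p])
  \<comment> \<open>With this exponent \<open>p powr \<epsilon> * y = sqrt y\<close>, which is the ratio of a convergent geometric majorant.\<close>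
  define \<epsilon> where "\<epsilon> = - ln y / (2 * ln (real p))"
  have lnp: "ln (real p) > 0" using p1 by simp
  have \<epsilon>: "\<epsilon> > 0" using y lnp by (simp add: \<epsilon>_def divide_neg_pos)
  have pe: "real p powr \<epsilon> * y = sqrt y"
  proof -
    have "real p powr \<epsilon> = exp (- ln y / 2)" using p1 lnp by (simp add: powr_def \<epsilon>_def)
    also have "\<dots> = y powr (- 1 / 2)" using y by (simp add: powr_def)
    finally have "real p powr \<epsilon> * y = y powr (- 1 / 2) * y powr 1" using y by simp
    also have "\<dots> = y powr (- 1 / 2 + 1)" by (rule powr_add[symmetric])
    also have "- 1 / 2 + 1 = (1 / 2 :: real)" by simp
    finally show ?thesis using y by (simp add: powr_half_sqrt)
  qed
  obtain C where C: "\<forall>n\<ge>1. norm (a n) \<le> C * real n powr \<epsilon>"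
    using ram \<epsilon> unfolding ramanujan_bounded_def by blast
  have "summable (\<lambda>i. C * sqrt y ^ i)" using y by (intro summable_mult summable_geometric) auto
  then have "summable (\<lambda>i. a (p ^ i) * z ^ i)"
  proof (rule summable_comparison_test'[of _ 0])
    fix i :: nat
    have "norm (a (p ^ i)) \<le> C * real (p ^ i) powr \<epsilon>" by (rule C[rule_format]) (use p1 in simp)
    then have "norm (a (p ^ i)) * y ^ i \<le> C * real (p ^ i) powr \<epsilon> * y ^ i" using y by (intro mult_right_mono) auto
    also have "real (p ^ i) powr \<epsilon> = (real p powr \<epsilon>) ^ i"
      using p1 by (simp add: powr_realpow[symmetric] powr_powr mult.commute)
    also have "C * (real p powr \<epsilon>) ^ i * y ^ i = C * sqrt y ^ i"
      by (simp add: pe[symmetric] power_mult_distrib)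
    finally show "norm (a (p ^ i) * z ^ i) \<le> C * sqrt y ^ i" by (simp add: norm_mult norm_power y_def)
  qed
  then obtain V where V: "(\<lambda>i. a (p ^ i) * z ^ i) sums V" by (auto simp: summable_def)
  define g where "g = remove_roots p (\<lambda>j. \<rho> j p) m a"
  have g: "g 1 = 1" "\<And>n. p dvd n \<Longrightarrow> g n = 0"
    unfolding g_def by (rule removed_roots_support[OF E ram L p]; assumption)+
  have "(\<lambda>i. g (p ^ i) * z ^ i) sums ((\<Prod>j=1..m. 1 - \<rho> j p * z) * V)"
    unfolding g_def by (rule power_series_remove_roots[OF V p1])
  moreover have "(\<Prod>j=1..m. 1 - \<rho> j p * z) = 0"
  proof (rule prod_zero)
    have "\<rho> j p \<noteq> 0" using big by auto
    then have "1 - \<rho> j p * z = 0" by (simp add: z_def)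
    with j show "\<exists>j\<in>{1..m}. 1 - \<rho> j p * z = 0" by blast
  qed simp
  ultimately have "(\<lambda>i. g (p ^ i) * z ^ i) sums 0" by (simp only: mult_zero_left)
  moreover have "(\<lambda>i. g (p ^ i) * z ^ i) = (\<lambda>i. if i = 0 then (\<lambda>_. 1) i else 0)"
  proof
    fix i show "g (p ^ i) * z ^ i = (if i = 0 then (\<lambda>_. 1) i else 0)"
      using g(1) g(2)[of "p ^ i"] by (cases i) auto
  qed
  then have "(\<lambda>i. g (p ^ i) * z ^ i) sums 1" using sums_single[of 0 "\<lambda>_. 1 :: complex"] by simp
  ultimately show False using sums_unique2 by fastforce
qed

lemma dirichlet_pow_coprime:
  assumes "\<And>n. \<not> p dvd n \<Longrightarrow> g n = a n" and "\<not> p dvd n"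
  shows "dirichlet_pow g k n = dirichlet_pow a k n"
  using assms(2)
proof (induction k arbitrary: n)
  case (Suc k)
  show ?case unfolding dirichlet_pow.simps dirichlet_conv_def
  proof (rule sum.cong[OF refl])
    fix d assume "d \<in> {d. d dvd n}"
    then obtain e where e: "n = d * e" by auto
    then have d: "\<not> p dvd d" "\<not> p dvd e" using Suc.prems by auto
    have "n \<noteq> 0" using Suc.prems by (metis dvd_0_right)
    then have "n div d = e" using e by auto
    then show "g d * dirichlet_pow g k (n div d) = a d * dirichlet_pow a k (n div d)"
      using assms(1)[OF d(1)] Suc.IH[OF d(2)] by simp
  qed
qed simp

lemma dirichlet_pow_support:
  assumes p: "prime p" and g: "\<And>n. p dvd n \<Longrightarrow> g n = 0" and n: "p dvd n"
  shows "dirichlet_pow g k n = 0"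
  using n
proof (induction k arbitrary: n)
  case 0
  then show ?case using p by auto
next
  case (Suc k)
  show ?case unfolding dirichlet_pow.simps dirichlet_conv_def
  proof (rule sum.neutral, rule ballI)
    fix d assume "d \<in> {d. d dvd n}"
    then obtain e where e: "n = d * e" by auto
    show "g d * dirichlet_pow g k (n div d) = 0"
    proof (cases "p dvd d")
      case False
      then have "p dvd e" using Suc.prems e p by (simp add: prime_dvd_mult_iff)
      moreover have "n div d = e" using e False by (cases "d = 0") auto
      ultimately show ?thesis using Suc.IH by simp
    qed (simp add: g)
  qed
qed

section \<open>Generic spacings and spacings attached to a prime\<close>

lemma frequency_independent_atLeast_1:
  assumes l: "l > 0" "l \<notin> Gamma_P"
  shows "frequency_independent l {1..}"
proof -
  have pos: False if mn: "m \<ge> 1" "n \<ge> 1" "m \<noteq> n" and z: "z > 0" and eq: "l * (ln (real m) - ln (real n)) = 2 * pi * of_int z"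
    for m n :: nat and z :: int
  proof -
    have ne: "ln (real m / real n) \<noteq> 0" using mn by (simp add: ln_div)
    have "l * ln (real m / real n) = 2 * pi * of_int z" using eq mn by (simp add: ln_div)
    then have "l = 2 * pi * of_int z / ln (real m / real n)" using ne by (simp add: field_simps)
    then have "l = 2 * pi * real (nat z) / ln (real m / real n)" using z by simp
    moreover have "nat z \<ge> 1" using z by simp
    ultimately have "l \<in> Gamma_P" using mn unfolding Gamma_P_def by blast
    then show False using l by simp
  qed
  have "l * (ln (real m) - ln (real n)) \<noteq> 2 * pi * of_int z" if mn: "m \<ge> 1" "n \<ge> 1" "m \<noteq> n" for m n :: nat and z :: int
  proof
    assume eq: "l * (ln (real m) - ln (real n)) = 2 * pi * of_int z"
    consider "z > 0" | "z < 0" | "z = 0" by linarith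
    then show False
    proof cases
      case 1
      then show ?thesis using pos[OF mn _ eq] by simp
    next
      case 2
      have "l * (ln (real n) - ln (real m)) = 2 * pi * of_int (- z)" using eq by (simp add: algebra_simps)
      then show ?thesis using pos[of n m "- z"] mn 2 by simp
    next
      case 3
      then have "ln (real m) = ln (real n)" using eq l by simp
      then show ?thesis using mn by simp
    qed
  qed
  then show ?thesis unfolding frequency_independent_def by simp
qed

text \<open>
  If two characters coincide, then \<open>m ^ r = p ^ z * n ^ r\<close> for some integer \<open>z\<close>, up to exchanging
  \<open>m\<close> and \<open>n\<close>; since \<open>p\<close> does not divide \<open>m\<close>, \<open>z = 0\<close>.
\<close>
lemma frequency_independent_coprime:
  assumes p: "prime p" and r: "r \<ge> 1" and l: "l = 2 * pi * real r / ln (real p)"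
  shows "frequency_independent l {n. n \<ge> 1 \<and> \<not> p dvd n}"
proof -
  have lnp: "ln (real p) > 0" using prime_gt_1_nat[OF p] by simp
  have aux: "m = n" if mn: "m \<ge> 1" "\<not> p dvd m" "n \<ge> 1" "\<not> p dvd n" and z: "z \<ge> 0"
    and eq: "l * (ln (real m) - ln (real n)) = 2 * pi * of_int z" for m n :: nat and z :: int
  proof -
    have "2 * pi * (real r * (ln (real m) - ln (real n))) = 2 * pi * (of_int z * ln (real p))"
      using eq lnp unfolding l by (simp add: field_simps)
    then have "real r * (ln (real m) - ln (real n)) = of_int z * ln (real p)" by simp
    also have "of_int z = real (nat z)" using z by simp
    finally have "ln (real (m ^ r)) = ln (real (p ^ nat z * n ^ r))"
      using mn lnp prime_gt_0_nat[OF p] by (simp add: ln_mult ln_realpow algebra_simps)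
    then have "real (m ^ r) = real (p ^ nat z * n ^ r)"
      using mn prime_gt_0_nat[OF p] by (subst (asm) ln_inj_iff) auto
    then have e: "m ^ r = p ^ nat z * n ^ r" unfolding of_nat_eq_iff .
    have "nat z = 0"
    proof (rule ccontr)
      assume "nat z \<noteq> 0"
      then have "p dvd p ^ nat z" by simp
      then have "p dvd m ^ r" unfolding e by (rule dvd_mult2)
      then show False using prime_dvd_power[OF p] mn by blast
    qed
    then show "m = n" using e r mn power_eq_iff_eq_base[of r m n] by simp
  qed
  have "l * (ln (real m) - ln (real n)) \<noteq> 2 * pi * of_int z"
    if mn: "m \<ge> 1" "\<not> p dvd m" "n \<ge> 1" "\<not> p dvd n" "m \<noteq> n" for m n :: nat and z :: int
  proof
    assume eq: "l * (ln (real m) - ln (real n)) = 2 * pi * of_int z"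
    show False
    proof (cases "z \<ge> 0")
      case True
      then show ?thesis using aux[OF mn(1-4) True eq] mn by simp
    next
      case False
      have "l * (ln (real n) - ln (real m)) = 2 * pi * of_int (- z)" using eq by (simp add: algebra_simps)
      then show ?thesis using aux[of n m "- z"] mn False by simp
    qed
  qed
  then show ?thesis unfolding frequency_independent_def by auto
qed

text \<open>
  The half-strip of the continuation of \<open>G\<close> is cut off at \<open>Re s = 0\<close>, to the right of which \<open>P\<close> has
  no zeros.
\<close>
lemma continuation_quotient:
  assumes G: "continuable_at G z" and z: "Re z > 0"
    and P: "P holomorphic_on UNIV" "\<And>s. Re s > 0 \<Longrightarrow> P s \<noteq> 0"
    and eq: "\<And>s. Re s > 1 \<Longrightarrow> G s = P s * L s"
  shows "continuable_at L z" and "continuation L z = continuation G z / P z"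
proof -
  obtain w where w: "continuation_value G z w" using G unfolding continuable_at_def ..
  then obtain F \<gamma> t u where F: "z \<in> half_strip \<gamma> t u" "F holomorphic_on half_strip \<gamma> t u"
    "\<forall>s\<in>half_strip \<gamma> t u. Re s > 1 \<longrightarrow> F s = G s" "F z = w"
    unfolding continuation_value_def by blast
  define H where "H = half_strip (max \<gamma> 0) t u"
  have H: "H \<subseteq> half_strip \<gamma> t u" "z \<in> H" using F(1) z by (auto simp: H_def half_strip_def)
  have Hre: "Re s > 0" if "s \<in> H" for s using that by (simp add: H_def half_strip_def)
  have "(\<lambda>s. F s / P s) holomorphic_on H"
    by (rule holomorphic_on_divide[OF holomorphic_on_subset[OF F(2) H(1)] holomorphic_on_subset[OF P(1)]])
      (use Hre P(2) in auto)
  moreover have "F s / P s = L s" if s: "s \<in> H" "Re s > 1" for s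
    using F(3) H(1) s eq[OF s(2)] P(2)[OF Hre[OF s(1)]] by auto
  ultimately have "continuation_value L z (F z / P z)"
    unfolding continuation_value_def using H(2)
    by (intro exI[of _ "\<lambda>s. F s / P s"] exI[of _ "max \<gamma> 0"] exI[of _ t] exI[of _ u]) (auto simp: H_def)
  then have v: "continuation_value L z (w / P z)" unfolding F(4) .
  then show "continuable_at L z" unfolding continuable_at_def by blast
  show "continuation L z = continuation G z / P z"
    unfolding continuation_eqI[OF v] continuation_eqI[OF w] ..
qed

lemma locally_bounded_shifts_mult:
  assumes L: "locally_bounded_shifts L \<beta> l" and P: "P holomorphic_on UNIV"
    and per: "\<And>n s. P (vshift l n s) = P s" and eq: "\<And>s. Re s > 1 \<Longrightarrow> G s = P s * L s"
  shows "locally_bounded_shifts G \<beta> l"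
  unfolding locally_bounded_shifts_def
proof (intro allI impI)
  fix \<epsilon> :: real assume "\<epsilon> > 0"
  define H where "H = half_strip \<beta> (- l) (2 * l)"
  obtain J F where J: "J \<subseteq> {1..}" "lower_density J > ereal (1 - \<epsilon>)"
    and F: "\<forall>n\<in>J. F n holomorphic_on H \<and> (\<forall>s\<in>H. Re s > 1 \<longrightarrow> F n s = L (vshift l n s))"
    and bd: "\<forall>X. compact X \<longrightarrow> X \<subseteq> H \<longrightarrow> (\<exists>B. \<forall>n\<in>J. \<forall>s\<in>X. norm (F n s) \<le> B)"
    using L[unfolded locally_bounded_shifts_def, rule_format, OF \<open>\<epsilon> > 0\<close>]
    unfolding H_def[symmetric] by (elim exE conjE) (rule that)
  define F' where "F' n s = P s * F n s" for n s
  have "\<forall>n\<in>J. F' n holomorphic_on H \<and> (\<forall>s\<in>H. Re s > 1 \<longrightarrow> F' n s = G (vshift l n s))"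
  proof (intro ballI conjI impI)
    fix n assume n: "n \<in> J"
    show "F' n holomorphic_on H"
      unfolding F'_def using bspec[OF F n] P by (intro holomorphic_on_mult) (auto intro: holomorphic_on_subset)
    fix s assume s: "s \<in> H" "Re s > 1"
    then have "F n s = L (vshift l n s)" using bspec[OF F n] by blast
    moreover have "G (vshift l n s) = P (vshift l n s) * L (vshift l n s)" using s(2) by (intro eq) simp
    ultimately show "F' n s = G (vshift l n s)" by (simp only: F'_def per)
  qed
  moreover have "\<exists>B. \<forall>n\<in>J. \<forall>s\<in>X. norm (F' n s) \<le> B" if X: "compact X" "X \<subseteq> H" for X
  proof -
    obtain B where B: "\<forall>n\<in>J. \<forall>s\<in>X. norm (F n s) \<le> B" using bd X by blast
    have "compact (P ` X)"
      by (rule compact_continuous_image[OF _ X(1)])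
        (use P in \<open>auto intro: holomorphic_on_imp_continuous_on holomorphic_on_subset\<close>)
    then obtain C where C: "\<forall>x\<in>P ` X. norm x \<le> C" using compact_imp_bounded bounded_iff by metis
    have "norm (F' n s) \<le> C * B" if "n \<in> J" "s \<in> X" for n s
    proof -
      have "norm (P s) \<le> C" "norm (F n s) \<le> B" using B C that by auto
      then show ?thesis unfolding F'_def norm_mult
        using norm_ge_zero[of "P s"] norm_ge_zero[of "F n s"] by (intro mult_mono) linarith+
    qed
    then show ?thesis by blast
  qed
  ultimately show "\<exists>J \<subseteq> {1..}. lower_density J > ereal (1 - \<epsilon>) \<and>
     (\<exists>F. (\<forall>n\<in>J. F n holomorphic_on half_strip \<beta> (- l) (2 * l) \<and>
              (\<forall>s\<in>half_strip \<beta> (- l) (2 * l). Re s > 1 \<longrightarrow> F n s = G (vshift l n s))) \<and>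
          (\<forall>X. compact X \<longrightarrow> X \<subseteq> half_strip \<beta> (- l) (2 * l) \<longrightarrow>
              (\<exists>B. \<forall>n\<in>J. \<forall>s\<in>X. norm (F n s) \<le> B)))"
    using J unfolding H_def[symmetric] by (intro exI[of _ J] conjI exI[of _ F']) auto
qed

lemma uniform_limit_mult_fixed:
  fixes W :: "'a \<Rightarrow> 'b :: real_normed_algebra"
  assumes F: "uniform_limit K F G sequentially" and W: "\<And>s. s \<in> K \<Longrightarrow> norm (W s) \<le> B"
  shows "uniform_limit K (\<lambda>N s. W s * F N s) (\<lambda>s. W s * G s) sequentially"
proof (rule uniform_limitI)
  fix e :: real assume e: "e > 0"
  define B' where "B' = \<bar>B\<bar> + 1"
  have B': "B' > 0" by (simp add: B'_def)
  have "\<forall>\<^sub>F N in sequentially. \<forall>s\<in>K. dist (F N s) (G s) < e / B'"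
    by (rule uniform_limitD[OF F]) (use e B' in simp)
  then show "\<forall>\<^sub>F N in sequentially. \<forall>s\<in>K. dist (W s * F N s) (W s * G s) < e"
  proof eventually_elim
    case (elim N)
    show ?case
    proof
      fix s assume s: "s \<in> K"
      have "norm (W s * F N s - W s * G s) \<le> norm (W s) * norm (F N s - G s)"
        unfolding right_diff_distrib[symmetric] by (rule norm_mult_ineq)
      also have "\<dots> \<le> B' * norm (F N s - G s)"
        using W[OF s] by (intro mult_right_mono) (auto simp: B'_def)
      also have "\<dots> < B' * (e / B')"
        using elim s B' by (intro mult_strict_left_mono) (auto simp: dist_norm)
      finally show "dist (W s * F N s) (W s * G s) < e" using B' by (simp add: dist_norm)
    qed
  qed
qed

lemma uniform_limit_block_coordinates:
  assumes "uniform_limit (block \<alpha> l) F (\<lambda>s. G (Re s) (Im s)) sequentially"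
  shows "uniform_limit ({\<alpha>..2} \<times> {0..l}) (\<lambda>N (\<sigma>, t). F N (Complex \<sigma> t)) (\<lambda>(\<sigma>, t). G \<sigma> t) sequentially"
proof (rule uniform_limitI)
  fix e :: real assume "e > 0"
  from uniform_limitD[OF assms this]
  show "\<forall>\<^sub>F N in sequentially. \<forall>x\<in>{\<alpha>..2} \<times> {0..l}.
      dist (case x of (\<sigma>, t) \<Rightarrow> F N (Complex \<sigma> t)) (case x of (\<sigma>, t) \<Rightarrow> G \<sigma> t) < e"
  proof eventually_elim
    case (elim N)
    have "dist (F N (Complex \<sigma> t)) (G \<sigma> t) < e" if "\<sigma> \<in> {\<alpha>..2}" "t \<in> {0..l}" for \<sigma> t
      using elim[rule_format, of "Complex \<sigma> t"] that by (simp add: in_cbox_complex_iff)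
    then show ?case by auto
  qed
qed

text \<open>
  The predicate \<open>Q\<close> carries along a further statement about each exponent.
\<close>
lemma moments_outside_lset:
  fixes M2 :: "nat \<Rightarrow> real \<Rightarrow> real \<Rightarrow> real" and M1 :: "nat \<Rightarrow> real \<Rightarrow> real \<Rightarrow> complex"
  assumes l: "l > 0" and Z: "Z \<subseteq> {1..}" "has_density Z 0"
    and cont: "\<And>n s. n \<ge> 1 \<Longrightarrow> n \<notin> Z \<Longrightarrow> s \<in> block \<alpha> l \<Longrightarrow> continuable_at L (vshift l n s)"
    and lim: "\<And>k. block_moments L \<alpha> l Z k (\<lambda>s. M2 k (Re s) (Im s)) (\<lambda>s. M1 k (Re s) (Im s))"
    and Q: "\<And>k. Q k"
  shows "\<exists>A. lset_density_zero l A \<and>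
     (\<forall>n\<ge>1. real n * l \<notin> A \<longrightarrow> (\<forall>\<sigma>\<in>{\<alpha>..2}. \<forall>t\<in>{0..l}. continuable_at L (Complex \<sigma> (t + real n * l)))) \<and>
     (\<forall>k\<ge>1. Q k \<and> uniform_limit ({\<alpha>..2} \<times> {0..l})
              (\<lambda>N (\<sigma>, t). (\<Sum>n=1..N. norm (continuation L (Complex \<sigma> (t + real n * l))) ^ (2 * k)
                              * indicator (- A) (real n * l)) / real N)
              (\<lambda>(\<sigma>, t). M2 k \<sigma> t) sequentially \<and>
          uniform_limit ({\<alpha>..2} \<times> {0..l})
              (\<lambda>N (\<sigma>, t). (\<Sum>n=1..N. continuation L (Complex \<sigma> (t + real n * l)) ^ k
                              * indicator (- A) (real n * l)) / of_nat N)
              (\<lambda>(\<sigma>, t). M1 k \<sigma> t) sequentially)"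
proof -
  define A where "A = (\<Union>n\<in>Z. {real n * l ..< real (n + 1) * l})"
  have A_iff: "real n * l \<in> A \<longleftrightarrow> n \<in> Z" for n
  proof
    assume "real n * l \<in> A"
    then obtain n' where n': "n' \<in> Z" "real n' * l \<le> real n * l" "real n * l < real (n' + 1) * l"
      by (auto simp: A_def)
    have "n' \<le> n" "n < n' + 1" using n'(2,3) l by simp_all
    then have "n = n'" by simp
    with n'(1) show "n \<in> Z" by simp
  next
    assume "n \<in> Z"
    then show "real n * l \<in> A" using l by (auto simp: A_def intro!: bexI[of _ n])
  qed
  have sh: "Complex \<sigma> (t + real n * l) = vshift l n (Complex \<sigma> t)" for \<sigma> t n by (simp add: complex_eq_iff)
  have lset: "lset_density_zero l A"
    unfolding lset_density_zero_def using Z by (intro exI[of _ Z]) (simp add: A_def)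
  have ca: "continuable_at L (Complex \<sigma> (t + real n * l))"
    if "n \<ge> 1" "real n * l \<notin> A" "\<sigma> \<in> {\<alpha>..2}" "t \<in> {0..l}" for n \<sigma> t
    unfolding sh by (rule cont) (use that in \<open>auto simp: A_iff in_cbox_complex_iff\<close>)
  have ind: "indicator (- A) (real n * l) = (if n \<in> Z then 0 else 1 :: 'b :: zero_neq_one)" for n
    using A_iff[of n] by (simp add: indicator_def)
  have s2: "norm (continuation L (Complex \<sigma> (t + real n * l))) ^ (2 * k) * indicator (- A) (real n * l)
      = (norm (if n \<in> Z then 0 else continuation L (vshift l n (Complex \<sigma> t)) ^ k))\<^sup>2" for \<sigma> t k n
    unfolding sh ind by (cases "n \<in> Z") (simp_all add: norm_power power_mult[symmetric] mult.commute)
  have s1: "continuation L (Complex \<sigma> (t + real n * l)) ^ k * indicator (- A) (real n * l)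
      = (if n \<in> Z then 0 else continuation L (vshift l n (Complex \<sigma> t)) ^ k)" for \<sigma> t k n
    unfolding sh ind by simp
  show ?thesis
  proof (intro exI[of _ A] conjI allI impI ballI lset)
    fix k
    show "uniform_limit ({\<alpha>..2} \<times> {0..l})
              (\<lambda>N (\<sigma>, t). (\<Sum>n=1..N. norm (continuation L (Complex \<sigma> (t + real n * l))) ^ (2 * k)
                              * indicator (- A) (real n * l)) / real N)
              (\<lambda>(\<sigma>, t). M2 k \<sigma> t) sequentially"
      unfolding s2 by (rule uniform_limit_block_coordinates[OF lim[unfolded block_moments_def, THEN conjunct1]])
    show "uniform_limit ({\<alpha>..2} \<times> {0..l})
              (\<lambda>N (\<sigma>, t). (\<Sum>n=1..N. continuation L (Complex \<sigma> (t + real n * l)) ^ k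
                              * indicator (- A) (real n * l)) / of_nat N)
              (\<lambda>(\<sigma>, t). M1 k \<sigma> t) sequentially"
      unfolding s1 by (rule uniform_limit_block_coordinates[OF lim[unfolded block_moments_def, THEN conjunct2]])
  qed (rule ca Q; assumption)+
qed

lemma euler_factor_vshift:
  assumes p: "prime p" and l: "l = 2 * pi * real r / ln (real p)"
  shows "of_nat p powr vshift l n s = (of_nat p powr s :: complex)"
proof -
  have p1: "p > 1" by (rule prime_gt_1_nat[OF p])
  then have lnp: "ln (real p) > 0" by simp
  have "of_nat p powr vshift l n s = exp (vshift l n s * of_real (ln (real p)))"
    using p1 by (simp add: powr_def Ln_of_nat)
  also have "vshift l n s * of_real (ln (real p)) = s * of_real (ln (real p)) + 2 * of_real pi * \<i> * of_nat (n * r)"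
  proof -
    have "l * ln (real p) = 2 * pi * real r" using lnp by (simp add: l)
    then have "real n * l * ln (real p) = 2 * pi * real (n * r)" by simp
    then have "complex_of_real (real n * l * ln (real p)) = of_real (2 * pi * real (n * r))" by (rule arg_cong)
    then have "complex_of_real (real n * l) * of_real (ln (real p)) = 2 * of_real pi * of_nat (n * r)" by simp
    then have "\<i> * (complex_of_real (real n * l) * of_real (ln (real p))) = \<i> * (2 * of_real pi * of_nat (n * r))"
      by (rule arg_cong)
    then show ?thesis by (simp only: distrib_right mult.assoc mult.left_commute[of \<i>])
  qed
  also have "exp (s * of_real (ln (real p)) + 2 * of_real pi * \<i> * of_nat (n * r)) = exp (s * of_real (ln (real p)))"
    using exp_integer_2pi[of "of_nat (n * r)"] by (simp add: exp_add mult_ac)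
  also have "\<dots> = of_nat p powr s" using p1 by (simp add: powr_def Ln_of_nat)
  finally show ?thesis .
qed

text \<open>
  The function \<open>G = P * L\<close> is \<open>L\<close> without its Euler factor at \<open>p\<close>. Its powers have the coefficients of
  the powers of \<open>L\<close> at integers prime to \<open>p\<close> and vanishing coefficients elsewhere. As \<open>P\<close> has period
  \<open>i l\<close>, the moments of \<open>L\<close> are those of \<open>G\<close> times a power of \<open>inverse (P s)\<close> that does not depend
  on \<open>n\<close>.
\<close>
lemma moments_at_prime_spacing:
  assumes l: "l > 0" and \<alpha>: "1 / 2 < \<beta>" "\<beta> < \<alpha>" "\<alpha> \<le> 1"
    and ram: "ramanujan_bounded a" and L: "\<And>s. Re s > 1 \<Longrightarrow> L s = dirichlet_sum a s"
    and lb: "locally_bounded_shifts L \<beta> l"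
    and E: "polynomial_euler_product L m \<rho>" and p: "prime p" and r: "r \<ge> 1"
    and lp: "l = 2 * pi * real r / ln (real p)"
  defines "P \<equiv> \<lambda>s. \<Prod>j=1..m. 1 - \<rho> j p / of_nat p powr s"
  shows "\<exists>Z \<subseteq> {1..}. has_density Z 0 \<and>
    (\<forall>n\<ge>1. n \<notin> Z \<longrightarrow> (\<forall>s\<in>block \<alpha> l. continuable_at L (vshift l n s))) \<and>
    (\<forall>k. block_moments L \<alpha> l Z k
        (\<lambda>s. (norm (inverse (P s) ^ k))\<^sup>2 *
           (\<Sum>\<^sub>\<infinity>n\<in>{n. n \<ge> 1 \<and> \<not> p dvd n}. (norm (dirichlet_pow a k n))\<^sup>2 / real n powr (2 * Re s)))
        (\<lambda>s. inverse (P s) ^ k * dirichlet_pow a k 1))"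
proof -
  define g where "g = remove_roots p (\<lambda>j. \<rho> j p) m a"
  define G where "G s = P s * L s" for s
  define S where "S = {n. n \<ge> 1 \<and> \<not> p dvd n}"
  have p1: "p > 1" by (rule prime_gt_1_nat[OF p])
  have rg: "ramanujan_bounded g" unfolding g_def using p1 by (intro ramanujan_bounded_remove_roots ram) simp
  have G: "G s = dirichlet_sum g s" if "Re s > 1" for s
    unfolding G_def P_def g_def
    using dirichlet_sum_remove_roots[OF ramanujan_bounded_abs_conv[OF ram that], of p] p1 L[OF that] by simp
  have P_hol: "P holomorphic_on UNIV" unfolding P_def using p1 by (intro holomorphic_intros) auto
  have P_nz: "P s \<noteq> 0" if s: "Re s > 0" for s
  proof -
    have "1 - \<rho> j p / of_nat p powr s \<noteq> 0" if j: "j \<in> {1..m}" for j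
    proof
      assume "1 - \<rho> j p / of_nat p powr s = 0"
      then have "norm (\<rho> j p / of_nat p powr s) = 1" by simp
      then have "norm (\<rho> j p) = real p powr Re s"
        using norm_dirichlet_term[of "\<lambda>_. \<rho> j p" p s] p1 by (simp add: divide_simps)
      moreover have "real p powr Re s > 1" using p1 s by (intro gr_one_powr) auto
      ultimately show False using local_root_norm_le_1[OF E ram L p j] by simp
    qed
    then show ?thesis unfolding P_def prod_zero_iff[OF finite_atLeastAtMost] by blast
  qed
  have P_per: "P (vshift l n s) = P s" for n s
    unfolding P_def euler_factor_vshift[OF p lp] ..
  have lbG: "locally_bounded_shifts G \<beta> l"
    by (rule locally_bounded_shifts_mult[OF lb P_hol P_per]) (simp add: G_def)
  have FS: "frequency_independent l S" unfolding S_def by (rule frequency_independent_coprime[OF p r lp])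
  have S1: "1 \<in> S" using p1 by (simp add: S_def)
  have gp: "g n = 0" if "p dvd n" for n unfolding g_def by (rule removed_roots_support(2)[OF E ram L p that])
  have supp: "dirichlet_pow g k n = 0" if "n \<notin> S" for k n
  proof (cases "p dvd n")
    case True
    then show ?thesis using gp by (intro dirichlet_pow_support[OF p])
  next
    case False
    then have "n = 0" using that by (simp add: S_def)
    then show ?thesis using False by simp
  qed
  have ga: "dirichlet_pow g k n = dirichlet_pow a k n" if "n \<in> S" for k n
    by (rule dirichlet_pow_coprime[of p]) (use that in \<open>auto simp: g_def S_def remove_roots_coprime\<close>)
  have sums: "(\<Sum>\<^sub>\<infinity>n. (norm (dirichlet_pow g k n))\<^sup>2 / real n powr (2 * Re s))
      = (\<Sum>\<^sub>\<infinity>n\<in>S. (norm (dirichlet_pow a k n))\<^sup>2 / real n powr (2 * Re s))" for k s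
    by (rule infsum_cong_neutral) (auto simp: supp ga)
  obtain Z where Z: "Z \<subseteq> {1..}" "has_density Z 0" and cb: "\<forall>n\<ge>1. n \<notin> Z \<longrightarrow> continuable_block G \<alpha> l n"
    and lims: "\<forall>k. block_moments G \<alpha> l Z k
        (\<lambda>s. \<Sum>\<^sub>\<infinity>m. (norm (dirichlet_pow g k m))\<^sup>2 / real m powr (2 * Re s))
        (\<lambda>s. dirichlet_pow g k 1)"
    by (rule exE[OF moments_along_density_one_set[OF l \<alpha> rg G lbG FS S1 supp]])
      (assumption | (elim conjE, rule that))+
  have re: "Re s > 0" if "s \<in> block \<alpha> l" for s using that \<alpha> by (simp add: in_cbox_complex_iff)
  have transfer: "continuable_at L (vshift l n s)" "continuation L (vshift l n s) = inverse (P s) * continuation G (vshift l n s)"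
    if "n \<ge> 1" "n \<notin> Z" "s \<in> block \<alpha> l" for n s
  proof -
    have c: "continuable_at G (vshift l n s)" using cb that by (simp add: continuable_block_def)
    have rv: "Re (vshift l n s) > 0" using re[OF that(3)] by simp
    note * = continuation_quotient[OF c rv P_hol P_nz G_def]
    show "continuable_at L (vshift l n s)" by (rule *(1)) assumption
    have "continuation L (vshift l n s) = continuation G (vshift l n s) / P (vshift l n s)" by (rule *(2)) assumption
    then show "continuation L (vshift l n s) = inverse (P s) * continuation G (vshift l n s)"
      unfolding P_per by (simp add: divide_inverse mult.commute)
  qed
  have "compact ((\<lambda>s. inverse (P s)) ` block \<alpha> l)"
  proof (rule compact_continuous_image[OF _ compact_cbox], rule continuous_on_inverse)
    show "continuous_on (block \<alpha> l) P"
      using P_hol by (auto intro: holomorphic_on_imp_continuous_on holomorphic_on_subset)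
  qed (use re P_nz in blast)
  then obtain C where C: "\<forall>x\<in>(\<lambda>s. inverse (P s)) ` block \<alpha> l. norm x \<le> C"
    using compact_imp_bounded bounded_iff by metis
  have Wk: "norm (inverse (P s) ^ k) \<le> C ^ k" if "s \<in> block \<alpha> l" for s k
    unfolding norm_power using C that by (intro power_mono) auto
  have scaled: "(if n \<in> Z then 0 else continuation L (vshift l n s) ^ k)
      = inverse (P s) ^ k * (if n \<in> Z then 0 else continuation G (vshift l n s) ^ k)"
    if "n \<ge> 1" "s \<in> block \<alpha> l" for n s k
    using transfer(2)[OF that(1) _ that(2)] by (simp add: power_mult_distrib)
  have lim2: "uniform_limit (block \<alpha> l)
        (\<lambda>N s. (\<Sum>n=1..N. (norm (if n \<in> Z then 0 else continuation L (vshift l n s) ^ k))\<^sup>2) / real N)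
        (\<lambda>s. (norm (inverse (P s) ^ k))\<^sup>2 *
           (\<Sum>\<^sub>\<infinity>n\<in>S. (norm (dirichlet_pow a k n))\<^sup>2 / real n powr (2 * Re s))) sequentially" for k
  proof -
    have "uniform_limit (block \<alpha> l)
        (\<lambda>N s. (norm (inverse (P s) ^ k))\<^sup>2 *
          ((\<Sum>n=1..N. (norm (if n \<in> Z then 0 else continuation G (vshift l n s) ^ k))\<^sup>2) / real N))
        (\<lambda>s. (norm (inverse (P s) ^ k))\<^sup>2 *
          (\<Sum>\<^sub>\<infinity>n\<in>S. (norm (dirichlet_pow a k n))\<^sup>2 / real n powr (2 * Re s))) sequentially"
    proof (rule uniform_limit_mult_fixed)
      show "norm ((norm (inverse (P s) ^ k))\<^sup>2) \<le> (C ^ k)\<^sup>2" if "s \<in> block \<alpha> l" for s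
        using power_mono[OF Wk[OF that, of k] norm_ge_zero, of 2] by (simp only: real_norm_def abs_power2)
    qed (use lims[rule_format, of k, unfolded block_moments_def] in \<open>simp only: sums\<close>)
    moreover have "(norm (inverse (P s) ^ k))\<^sup>2 *
          ((\<Sum>n=1..N. (norm (if n \<in> Z then 0 else continuation G (vshift l n s) ^ k))\<^sup>2) / real N)
       = (\<Sum>n=1..N. (norm (if n \<in> Z then 0 else continuation L (vshift l n s) ^ k))\<^sup>2) / real N"
      if s: "s \<in> block \<alpha> l" for N s
    proof -
      have "(\<Sum>n=1..N. (norm (if n \<in> Z then 0 else continuation L (vshift l n s) ^ k))\<^sup>2)
        = (\<Sum>n=1..N. (norm (inverse (P s) ^ k))\<^sup>2 * (norm (if n \<in> Z then 0 else continuation G (vshift l n s) ^ k))\<^sup>2)"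
      proof (rule sum.cong[OF refl])
        fix n assume "n \<in> {1..N}"
        then have "n \<ge> 1" by simp
        show "(norm (if n \<in> Z then 0 else continuation L (vshift l n s) ^ k))\<^sup>2
          = (norm (inverse (P s) ^ k))\<^sup>2 * (norm (if n \<in> Z then 0 else continuation G (vshift l n s) ^ k))\<^sup>2"
          unfolding scaled[OF \<open>n \<ge> 1\<close> s] norm_mult power_mult_distrib ..
      qed
      then show ?thesis by (simp only: sum_distrib_left[symmetric] times_divide_eq_right)
    qed
    ultimately show ?thesis by (rule uniform_limit_cong'[THEN iffD1, rotated 2]) (assumption | rule refl)+
  qed
  have lim1: "uniform_limit (block \<alpha> l)
        (\<lambda>N s. (\<Sum>n=1..N. if n \<in> Z then 0 else continuation L (vshift l n s) ^ k) / of_nat N)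
        (\<lambda>s. inverse (P s) ^ k * dirichlet_pow a k 1) sequentially" for k
  proof -
    have "uniform_limit (block \<alpha> l)
        (\<lambda>N s. inverse (P s) ^ k * ((\<Sum>n=1..N. if n \<in> Z then 0 else continuation G (vshift l n s) ^ k) / of_nat N))
        (\<lambda>s. inverse (P s) ^ k * dirichlet_pow a k 1) sequentially"
      by (rule uniform_limit_mult_fixed[OF _ Wk]) (use lims[rule_format, of k, unfolded block_moments_def] ga[OF S1] in \<open>simp_all only:\<close>)
    moreover have "inverse (P s) ^ k * ((\<Sum>n=1..N. if n \<in> Z then 0 else continuation G (vshift l n s) ^ k) / of_nat N)
       = (\<Sum>n=1..N. if n \<in> Z then 0 else continuation L (vshift l n s) ^ k) / of_nat N"
      if s: "s \<in> block \<alpha> l" for N s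
    proof -
      have "(\<Sum>n=1..N. if n \<in> Z then 0 else continuation L (vshift l n s) ^ k)
        = (\<Sum>n=1..N. inverse (P s) ^ k * (if n \<in> Z then 0 else continuation G (vshift l n s) ^ k))"
        by (rule sum.cong[OF refl], rule scaled[OF _ s]) simp
      then show ?thesis by (simp only: sum_distrib_left[symmetric] times_divide_eq_right)
    qed
    ultimately show ?thesis by (rule uniform_limit_cong'[THEN iffD1, rotated 2]) (assumption | rule refl)+
  qed
  show ?thesis
    unfolding S_def[symmetric] block_moments_def
    by (intro exI[of _ Z] conjI allI impI ballI Z lim2 lim1) (rule transfer(1))
qed

theorem corollary9p3:
  fixes u \<alpha> l :: real and L :: "complex \<Rightarrow> complex"
  assumes "1 / 2 \<le> u" and "u < 1" and "L \<in> class_N u"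
    and "ramanujan_hypothesis L"
    and "u < \<alpha>" and "\<alpha> \<le> 1" and "l > 0"
  shows
    "(l \<notin> Gamma_P \<longrightarrow>
      (\<exists>A. lset_density_zero l A \<and>
         (\<forall>n\<ge>1. real n * l \<notin> A \<longrightarrow>
            (\<forall>\<sigma>\<in>{\<alpha>..2}. \<forall>t\<in>{0..l}. continuable_at L (Complex \<sigma> (t + real n * l)))) \<and>
         (\<forall>k\<ge>1.
            (\<forall>\<sigma>\<in>{\<alpha>..2}. (\<lambda>n. (norm (dirichlet_coeffs (\<lambda>s. L s ^ k) n))\<^sup>2 / real n powr (2 * \<sigma>))
               summable_on {1..}) \<and>
            uniform_limit ({\<alpha>..2} \<times> {0..l})
              (\<lambda>N (\<sigma>, t). (\<Sum>n=1..N. norm (continuation L (Complex \<sigma> (t + real n * l))) ^ (2 * k)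
                              * indicator (- A) (real n * l)) / real N)
              (\<lambda>(\<sigma>, t). \<Sum>\<^sub>\<infinity>n\<in>{1..}.
                 (norm (dirichlet_coeffs (\<lambda>s. L s ^ k) n))\<^sup>2 / real n powr (2 * \<sigma>))
              sequentially \<and>
            uniform_limit ({\<alpha>..2} \<times> {0..l})
              (\<lambda>N (\<sigma>, t). (\<Sum>n=1..N. continuation L (Complex \<sigma> (t + real n * l)) ^ k
                              * indicator (- A) (real n * l)) / of_nat N)
              (\<lambda>(\<sigma>, t). dirichlet_coeffs (\<lambda>s. L s ^ k) 1)
              sequentially)))
     \<and>
     (\<forall>m \<rho> r p. polynomial_euler_product L m \<rho> \<and> r \<ge> 1 \<and> prime p \<and>
        l = 2 * pi * real r / ln (real p) \<longrightarrow>
      (\<exists>A. lset_density_zero l A \<and>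
         (\<forall>n\<ge>1. real n * l \<notin> A \<longrightarrow>
            (\<forall>\<sigma>\<in>{\<alpha>..2}. \<forall>t\<in>{0..l}. continuable_at L (Complex \<sigma> (t + real n * l)))) \<and>
         (\<forall>k\<ge>1.
            (\<forall>\<sigma>\<in>{\<alpha>..2}. (\<lambda>n. (norm (dirichlet_coeffs (\<lambda>s. L s ^ k) n))\<^sup>2 / real n powr (2 * \<sigma>))
               summable_on {n. n \<ge> 1 \<and> \<not> p dvd n}) \<and>
            uniform_limit ({\<alpha>..2} \<times> {0..l})
              (\<lambda>N (\<sigma>, t). (\<Sum>n=1..N. norm (continuation L (Complex \<sigma> (t + real n * l))) ^ (2 * k)
                              * indicator (- A) (real n * l)) / real N)
              (\<lambda>(\<sigma>, t). norm (\<Prod>j=1..m.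
                    (1 - \<rho> j p / of_nat p powr Complex \<sigma> t) powi (- 2 * int k))
                 * (\<Sum>\<^sub>\<infinity>n\<in>{n. n \<ge> 1 \<and> \<not> p dvd n}.
                      (norm (dirichlet_coeffs (\<lambda>s. L s ^ k) n))\<^sup>2 / real n powr (2 * \<sigma>)))
              sequentially \<and>
            uniform_limit ({\<alpha>..2} \<times> {0..l})
              (\<lambda>N (\<sigma>, t). (\<Sum>n=1..N. continuation L (Complex \<sigma> (t + real n * l)) ^ k
                              * indicator (- A) (real n * l)) / of_nat N)
              (\<lambda>(\<sigma>, t). dirichlet_coeffs (\<lambda>s. L s ^ k) 1
                 * (\<Prod>j=1..m. (1 - \<rho> j p / of_nat p powr Complex \<sigma> t) powi (- int k)))
              sequentially)))"
proof -
  obtain a where a: "has_dirichlet_series L a" using assms(3) unfolding class_N_def by blast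
  have ram: "ramanujan_bounded a" by (rule ramanujan_hypothesis_imp_bounded[OF assms(4) a])
  have L: "L s = dirichlet_sum a s" if "Re s > 1" for s
    by (rule has_dirichlet_series_imp_dirichlet_sum[OF a ram that])
  have coeffs: "dirichlet_coeffs (\<lambda>s. L s ^ k) = dirichlet_pow a k" for k
    by (rule dirichlet_coeffs_power[OF a ram])
  \<comment> \<open>Room between \<open>\<beta>\<close> and \<open>\<alpha>\<close> lets the closed block lie inside the strip of continuation.\<close>
  define \<beta> where "\<beta> = (u + \<alpha>) / 2"
  have \<beta>: "u < \<beta>" "\<beta> \<le> 1" and \<alpha>: "1 / 2 < \<beta>" "\<beta> < \<alpha>" "\<alpha> \<le> 1"
    using assms by (auto simp: \<beta>_def)
  have lb: "locally_bounded_shifts L \<beta> l"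
    by (rule class_N_imp_locally_bounded_shifts[OF assms(3) ram L \<beta> assms(7)])
  have square_summable: "(\<lambda>n. (norm (dirichlet_pow a k n))\<^sup>2 / real n powr (2 * \<sigma>)) summable_on X"
    if "\<sigma> \<in> {\<alpha>..2}" for k \<sigma> X
    using ramanujan_bounded_square_summable[OF ramanujan_bounded_pow[OF ram], of \<sigma> k] that \<alpha>
    by (auto intro: summable_on_subset_banach)
  show ?thesis unfolding coeffs
  proof (intro conjI impI allI, goal_cases)
    case 1
    have S: "frequency_independent l {1..}" by (rule frequency_independent_atLeast_1[OF assms(7) 1])
    have supp: "dirichlet_pow a k m = 0" if "m \<notin> {1..}" for k m
    proof -
      have "m = 0" using that by (cases m) auto
      then show ?thesis using ramanujan_bounded_pow[OF ram, of k] by (simp add: ramanujan_bounded_def)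
    qed
    have S1: "(1::nat) \<in> {1..}" by simp
    have sums: "(\<Sum>\<^sub>\<infinity>n. (norm (dirichlet_pow a k n))\<^sup>2 / real n powr (2 * Re s))
        = (\<Sum>\<^sub>\<infinity>n\<in>{1..}. (norm (dirichlet_pow a k n))\<^sup>2 / real n powr (2 * Re s))" for k s
      by (rule infsum_cong_neutral) (auto simp: Suc_le_eq)
    obtain Z where Z: "Z \<subseteq> {1..}" "has_density Z 0" and cb: "\<forall>n\<ge>1. n \<notin> Z \<longrightarrow> continuable_block L \<alpha> l n"
      and lims: "\<forall>k. block_moments L \<alpha> l Z k
        (\<lambda>s. \<Sum>\<^sub>\<infinity>m. (norm (dirichlet_pow a k m))\<^sup>2 / real m powr (2 * Re s))
        (\<lambda>s. dirichlet_pow a k 1)"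
      by (rule exE[OF moments_along_density_one_set[OF assms(7) \<alpha> ram L lb S S1 supp]])
        (assumption | (elim conjE, rule that))+
    show ?case
    proof (rule moments_outside_lset[OF assms(7) Z])
      show "continuable_at L (vshift l n s)" if "n \<ge> 1" "n \<notin> Z" "s \<in> block \<alpha> l" for n s
        using cb that by (simp add: continuable_block_def)
    qed ((use lims in \<open>simp_all only: sums\<close>), use square_summable in blast)
  next
    case (2 m \<rho> r p)
    then have E: "polynomial_euler_product L m \<rho>" "prime p" "r \<ge> 1" "l = 2 * pi * real r / ln (real p)"
      by auto
    define P where "P s = (\<Prod>j=1..m. 1 - \<rho> j p / of_nat p powr s)" for s
    have powi: "(\<Prod>j=1..m. (1 - \<rho> j p / of_nat p powr s) powi (- int k)) = inverse (P s) ^ k" for s k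
      unfolding P_def power_int_minus power_int_of_nat
      by (simp add: prod_inversef[symmetric] o_def prod_power_distrib power_inverse)
    have powi2: "norm (\<Prod>j=1..m. (1 - \<rho> j p / of_nat p powr s) powi (- 2 * int k)) = (norm (inverse (P s) ^ k))\<^sup>2" for s k
    proof -
      have "- 2 * int k = - int (k * 2)" by simp
      then show ?thesis by (simp only: powi norm_power power_mult)
    qed
    obtain Z where Z: "Z \<subseteq> {1..}" "has_density Z 0"
      and cb: "\<forall>n\<ge>1. n \<notin> Z \<longrightarrow> (\<forall>s\<in>block \<alpha> l. continuable_at L (vshift l n s))"
      and lims: "\<forall>k. block_moments L \<alpha> l Z k
        (\<lambda>s. (norm (inverse (P s) ^ k))\<^sup>2 *
           (\<Sum>\<^sub>\<infinity>n\<in>{n. n \<ge> 1 \<and> \<not> p dvd n}. (norm (dirichlet_pow a k n))\<^sup>2 / real n powr (2 * Re s)))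
        (\<lambda>s. inverse (P s) ^ k * dirichlet_pow a k 1)"
      by (rule exE[OF moments_at_prime_spacing[OF assms(7) \<alpha> ram L lb E, folded P_def]])
        (assumption | (elim conjE, rule that))+
    show ?case unfolding powi powi2
    proof (rule moments_outside_lset[OF assms(7) Z])
      show "continuable_at L (vshift l n s)" if "n \<ge> 1" "n \<notin> Z" "s \<in> block \<alpha> l" for n s
        using cb that by blast
    qed ((use lims in \<open>simp_all only: complex.collapse mult.commute[of "dirichlet_pow a _ 1"]\<close>),
        use square_summable in blast)
  qed
qed

end
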